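(* Let $K$ be an algebraically closed field of characteristic different from $2$. Let $n\ge2$, $1\le k<n$, $d_1=(n-1)(2^k-1)$ and $d=k+2d_1$. With $N_n(K)$, $V$, $\vartheta_K:N_n(K)^{d,*}\to V$ and $\varepsilon_K:V\to\mathbb F_2$ as in the context, the following hold. (1) $\vartheta_K\bigl(A_{K,+}^\sharp(N_n(K))\cap N_n(K)^{d,*}\bigr)=\ker(\varepsilon_K)$; equivalently, the sequence $0\to\vartheta_K\bigl(A_{K,+}^\sharp(N_n(K))\cap N_n(K)^{d,*}\bigr)\to V\xrightarrow{\varepsilon_K}\mathbb F_2\to0$ is exact, so that $V/\vartheta_K\bigl(A_{K,+}^\sharp(N_n(K))\cap N_n(K)^{d,*}\bigr)\cong\mathbb F_2$. If $u\in N_n(K)^{d,*}$ satisfies $\varepsilon_K(\vartheta_K(u))=1$, then $u\notin A_{K,+}^\sharp(N_n(K))$. (2) If $S\subset\mathrm{Mono}(k)$ has odd cardinality, then the class of $\sum_{\sigma\in S}\sigma(z_k)$ is nonzero in $QN_n^{d,*}(K)=N_n(K)^{d,*}/\bigl(A_{K,+}^\sharp(N_n(K))\cap N_n(K)^{d,*}\bigr)$. (3) In particular, if $S\subset\mathrm{Mono}(k)$ has odd cardinality, then $u_S=\sum_{\sigma\in S}\sigma(z_k)\in M_n(K)_{d,*}$ represents a nonzero class in $QM_n^{d,*}(K)$.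
   Context: Motivic setting. For $K$ algebraically closed with $\operatorname{char}(K)\ne2$, $M_n(K)=H^{*,*}(BV_n/K;\mathbb F_2)$ is the mod $2$ motivic cohomology of the classifying space of the elementary abelian $2$-group $V_n$ of rank $n$, and $$M_n(K)\cong\mathbb F_2[\tau,x_1,\dots,x_n,y_1,\dots,y_n]/(x_1^2+\tau y_1,\dots,x_n^2+\tau y_n),$$ $|\tau|=(0,1)$, $|x_i|=(1,1)$, $|y_i|=(2,1)$. $M_n(K)_{d,*}$ is the part of topological (first) degree $d$. $A_K^{*,*}$ is the mod $2$ motivic Steenrod algebra over $K$ (generated over $H^{*,*}(\operatorname{Spec}K;\mathbb F_2)=\mathbb F_2[\tau]$ by the Bockstein $Q_0$ and reduced powers $\mathcal P^a$), $A_{K,+}^{*,*}$ its homogeneous positive-degree part (bidegrees $(p,q)$ with $p+q>0$), $A_{K,+}^{*,*}(M_n(K))$ the subspace generated by values of these operations on $M_n(K)$, and $QM_n^{d,*}(K)=M_n(K)_{d,*}/\bigl(A_{K,+}^{*,*}(M_n(K))\cap M_n(K)_{d,*}\bigr)$. Reduction mod $\tau$. $N_n(K)=M_n(K)/(\tau)=\Lambda_n\otimes Y_n$ with $\Lambda_n=\Lambda(x_1,\dots,x_n)$ exterior over $\mathbb F_2$ and $Y_n=\mathbb F_2[y_1,\dots,y_n]$; topological degrees $|x_i|=1$, $|y_i|=2$. $N_n(K)^{d,*}$ is the part of topological degree $d$, $\Lambda_n^a$ the part of exterior degree $a$, $Y_n^{2b}$ the part of polynomial degree $b$; $\mathrm{pr}_k:N_n(K)^{d,*}=\bigoplus_{a+2b=d}\Lambda_n^a\otimes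 Y_n^{2b}\to\Lambda_n^k\otimes Y_n^{2d_1}$ is the projection. $A_K^\sharp=A_K^{*,*}/(\tau)$ is generated by $Q_0$ and $\mathcal P^a$ ($a\ge1$), acting on $N_n(K)$ by: $Q_0$ is the derivation with $Q_0(x_i)=y_i$, $Q_0(y_i)=0$; $\mathcal P^a(\lambda y)=\lambda\mathcal P^a(y)$ for $\lambda\in\Lambda_n$, $y\in Y_n$, with $\mathcal P^a$ on $Y_n$ determined by the Cartan formula $\mathcal P^a(fg)=\sum_{i+j=a}\mathcal P^i(f)\mathcal P^j(g)$ ($\mathcal P^0=\mathrm{id}$), $\mathcal P^1(y_i)=y_i^2$, $\mathcal P^a(y_i)=0$ for $a\ge2$. $A_{K,+}^\sharp$ is its homogeneous positive-degree part and $A_{K,+}^\sharp(N_n(K))$ the span of the values of its elements on $N_n(K)$. $P^+(Y_n)$ is the span of all values on $Y_n$ of positive-degree elements of the subalgebra generated by the $\mathcal P^a$. Local projection. For a monomial $y=y_1^{e_1}\cdots y_n^{e_n}$ write $2e_i=\sum_{j\ge0}\alpha_{ij}2^j$ ($\alpha_{ij}\in\{0,1\}$) and $\omega_j(y)=\sum_i\alpha_{ij}$. $G_n\subset Y_n$ is spanned by $P^+(Y_n)$ and all monomials $y$ with $(\omega_1(y),\dots,\omega_k(y))<(n-1,\dots,n-1)$ lexicographically. $\pi:\Lambda_n^k\otimes Y_n^{2d_1}\to\Lambda_n^k\otimes(Y_n/G_n)^{2d_1}$ is the quotient map. $\mathrm{Mono}(k)$ is the set of strictly increasing maps $\sigma:\{1,\dots,k\}\to\{1,\dots,n\}$,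 and $$\sigma(z_k)=x_{\sigma(1)}\cdots x_{\sigma(k)}\Bigl(\prod_{j=1}^k y_{\sigma(j)}^{2^k-2^{k-j}-1}\Bigr)\Bigl(\prod_{i\notin\mathrm{im}(\sigma)}y_i^{2^k-1}\Bigr)$$ (regarded in $M_n(K)$ or $N_n(K)$). Put $M_1=\{\sigma(z_k)\mid\sigma\in\mathrm{Mono}(k)\}$. $M_0$ is a set of monomials in $\Lambda_n^k\otimes Y_n^{2d_1}$, disjoint from $M_1$, such that the $\pi(m)$, $m\in M_0\cup M_1$, are pairwise distinct and form a basis of $\Lambda_n^k\otimes(Y_n/G_n)^{2d_1}$ (such a set was constructed by Kameko). $U_0=\langle\pi(M_0)\rangle$, $V=\langle\pi(M_1)\rangle$; $p_{M_1}$ is the projection of $U_0\oplus V=\Lambda_n^k\otimes(Y_n/G_n)^{2d_1}$ onto $V$ with kernel $U_0$; $\vartheta_K=p_{M_1}\circ\pi\circ\mathrm{pr}_k$; and $\varepsilon_K\bigl(\sum_\sigma c_\sigma\pi(\sigma(z_k))\bigr)=\sum_\sigma c_\sigma$. *)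

theory Defs
  imports
    "HOL-Library.Poly_Mapping"
    "HOL-Library.Z2"
    "HOL-Library.FuncSet"
    "HOL-Library.Cardinality"
    "HOL-Computational_Algebra.Computational_Algebra"
    "HOL-Algebra.Coset"
begin

section \<open>Polynomials and spans over the field with two elements\<close>

definition f2_scale :: "bit \<Rightarrow> 'a::comm_ring_1 \<Rightarrow> 'a"
  where "f2_scale c u = (if c = 1 then u else 0)"

abbreviation F2_span :: "'a::comm_ring_1 set \<Rightarrow> 'a set"
  where "F2_span \<equiv> module.span f2_scale"

definition meval :: "('v \<Rightarrow> 'b::comm_ring_1) \<Rightarrow> ('v \<Rightarrow>\<^sub>0 nat) \<Rightarrow> 'b"
  where "meval f m = (\<Prod>v\<in>Poly_Mapping.keys m. f v ^ Poly_Mapping.lookup m v)"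

definition peval :: "('v \<Rightarrow> 'b::comm_ring_1) \<Rightarrow> (('v \<Rightarrow>\<^sub>0 nat) \<Rightarrow>\<^sub>0 bit) \<Rightarrow> 'b"
  where "peval f p = (\<Sum>m\<in>Poly_Mapping.keys p. meval f m)"

lemma meval_alt:
  "finite A \<Longrightarrow> Poly_Mapping.keys m \<subseteq> A \<Longrightarrow> meval f m = (\<Prod>v\<in>A. f v ^ Poly_Mapping.lookup m v)"
  unfolding meval_def
  by (rule prod.mono_neutral_left) (auto simp: in_keys_iff)

lemma meval_0 [simp]: "meval f 0 = 1"
  by (simp add: meval_def)

lemma meval_add: "meval f (m + m') = meval f m * meval f m'"
proof -
  let ?A = "Poly_Mapping.keys m \<union> Poly_Mapping.keys m'"
  have "Poly_Mapping.keys (m + m') \<subseteq> ?A" by (rule Poly_Mapping.keys_add)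
  then show ?thesis
    by (simp add: meval_alt[of ?A] lookup_add power_add prod.distrib)
qed

lemma peval_alt:
  "finite A \<Longrightarrow> Poly_Mapping.keys p \<subseteq> A \<Longrightarrow>
    peval f p = (\<Sum>m\<in>A. f2_scale (Poly_Mapping.lookup p m) (meval f m))"
  unfolding peval_def
  by (rule sum.mono_neutral_cong_left) (auto simp: in_keys_iff f2_scale_def)

lemma f2_scale_add_left:
  "(2::'a::comm_ring_1) = 0 \<Longrightarrow> f2_scale (c + d) (u::'a) = f2_scale c u + f2_scale d u"
proof -
  assume "(2::'a) = 0"
  then have "u + u = 0" by (metis mult_2 mult_zero_left)
  then show ?thesis by (cases c; cases d) (auto simp: f2_scale_def)
qed

lemma peval_add:
  fixes f :: "'v \<Rightarrow> 'b::comm_ring_1"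
  assumes "(2::'b) = 0"
  shows "peval f (p + q) = peval f p + peval f q"
proof -
  let ?A = "Poly_Mapping.keys p \<union> Poly_Mapping.keys q"
  have "Poly_Mapping.keys (p + q) \<subseteq> ?A" by (rule Poly_Mapping.keys_add)
  then show ?thesis
    by (simp add: peval_alt[of ?A] lookup_add f2_scale_add_left[OF assms] sum.distrib del: add_bit_eq_xor)
qed

lemma peval_0 [simp]: "peval f 0 = 0"
  by (simp add: peval_def)

lemma peval_1 [simp]: "peval f 1 = 1"
  by (simp add: peval_def)

lemma peval_single: "peval f (Poly_Mapping.single m 1) = meval f m"
  by (simp add: peval_def)

lemma bit_pm_induct [case_names zero add]:
  fixes p :: "'m \<Rightarrow>\<^sub>0 bit"
  assumes "P 0" "\<And>m p. P p \<Longrightarrow> P (Poly_Mapping.single m 1 + p)"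
  shows "P p"
proof (induction "Poly_Mapping.keys p" arbitrary: p rule: infinite_finite_induct)
  case infinite
  then show ?case by simp
next
  case empty
  then show ?case using assms(1) by (metis keys_eq_empty)
next
  case (insert m A)
  let ?q = "Poly_Mapping.single m 1 + p"
  have keys_p: "Poly_Mapping.keys p = insert m A" by (rule insert.hyps(4)[symmetric])
  then have pm: "Poly_Mapping.lookup p m = 1"
    by (metis in_keys_iff insertI1 bit_not_zero_iff)
  have "x \<in> A \<longleftrightarrow> x \<in> Poly_Mapping.keys ?q" for x
  proof (cases "x = m")
    case True
    then show ?thesis using insert.hyps(2) pm
      by (simp add: in_keys_iff lookup_add lookup_single)
  next
    case False
    then have "x \<in> A \<longleftrightarrow> x \<in> Poly_Mapping.keys p" by (simp add: keys_p)
    with False show ?thesis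
      by (simp add: in_keys_iff lookup_add lookup_single when_def)
  qed
  then have "P ?q" by (intro insert.hyps(3)) blast
  from assms(2)[OF this, of m] 
  have "P (Poly_Mapping.single m 1 + ?q)" .
  moreover have "Poly_Mapping.single m 1 + ?q = p"
    by (rule poly_mapping_eqI) (simp add: lookup_add lookup_single when_def)
  ultimately show ?case by simp
qed

lemma peval_mult:
  fixes f :: "'v \<Rightarrow> 'b::comm_ring_1"
  assumes [simp]: "(2::'b) = 0"
  shows "peval f (p * q) = peval f p * peval f q"
proof (induction p rule: bit_pm_induct)
  case (add m p)
  have "peval f (Poly_Mapping.single m 1 * q) = meval f m * peval f q"
  proof (induction q rule: bit_pm_induct)
    case (add m' q)
    then show ?case
      by (simp add: distrib_left peval_add mult_single peval_single meval_add)
  qed simp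
  with add show ?case by (simp add: distrib_right peval_add peval_single)
qed simp


section \<open>The rings M(n) and N(n)\<close>

text \<open>
  For algebraically closed K of characteristic other than 2, the mod 2 motivic cohomology
  M(n) of the classifying space of an elementary abelian 2-group of rank n depends only on n.
  It is taken in its presentation over \<open>\<F>\<^sub>2\<close>, with \<open>\<F>\<^sub>2\<close> the type
  \<^typ>\<open>bit\<close>. The indices 1, ..., n are the elements of a finite linearly ordered type
  \<open>'n\<close>, so that n is \<open>CARD('n)\<close>.
\<close>

datatype 'n mvar = VarT | VarX 'n | VarY 'n

type_synonym 'n mpol = "('n mvar \<Rightarrow>\<^sub>0 nat) \<Rightarrow>\<^sub>0 bit"

definition pvar :: "'n mvar \<Rightarrow> 'n mpol"
  where "pvar v = Poly_Mapping.single (Poly_Mapping.single v 1) 1"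

definition mot_ideal :: "'n mpol set"
  where "mot_ideal = module.span (*) (range (\<lambda>i. pvar (VarX i) ^ 2 + pvar VarT * pvar (VarY i)))"

interpretation mult_module: Modules.module "(*) :: 'a::comm_ring_1 \<Rightarrow> 'a \<Rightarrow> 'a"
  by unfold_locales (simp_all add: algebra_simps)

definition mot_rel :: "'n mpol \<Rightarrow> 'n mpol \<Rightarrow> bool"
  where "mot_rel p q \<longleftrightarrow> p - q \<in> mot_ideal"

lemma mot_ideal_0: "0 \<in> mot_ideal"
  and mot_ideal_add: "p \<in> mot_ideal \<Longrightarrow> q \<in> mot_ideal \<Longrightarrow> p + q \<in> mot_ideal"
  and mot_ideal_neg: "p \<in> mot_ideal \<Longrightarrow> - p \<in> mot_ideal"
  and mot_ideal_mult: "p \<in> mot_ideal \<Longrightarrow> r * p \<in> mot_ideal"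
  unfolding mot_ideal_def
  by (auto intro: mult_module.span_zero mult_module.span_add mult_module.span_neg
      mult_module.span_scale)

lemma mot_rel_eqI: "p = q \<Longrightarrow> mot_rel p q"
  by (simp add: mot_rel_def mot_ideal_0)

lemma equivp_mot_rel: "equivp (mot_rel :: 'a mpol \<Rightarrow> _)"
proof (rule equivpI)
  show "reflp (mot_rel :: 'a mpol \<Rightarrow> _)" by (rule reflpI) (simp add: mot_rel_def mot_ideal_0)
  show "symp (mot_rel :: 'a mpol \<Rightarrow> _)"
    by (rule sympI) (metis mot_rel_def mot_ideal_neg minus_diff_eq)
  show "transp (mot_rel :: 'a mpol \<Rightarrow> _)"
  proof (rule transpI)
    have "(x - y) + (y - z) \<in> mot_ideal" if "mot_rel x y" "mot_rel y z" for x y z :: "'a mpol"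
      using that unfolding mot_rel_def by (rule mot_ideal_add)
    then show "mot_rel x z" if "mot_rel x y" "mot_rel y z" for x y z :: "'a mpol"
      using that by (simp add: mot_rel_def)
  qed
qed

quotient_type 'n mot = "'n mpol" / mot_rel
  by (rule equivp_mot_rel)

lemma pm_two: "(2 :: 'm::comm_monoid_add \<Rightarrow>\<^sub>0 bit) = 0"
  by (rule poly_mapping_eqI) (simp add: lookup_numeral)

lemma peval_pvar [simp]: "peval f (pvar v) = f v"
  by (simp add: pvar_def peval_single meval_def)

lemma peval_mot_ideal:
  fixes f :: "'n mvar \<Rightarrow> 'b::comm_ring_1"
  assumes [simp]: "(2::'b) = 0" and rel: "\<And>i. f (VarX i) ^ 2 + f VarT * f (VarY i) = 0"
    and "p \<in> mot_ideal"
  shows "peval f p = 0"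
  using assms(3) unfolding mot_ideal_def
proof (induction rule: mult_module.span_induct_alt)
  case (step c a b)
  then show ?case using rel by (auto simp: peval_add peval_mult power2_eq_square)
qed simp

lemma peval_mot_rel:
  fixes f :: "'n mvar \<Rightarrow> 'b::comm_ring_1"
  assumes two: "(2::'b) = 0" and rel: "\<And>i. f (VarX i) ^ 2 + f VarT * f (VarY i) = 0"
    and "mot_rel p q"
  shows "peval f p = peval f q"
proof -
  have "peval f (p - q) = 0"
    using peval_mot_ideal[OF two rel] assms(3) by (auto simp: mot_rel_def)
  moreover have "peval f ((p - q) + q) = peval f (p - q) + peval f q"
    by (rule peval_add[OF two])
  ultimately show ?thesis by simp
qed

lemma one_not_mot_ideal: "1 \<notin> mot_ideal"
proof
  assume "(1 :: 'n mpol) \<in> mot_ideal"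
  from peval_mot_ideal[OF _ _ this, of "\<lambda>_. 0 :: bit"] show False by simp
qed

instantiation mot :: (type) comm_ring_1
begin
lift_definition zero_mot :: "'a mot" is 0 .
lift_definition one_mot :: "'a mot" is 1 .
lift_definition plus_mot :: "'a mot \<Rightarrow> 'a mot \<Rightarrow> 'a mot" is "(+)"
proof -
  fix p q r s :: "'a mpol"
  assume "mot_rel p q" "mot_rel r s"
  moreover have "(p + r) - (q + s) = (p - q) + (r - s)" by simp
  ultimately show "mot_rel (p + r) (q + s)"
    unfolding mot_rel_def by (metis mot_ideal_add)
qed
lift_definition uminus_mot :: "'a mot \<Rightarrow> 'a mot" is "uminus"
proof -
  fix p q :: "'a mpol"
  assume "mot_rel p q"
  moreover have "(- p) - (- q) = - (p - q)" by simp
  ultimately show "mot_rel (- p) (- q)"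
    unfolding mot_rel_def by (metis mot_ideal_neg)
qed
lift_definition minus_mot :: "'a mot \<Rightarrow> 'a mot \<Rightarrow> 'a mot" is "(-)"
proof -
  fix p q r s :: "'a mpol"
  assume "mot_rel p q" "mot_rel r s"
  moreover have "(p - r) - (q - s) = (p - q) + - (r - s)" by simp
  ultimately show "mot_rel (p - r) (q - s)"
    unfolding mot_rel_def by (metis mot_ideal_add mot_ideal_neg)
qed
lift_definition times_mot :: "'a mot \<Rightarrow> 'a mot \<Rightarrow> 'a mot" is "(*)"
proof -
  fix p q r s :: "'a mpol"
  assume "mot_rel p q" "mot_rel r s"
  moreover have "p * r - q * s = r * (p - q) + q * (r - s)" by (simp add: algebra_simps)
  ultimately show "mot_rel (p * r) (q * s)"
    unfolding mot_rel_def by (metis mot_ideal_add mot_ideal_mult)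
qed
instance
proof
  show "(0::'a mot) \<noteq> 1"
  proof (transfer, rule notI)
    assume "mot_rel (0 :: 'a mpol) 1"
    then have "- (0 - 1 :: 'a mpol) \<in> mot_ideal"
      unfolding mot_rel_def by (rule mot_ideal_neg)
    then show False by (simp add: one_not_mot_ideal del: minus_diff_eq)
  qed
qed (transfer, rule mot_rel_eqI,
    rule mult.assoc mult.commute add.assoc add.commute mult_1_left add_0_left left_minus
      diff_conv_add_uminus distrib_right)+

end

lift_definition tau :: "'n mot" is "pvar VarT" .
lift_definition mx :: "'n \<Rightarrow> 'n mot" is "\<lambda>i. pvar (VarX i)" .
lift_definition my :: "'n \<Rightarrow> 'n mot" is "\<lambda>i. pvar (VarY i)" .

lemma mot_relation: "mx i ^ 2 + tau * my i = (0 :: 'n mot)"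
  unfolding power2_eq_square
proof transfer
  fix i :: 'n
  have "pvar (VarX i) ^ 2 + pvar VarT * pvar (VarY i) \<in> mot_ideal"
    unfolding mot_ideal_def by (rule mult_module.span_base) auto
  then show "mot_rel (pvar (VarX i) * pvar (VarX i) + pvar VarT * pvar (VarY i)) 0"
    by (simp add: mot_rel_def power2_eq_square)
qed

lemma mot_two: "(2 :: 'n mot) = 0"
proof -
  have "(1 :: 'n mot) + 1 = 0"
    by transfer (rule mot_rel_eqI, simp add: pm_two)
  then show ?thesis by simp
qed

definition rmot_rel :: "'n mot \<Rightarrow> 'n mot \<Rightarrow> bool"
  where "rmot_rel u v \<longleftrightarrow> tau dvd u - v"

lemma equivp_rmot_rel: "equivp (rmot_rel :: 'a mot \<Rightarrow> _)"
proof (rule equivpI)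
  show "reflp (rmot_rel :: 'a mot \<Rightarrow> _)" by (rule reflpI) (simp add: rmot_rel_def)
  show "symp (rmot_rel :: 'a mot \<Rightarrow> _)" by (rule sympI) (metis rmot_rel_def dvd_minus_iff minus_diff_eq)
  show "transp (rmot_rel :: 'a mot \<Rightarrow> _)"
  proof (rule transpI)
    have "tau dvd (x - y) + (y - z)" if "rmot_rel x y" "rmot_rel y z" for x y z :: "'a mot"
      using that unfolding rmot_rel_def by (rule dvd_add)
    then show "rmot_rel x z" if "rmot_rel x y" "rmot_rel y z" for x y z :: "'a mot"
      using that by (simp add: rmot_rel_def)
  qed
qed

quotient_type 'n rmot = "'n mot" / rmot_rel
  by (rule equivp_rmot_rel)

lemma rmot_rel_eqI: "u = v \<Longrightarrow> rmot_rel u v"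
  by (simp add: rmot_rel_def)

lift_definition mot_const :: "'n mot \<Rightarrow> bit" is "peval (\<lambda>_. 0)"
  by (rule peval_mot_rel) auto

lemma not_tau_dvd_1: "\<not> tau dvd (1 :: 'n mot)"
proof
  assume "tau dvd (1 :: 'n mot)"
  then obtain u :: "'n mot" where "1 = tau * u" by (rule dvdE)
  then have "mot_const (1 :: 'n mot) = mot_const (tau * u)" by simp
  moreover have "mot_const (tau * u) = 0" by transfer (simp add: peval_mult)
  moreover have "mot_const (1 :: 'n mot) = 1" by transfer simp
  ultimately show False by simp
qed

instantiation rmot :: (type) comm_ring_1
begin
lift_definition zero_rmot :: "'a rmot" is 0 .
lift_definition one_rmot :: "'a rmot" is 1 .
lift_definition plus_rmot :: "'a rmot \<Rightarrow> 'a rmot \<Rightarrow> 'a rmot" is "(+)"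
  by (metis rmot_rel_def add_diff_add dvd_add)
lift_definition uminus_rmot :: "'a rmot \<Rightarrow> 'a rmot" is "uminus"
  by (metis rmot_rel_def dvd_minus_iff minus_diff_minus)
lift_definition minus_rmot :: "'a rmot \<Rightarrow> 'a rmot \<Rightarrow> 'a rmot" is "(-)"
proof -
  fix p q r s :: "'a mot"
  assume "rmot_rel p q" "rmot_rel r s"
  moreover have "(p - r) - (q - s) = (p - q) - (r - s)" by simp
  ultimately show "rmot_rel (p - r) (q - s)"
    unfolding rmot_rel_def by (metis dvd_diff)
qed
lift_definition times_rmot :: "'a rmot \<Rightarrow> 'a rmot \<Rightarrow> 'a rmot" is "(*)"
proof -
  fix p q r s :: "'a mot"
  assume "rmot_rel p q" "rmot_rel r s"
  moreover have "p * r - q * s = r * (p - q) + q * (r - s)" by (simp add: algebra_simps)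
  ultimately show "rmot_rel (p * r) (q * s)"
    unfolding rmot_rel_def by (metis dvd_add dvd_mult)
qed
instance
proof
  show "(0::'a rmot) \<noteq> 1"
    by transfer (simp add: rmot_rel_def not_tau_dvd_1)
qed (transfer, rule rmot_rel_eqI,
    rule mult.assoc mult.commute add.assoc add.commute mult_1_left add_0_left left_minus
      diff_conv_add_uminus distrib_right)+

end

lift_definition nx :: "'n \<Rightarrow> 'n rmot" is mx .
lift_definition ny :: "'n \<Rightarrow> 'n rmot" is my .

lemma rmot_two: "(2 :: 'n rmot) = 0"
proof -
  have "(1 :: 'n rmot) + 1 = 0"
    by transfer (rule rmot_rel_eqI, simp add: mot_two)
  then show ?thesis by simp
qed

text \<open>
  In characteristic 2 the map \<^const>\<open>f2_scale\<close> is a vector space structure.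
\<close>

lemma vector_space_f2_scale:
  assumes "(2 :: 'a::comm_ring_1) = 0"
  shows "vector_space (f2_scale :: bit \<Rightarrow> 'a \<Rightarrow> 'a)"
proof
  show "f2_scale (a + b) x = f2_scale a x + f2_scale b x" for a b and x :: 'a
    by (rule f2_scale_add_left[OF assms])
qed (auto simp: f2_scale_def)

global_interpretation mot: vector_space "f2_scale :: bit \<Rightarrow> 'n mot \<Rightarrow> 'n mot"
  by (rule vector_space_f2_scale[OF mot_two])

global_interpretation rmot: vector_space "f2_scale :: bit \<Rightarrow> 'n rmot \<Rightarrow> 'n rmot"
  by (rule vector_space_f2_scale[OF rmot_two])

section \<open>Gradings\<close>

definition mot_deg :: "nat \<Rightarrow> 'n::finite mot set"
  where "mot_deg d = F2_span {tau ^ t * (\<Prod>i\<in>UNIV. mx i ^ a i) * (\<Prod>i\<in>UNIV. my i ^ e i) | t a e.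
    sum a UNIV + 2 * sum e UNIV = d}"

definition rmot_deg :: "nat \<Rightarrow> 'n::finite rmot set"
  where "rmot_deg d = F2_span {(\<Prod>i\<in>UNIV. nx i ^ a i) * (\<Prod>i\<in>UNIV. ny i ^ e i) | a e.
    sum a UNIV + 2 * sum e UNIV = d}"

definition ymon :: "('n::finite \<Rightarrow> nat) \<Rightarrow> 'n rmot"
  where "ymon e = (\<Prod>i\<in>UNIV. ny i ^ e i)"

definition Yn :: "'n::finite rmot set"
  where "Yn = F2_span (range ymon)"

definition Yn_part :: "nat \<Rightarrow> 'n::finite rmot set"
  where "Yn_part b = F2_span {ymon e | e. sum e UNIV = b}"

definition Lambda :: "'n::finite rmot set"
  where "Lambda = F2_span (range (\<lambda>I. prod nx I))"

definition Lambda_part :: "nat \<Rightarrow> 'n::finite rmot set"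
  where "Lambda_part a = F2_span {prod nx I | I. card I = a}"

definition tensor :: "'n rmot set \<Rightarrow> 'n rmot set \<Rightarrow> 'n rmot set"
  where "tensor A B = F2_span {u * v | u v. u \<in> A \<and> v \<in> B}"

section \<open>Steenrod operations\<close>

text \<open>
  The operations on M(n). Since K is algebraically closed, the class rho of -1 vanishes and
  Voevodsky's Cartan formula for \<open>P a = Sq\<^bsup>2a\<^esup>\<close> has only the correction term
  below, with \<open>Q \<circ> P b = Sq\<^bsup>2b+1\<^esup>\<close>. The locale axioms determine
  \<open>Q\<close> and \<open>P\<close>.
\<close>

locale motivic_action =
  fixes Q :: "'n mot \<Rightarrow> 'n mot" and P :: "nat \<Rightarrow> 'n mot \<Rightarrow> 'n mot"
  assumes Q_add: "Q (u + v) = Q u + Q v"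
    and Q_mult: "Q (u * v) = Q u * v + u * Q v"
    and Q_tau: "Q tau = 0"
    and Q_x: "Q (mx i) = my i"
    and Q_y: "Q (my i) = 0"
    and P_add: "P a (u + v) = P a u + P a v"
    and P_0: "P 0 u = u"
    and P_mult: "P a (u * v) = (\<Sum>(b, c) | b + c = a. P b u * P c v)
      + tau * (\<Sum>(b, c) | b + c + 1 = a. Q (P b u) * Q (P c v))"
    and P_tau: "a \<ge> 1 \<Longrightarrow> P a tau = 0"
    and P_x: "a \<ge> 1 \<Longrightarrow> P a (mx i) = 0"
    and P1_y: "P 1 (my i) = my i ^ 2"
    and P_y: "a \<ge> 2 \<Longrightarrow> P a (my i) = 0"

locale reduced_action =
  fixes q :: "'n::finite rmot \<Rightarrow> 'n rmot" and p :: "nat \<Rightarrow> 'n rmot \<Rightarrow> 'n rmot"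
  assumes q_add: "q (u + v) = q u + q v"
    and q_mult: "q (u * v) = q u * v + u * q v"
    and q_x: "q (nx i) = ny i"
    and q_y: "q (ny i) = 0"
    and p_add: "p a (u + v) = p a u + p a v"
    and p_Lambda: "l \<in> Lambda \<Longrightarrow> y \<in> Yn \<Longrightarrow> p a (l * y) = l * p a y"
    and p_0: "p 0 u = u"
    and p_mult: "f \<in> Yn \<Longrightarrow> g \<in> Yn \<Longrightarrow> p a (f * g) = (\<Sum>(b, c) | b + c = a. p b f * p c g)"
    and p1_y: "p 1 (ny i) = ny i ^ 2"
    and p_y: "a \<ge> 2 \<Longrightarrow> p a (ny i) = 0"

text \<open>
  The homogeneous elements, with their bidegree, of the algebra generated by a set of
  operations with given bidegrees.
\<close>

inductive homog_op :: "(nat \<times> nat \<times> ('a::comm_ring_1 \<Rightarrow> 'a)) set \<Rightarrow> nat \<Rightarrow> nat \<Rightarrow> ('a \<Rightarrow> 'a) \<Rightarrow> bool"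
  for gens
  where
    gen: "(r, s, f) \<in> gens \<Longrightarrow> homog_op gens r s f"
  | unit: "homog_op gens 0 0 (\<lambda>u. u)"
  | zero: "homog_op gens r s (\<lambda>u. 0)"
  | add: "homog_op gens r s f \<Longrightarrow> homog_op gens r s g \<Longrightarrow> homog_op gens r s (\<lambda>u. f u + g u)"
  | comp: "homog_op gens r s f \<Longrightarrow> homog_op gens r' s' g \<Longrightarrow>
      homog_op gens (r + r') (s + s') (\<lambda>u. f (g u))"

definition positive_values :: "(nat \<times> nat \<times> ('a::comm_ring_1 \<Rightarrow> 'a)) set \<Rightarrow> 'a set \<Rightarrow> 'a set"
  where "positive_values gens C = F2_span {f u | f u r s. homog_op gens r s f \<and> r + s > 0 \<and> u \<in> C}"

definition powers :: "(nat \<Rightarrow> 'a \<Rightarrow> 'a) \<Rightarrow> (nat \<times> nat \<times> ('a \<Rightarrow> 'a)) set"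
  where "powers P = {(2 * a, a, P a) | a. a \<ge> 1}"

text \<open>
  On M(n) the coefficient tau, of bidegree (0, 1), is itself an operation of positive degree.
\<close>

definition A_plus_M :: "('n mot \<Rightarrow> 'n mot) \<Rightarrow> (nat \<Rightarrow> 'n mot \<Rightarrow> 'n mot) \<Rightarrow> 'n mot set"
  where "A_plus_M Q P = positive_values ({(0, 1, (*) tau), (1, 0, Q)} \<union> powers P) UNIV"

definition A_plus_N :: "('n rmot \<Rightarrow> 'n rmot) \<Rightarrow> (nat \<Rightarrow> 'n rmot \<Rightarrow> 'n rmot) \<Rightarrow> 'n rmot set"
  where "A_plus_N q p = positive_values ({(1, 0, q)} \<union> powers p) UNIV"

definition P_plus_Y :: "(nat \<Rightarrow> 'n::finite rmot \<Rightarrow> 'n rmot) \<Rightarrow> 'n rmot set"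
  where "P_plus_Y p = positive_values (powers p) Yn"

section \<open>The local projection\<close>

text \<open>\<open>omega j e\<close> is the invariant of the monomial \<open>ymon e\<close>.\<close>

definition omega :: "nat \<Rightarrow> ('n::finite \<Rightarrow> nat) \<Rightarrow> nat"
  where "omega j e = (\<Sum>i\<in>UNIV. (2 * e i) div 2 ^ j mod 2)"

definition Gn :: "(nat \<Rightarrow> 'n::finite rmot \<Rightarrow> 'n rmot) \<Rightarrow> nat \<Rightarrow> 'n rmot set"
  where "Gn p k = F2_span (P_plus_Y p \<union>
    {ymon e | e. (map (\<lambda>j. omega j e) [1..<Suc k], replicate k (CARD('n) - 1)) \<in> lex less_than})"

definition add_grp :: "'a::ab_group_add set \<Rightarrow> 'a monoid"
  where "add_grp C = \<lparr>carrier = C, monoid.mult = (+), one = 0\<rparr>"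

definition top_part :: "nat \<Rightarrow> nat \<Rightarrow> 'n::finite rmot set"
  where "top_part k d1 = tensor (Lambda_part k) (Yn_part d1)"

definition top_G :: "(nat \<Rightarrow> 'n::finite rmot \<Rightarrow> 'n rmot) \<Rightarrow> nat \<Rightarrow> nat \<Rightarrow> 'n rmot set"
  where "top_G p k d1 = tensor (Lambda_part k) (Gn p k \<inter> Yn_part d1)"

text \<open>
  \<open>quo p k d1\<close> is the space \<open>\<Lambda>\<^sup>k \<otimes> (Y/G)\<^bsup>2 d1\<^esup>\<close>, as the quotient of
  \<open>\<Lambda>\<^sup>k \<otimes> Y\<^bsup>2 d1\<^esup>\<close> by \<open>\<Lambda>\<^sup>k \<otimes> G\<^bsup>2 d1\<^esup>\<close>; its elements are cosets
  and its addition is the group operation of \<^const>\<open>FactGroup\<close>.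
\<close>

definition quo :: "(nat \<Rightarrow> 'n::finite rmot \<Rightarrow> 'n rmot) \<Rightarrow> nat \<Rightarrow> nat \<Rightarrow> 'n rmot set monoid"
  where "quo p k d1 = add_grp (top_part k d1) Mod top_G p k d1"

definition quo_map :: "(nat \<Rightarrow> 'n::finite rmot \<Rightarrow> 'n rmot) \<Rightarrow> nat \<Rightarrow> nat \<Rightarrow> 'n rmot \<Rightarrow> 'n rmot set"
  where "quo_map p k d1 u = top_G p k d1 #>\<^bsub>add_grp (top_part k d1)\<^esub> u"

definition pr :: "nat \<Rightarrow> nat \<Rightarrow> 'n::finite rmot \<Rightarrow> 'n rmot"
  where "pr k d1 u = (THE v. v \<in> top_part k d1 \<and>
    (\<exists>w \<in> F2_span (\<Union>{tensor (Lambda_part a) (Yn_part b) | a b. a + 2 * b = k + 2 * d1 \<and> a \<noteq> k}).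
      u = v + w))"

definition Mono_maps :: "nat \<Rightarrow> (nat \<Rightarrow> 'n::linorder) set"
  where "Mono_maps k = {\<sigma> \<in> {1..k} \<rightarrow>\<^sub>E UNIV. strict_mono_on {1..k} \<sigma>}"

definition sigma_z ::
    "('n::finite \<Rightarrow> 'a::comm_ring_1) \<Rightarrow> ('n \<Rightarrow> 'a) \<Rightarrow> nat \<Rightarrow> (nat \<Rightarrow> 'n) \<Rightarrow> 'a"
  where "sigma_z x y k \<sigma> = (\<Prod>j=1..k. x (\<sigma> j))
    * (\<Prod>j=1..k. y (\<sigma> j) ^ (2 ^ k - 2 ^ (k - j) - 1))
    * (\<Prod>i\<in>- \<sigma> ` {1..k}. y i ^ (2 ^ k - 1))"

definition M1 :: "nat \<Rightarrow> 'n::{finite,linorder} rmot set"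
  where "M1 k = sigma_z nx ny k ` Mono_maps k"

text \<open>
  Coefficients in \<open>\<F>\<^sub>2\<close> amount to the choice of a finite set \<open>B\<close> of monomials.
\<close>

definition basis_complement ::
    "(nat \<Rightarrow> 'n::{finite,linorder} rmot \<Rightarrow> 'n rmot) \<Rightarrow> nat \<Rightarrow> nat \<Rightarrow> 'n rmot set \<Rightarrow> bool"
  where "basis_complement p k d1 M0 \<longleftrightarrow>
    M0 \<subseteq> {prod nx I * ymon e | I e. card I = k \<and> sum e UNIV = d1} \<and>
    M0 \<inter> M1 k = {} \<and>
    inj_on (quo_map p k d1) (M0 \<union> M1 k) \<and>
    (\<forall>Z \<in> carrier (quo p k d1). \<exists>!B. finite B \<and> B \<subseteq> M0 \<union> M1 k \<and> Z = quo_map p k d1 (\<Sum>B))"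

text \<open>
  The spans of the classes of \<open>M0\<close> and \<open>M1\<close> are images of spans, as
  \<^const>\<open>quo_map\<close> is linear.
\<close>

definition U0 ::
    "(nat \<Rightarrow> 'n::finite rmot \<Rightarrow> 'n rmot) \<Rightarrow> nat \<Rightarrow> nat \<Rightarrow> 'n rmot set \<Rightarrow> 'n rmot set set"
  where "U0 p k d1 M0 = quo_map p k d1 ` F2_span M0"

definition V_space ::
    "(nat \<Rightarrow> 'n::{finite,linorder} rmot \<Rightarrow> 'n rmot) \<Rightarrow> nat \<Rightarrow> nat \<Rightarrow> 'n rmot set set"
  where "V_space p k d1 = quo_map p k d1 ` F2_span (M1 k)"

definition V_grp ::
    "(nat \<Rightarrow> 'n::{finite,linorder} rmot \<Rightarrow> 'n rmot) \<Rightarrow> nat \<Rightarrow> nat \<Rightarrow> 'n rmot set monoid"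
  where "V_grp p k d1 = (quo p k d1)\<lparr>carrier := V_space p k d1\<rparr>"

definition proj_M1 ::
    "(nat \<Rightarrow> 'n::{finite,linorder} rmot \<Rightarrow> 'n rmot) \<Rightarrow> nat \<Rightarrow> nat \<Rightarrow> 'n rmot set \<Rightarrow>
      'n rmot set \<Rightarrow> 'n rmot set"
  where "proj_M1 p k d1 M0 Z =
    (THE v. v \<in> V_space p k d1 \<and> (\<exists>u \<in> U0 p k d1 M0. Z = u \<otimes>\<^bsub>quo p k d1\<^esub> v))"

definition theta ::
    "(nat \<Rightarrow> 'n::{finite,linorder} rmot \<Rightarrow> 'n rmot) \<Rightarrow> nat \<Rightarrow> nat \<Rightarrow> 'n rmot set \<Rightarrow>
      'n rmot \<Rightarrow> 'n rmot set"
  where "theta p k d1 M0 u = proj_M1 p k d1 M0 (quo_map p k d1 (pr k d1 u))"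

definition eps ::
    "(nat \<Rightarrow> 'n::{finite,linorder} rmot \<Rightarrow> 'n rmot) \<Rightarrow> nat \<Rightarrow> nat \<Rightarrow> 'n rmot set \<Rightarrow> bit"
  where "eps p k d1 v = (THE e. \<exists>c. e = (\<Sum>\<sigma>\<in>Mono_maps k. c \<sigma>) \<and>
    v = quo_map p k d1 (\<Sum>\<sigma>\<in>Mono_maps k. f2_scale (c \<sigma>) (sigma_z nx ny k \<sigma>)))"

section \<open>Existence of the operations\<close>

text \<open>
  The axioms of \<^locale>\<open>motivic_action\<close> and \<^locale>\<open>reduced_action\<close> are satisfiable.
  The total operation \<open>u \<mapsto> \<Sum>a. (P a u + s * Q (P a u)) * t ^ a\<close> is a ring
  homomorphism from M(n) to \<open>M(n)[t, s]/(s\<^sup>2 - tau * t)\<close>, whose elements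
  \<open>f + s * g\<close> are written \<open>Tot f g\<close>.
\<close>

datatype 'n tot = Tot (even_part: "'n mot poly") (odd_part: "'n mot poly")

instantiation tot :: (type) comm_ring_1
begin
definition "0 = Tot 0 0"
definition "1 = Tot 1 0"
definition "u + v = Tot (even_part u + even_part v) (odd_part u + odd_part v)"
definition "u - v = Tot (even_part u - even_part v) (odd_part u - odd_part v)"
definition "- u = Tot (- even_part u) (- odd_part u)"
definition "u * v = Tot (even_part u * even_part v + [:0, tau:] * (odd_part u * odd_part v))
  (even_part u * odd_part v + odd_part u * even_part v)"
instance
  by standard (simp_all only: zero_tot_def one_tot_def plus_tot_def minus_tot_def uminus_tot_def
      times_tot_def tot.sel tot.inject algebra_simps
      mult_1_left mult_1_right mult_zero_left mult_zero_right add_0_left add_0_right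
      zero_neq_one simp_thms tot.collapse add_uminus_conv_diff diff_self)
end

lemma tot_simps [simp]:
  "even_part 0 = 0" "odd_part 0 = 0" "even_part 1 = 1" "odd_part 1 = 0"
  "even_part (u + v) = even_part u + even_part v" "odd_part (u + v) = odd_part u + odd_part v"
  "even_part (u * v) = even_part u * even_part v + pCons 0 (smult tau (odd_part u * odd_part v))"
  "odd_part (u * v) = even_part u * odd_part v + odd_part u * even_part v"
  by (simp_all add: zero_tot_def one_tot_def plus_tot_def times_tot_def)

lemma mot_double: "u + u = (0 :: 'n mot)"
  by (metis mot_two mult_2 mult_zero_left)

lemma mot_poly_double: "f + f = (0 :: 'n mot poly)"
  by (rule poly_eqI) (simp only: coeff_add mot_double coeff_0)

lemma tot_two: "(2 :: 'n tot) = 0"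
proof -
  have "(1 :: 'n tot) + 1 = 0"
    by (simp add: zero_tot_def one_tot_def plus_tot_def mot_poly_double)
  then show ?thesis by simp
qed

primrec tot_gen :: "'n mvar \<Rightarrow> 'n tot"
  where
    "tot_gen VarT = Tot [:tau:] 0"
  | "tot_gen (VarX i) = Tot [:mx i:] [:my i:]"
  | "tot_gen (VarY i) = Tot [:my i, my i ^ 2:] 0"

lemma tot_gen_rel: "tot_gen (VarX i) ^ 2 + tot_gen VarT * tot_gen (VarY i) = 0"
proof -
  have "mx i * mx i + tau * my i = 0"
    and "mx i * mx i + my i * tau = 0"
    using mot_relation[of i] by (simp_all add: power2_eq_square mult.commute)
  moreover have "tau * (my i * my i) + tau * (my i * my i) = 0"
    "mx i * my i + my i * mx i = 0"
    by (simp_all only: mult.commute[of "my i" "mx i"] mot_double)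
  ultimately show ?thesis
    by (simp add: power2_eq_square times_tot_def plus_tot_def zero_tot_def
        del: mult_2 mult_2_right)
qed

lift_definition total_op :: "'n mot \<Rightarrow> 'n tot" is "peval tot_gen"
  by (rule peval_mot_rel[OF tot_two tot_gen_rel])

lemma total_op_add: "total_op (u + v) = total_op u + total_op v"
  by transfer (rule peval_add[OF tot_two])

lemma total_op_mult: "total_op (u * v) = total_op u * total_op v"
  by transfer (rule peval_mult[OF tot_two])

lemma total_op_gens [simp]:
  "total_op 0 = 0" "total_op 1 = 1" "total_op tau = Tot [:tau:] 0" "total_op (mx i) = Tot [:mx i:] [:my i:]"
  "total_op (my i) = Tot [:my i, my i ^ 2:] 0"
  by (simp_all add: zero_mot_def one_mot_def tau_def mx_def my_def total_op.abs_eq)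

lemma monomial_induct [case_names zero add]:
  fixes m :: "'v \<Rightarrow>\<^sub>0 nat"
  assumes "R 0" "\<And>v m. R m \<Longrightarrow> R (Poly_Mapping.single v 1 + m)"
  shows "R m"
proof (induction "\<Sum>v\<in>Poly_Mapping.keys m. Poly_Mapping.lookup m v" arbitrary: m rule: less_induct)
  case less
  show ?case
  proof (cases "m = 0")
    case True
    then show ?thesis using assms(1) by simp
  next
    case False
    then obtain v where v: "v \<in> Poly_Mapping.keys m"
      by (metis ex_in_conv keys_eq_empty)
    define m' where "m' = m - Poly_Mapping.single v 1"
    have look: "Poly_Mapping.lookup m' w = Poly_Mapping.lookup m w - (if w = v then 1 else 0)" for w
      by (simp add: m'_def lookup_minus lookup_single when_def)
    have pos: "Poly_Mapping.lookup m v > 0"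
      using v by (simp add: in_keys_iff)
    have m: "m = Poly_Mapping.single v 1 + m'"
      using pos by (intro poly_mapping_eqI) (auto simp: lookup_add look lookup_single when_def)
    have "Poly_Mapping.keys m' \<subseteq> Poly_Mapping.keys m"
      by (auto simp: in_keys_iff look)
    then have "(\<Sum>w\<in>Poly_Mapping.keys m'. Poly_Mapping.lookup m' w)
        = (\<Sum>w\<in>Poly_Mapping.keys m. Poly_Mapping.lookup m' w)"
      by (intro sum.mono_neutral_left) (auto simp: in_keys_iff)
    also have "\<dots> < (\<Sum>w\<in>Poly_Mapping.keys m. Poly_Mapping.lookup m w)"
      using v pos by (intro sum_strict_mono_ex1) (auto simp: look intro!: bexI[of _ v])
    finally have "R m'" by (rule less)
    then show ?thesis unfolding m by (rule assms(2))
  qed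
qed

lemma mot_induct [case_names one tau x y add mult]:
  fixes u :: "'n mot"
  assumes "R 1" "R tau" "\<And>i. R (mx i)" "\<And>i. R (my i)"
    and add: "\<And>u v. R u \<Longrightarrow> R v \<Longrightarrow> R (u + v)"
    and mult: "\<And>u v. R u \<Longrightarrow> R v \<Longrightarrow> R (u * v)"
  shows "R u"
proof -
  have var: "R (abs_mot (pvar v))" for v
    using assms(2-4) by (cases v) (simp_all add: tau_def mx_def my_def)
  have mon: "R (abs_mot (Poly_Mapping.single m 1))" for m
  proof (induction m rule: monomial_induct)
    case zero
    then show ?case using assms(1) by (simp add: one_mot_def)
  next
    case (add v m)
    then have "R (abs_mot (pvar v) * abs_mot (Poly_Mapping.single m 1))"
      by (intro mult var)
    then show ?case
      by (simp add: times_mot.abs_eq pvar_def mult_single)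
  qed
  have "R (abs_mot p)" for p
  proof (induction p rule: bit_pm_induct)
    case zero
    have "R (1 + 1)" by (intro add assms(1))
    then show ?case by (simp only: mot_double zero_mot_def)
  next
    case (add m p)
    then have "R (abs_mot (Poly_Mapping.single m 1) + abs_mot p)"
      by (intro assms(5) mon)
    then show ?case by (simp add: plus_mot.abs_eq)
  qed
  then have "R (abs_mot (rep_mot u))" .
  then show ?thesis by (simp add: Quotient3_abs_rep[OF Quotient3_mot])
qed

definition op_P :: "nat \<Rightarrow> 'n mot \<Rightarrow> 'n mot"
  where "op_P a u = coeff (even_part (total_op u)) a"

definition op_Q :: "'n mot \<Rightarrow> 'n mot"
  where "op_Q u = coeff (odd_part (total_op u)) 0"

lemma op_P_0: "op_P 0 u = u"
  by (induction u rule: mot_induct)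
    (simp_all add: op_P_def total_op_add total_op_mult coeff_mult_0 coeff_pCons)

lemma op_Q_mult: "op_Q (u * v) = op_Q u * v + u * op_Q v"
  using op_P_0[of u] op_P_0[of v]
  by (simp add: op_Q_def op_P_def total_op_mult coeff_mult_0 add.commute)

lemma op_Q_add: "op_Q (u + v) = op_Q u + op_Q v"
  by (simp add: op_Q_def total_op_add)

lemma op_Q_gens: "op_Q 0 = 0" "op_Q 1 = 0" "op_Q tau = 0" "op_Q (mx i) = my i" "op_Q (my i) = 0"
  by (simp_all add: op_Q_def)

lemma op_Q_tau: "op_Q (tau * u) = tau * op_Q u"
  by (simp add: op_Q_mult op_Q_gens)

lemma op_Q_Q: "op_Q (op_Q u) = 0"
proof (induction u rule: mot_induct)
  case (mult u v)
  then show ?case by (simp add: op_Q_mult op_Q_add mot_double)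
qed (simp_all add: op_Q_gens op_Q_add)

lemma op_Q_sum: "finite A \<Longrightarrow> op_Q (\<Sum>i\<in>A. f i) = (\<Sum>i\<in>A. op_Q (f i))"
  by (induction A rule: finite_induct) (simp_all add: op_Q_add op_Q_gens)

lemma sum_pairs: "(\<Sum>(b, c) | b + c = a. f b c) = (\<Sum>b\<le>a. f b (a - b))" for a :: nat
  by (rule sum.reindex_bij_witness[of _ "\<lambda>b. (b, a - b)" fst]) auto

lemma op_P_mult_odd:
  "op_P a (u * v) = (\<Sum>b\<le>a. op_P b u * op_P (a - b) v)
    + (if a = 0 then 0 else tau * (\<Sum>b\<le>a - 1. coeff (odd_part (total_op u)) b
        * coeff (odd_part (total_op v)) (a - 1 - b)))"
  by (cases a) (simp_all add: op_P_def total_op_mult coeff_mult del: sum.atMost_Suc)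

lemma coeff_odd_part: "coeff (odd_part (total_op u)) a = op_Q (op_P a u)"
proof (induction u arbitrary: a rule: mot_induct)
  case (mult u v)
  have "op_Q (op_P a (u * v)) = (\<Sum>b\<le>a. op_Q (op_P b u * op_P (a - b) v))"
    unfolding op_P_mult_odd mult
    by (simp add: op_Q_add op_Q_sum op_Q_mult op_Q_Q op_Q_gens)
  then show ?case
    by (simp add: total_op_mult coeff_mult mult op_Q_mult sum.distrib add.commute)
       (simp add: op_P_def)
next
  case (add u v)
  then show ?case by (simp add: total_op_add op_P_def op_Q_add)
qed (simp_all add: op_P_def coeff_pCons op_Q_gens op_Q_mult power2_eq_square split: nat.split)

theorem motivic_action_exists: "motivic_action op_Q op_P"
proof
  fix a and u v :: "'a mot"
  show "op_P a (u * v) = (\<Sum>(b, c) | b + c = a. op_P b u * op_P c v)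
      + tau * (\<Sum>(b, c) | b + c + 1 = a. op_Q (op_P b u) * op_Q (op_P c v))"
  proof (cases a)
    case 0
    then show ?thesis
      by (simp add: op_P_mult_odd sum_pairs del: add_is_0)
  next
    case (Suc a')
    have "{(b, c). b + c + 1 = a} = {(b, c). b + c = a'}" by (auto simp: Suc)
    then show ?thesis
      by (simp add: op_P_mult_odd sum_pairs coeff_odd_part Suc del: sum.atMost_Suc)
  qed
next
  show "op_P 0 u = u" for u :: "'a mot" by (rule op_P_0)
qed (auto simp: op_Q_add op_Q_mult op_Q_gens op_P_def total_op_add coeff_pCons
    split: nat.splits)

lift_definition red_P :: "nat \<Rightarrow> 'n rmot \<Rightarrow> 'n rmot" is op_P
  unfolding rmot_rel_def
proof -
  fix a and u v :: "'n mot"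
  assume "tau dvd u - v"
  then obtain w where w: "u = v + tau * w" by (metis dvdE add.commute diff_add_cancel)
  have "op_P b (tau :: 'n mot) = (if b = 0 then tau else 0)" for b
    by (simp add: op_P_def coeff_pCons split: nat.split)
  then have "tau dvd op_P a (tau * w)"
    by (auto simp: op_P_mult_odd intro!: dvd_add dvd_sum)
  then show "tau dvd op_P a u - op_P a v"
    by (simp add: w op_P_def total_op_add)
qed

lift_definition red_Q :: "'n rmot \<Rightarrow> 'n rmot" is op_Q
  unfolding rmot_rel_def
proof -
  fix u v :: "'n mot"
  assume "tau dvd u - v"
  then obtain w where "u = v + tau * w" by (metis dvdE add.commute diff_add_cancel)
  then show "tau dvd op_Q u - op_Q v"
    by (simp add: op_Q_add op_Q_tau)
qed

lemma abs_rmot_sum: "finite A \<Longrightarrow> abs_rmot (\<Sum>i\<in>A. f i) = (\<Sum>i\<in>A. abs_rmot (f i))"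
  by (induction A rule: finite_induct) (simp_all add: plus_rmot.abs_eq[symmetric] zero_rmot_def)

lemma rmot_cases:
  obtains v :: "'n mot" where "u = abs_rmot v"
  using Quotient3_abs_rep[OF Quotient3_rmot, of u] by metis

lemma abs_rmot_simps:
  "abs_rmot 0 = 0" "abs_rmot 1 = 1" "abs_rmot tau = 0" "abs_rmot (mx i) = nx i"
  "abs_rmot (my i) = ny i" "abs_rmot (u + v) = abs_rmot u + abs_rmot v"
  "abs_rmot (u * v) = abs_rmot u * abs_rmot v"
  by (simp_all add: zero_rmot_def one_rmot_def nx_def ny_def plus_rmot.abs_eq times_rmot.abs_eq
      rmot.abs_eq_iff rmot_rel_def)

lemma red_P_add: "red_P a (u + v) = red_P a u + red_P a v"
proof -
  obtain u' v' where "u = abs_rmot u'" "v = abs_rmot v'" by (metis rmot_cases)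
  then show ?thesis
    by (simp add: red_P.abs_eq abs_rmot_simps(6)[symmetric] op_P_def total_op_add)
qed

lemma red_P_mult: "red_P a (u * v) = (\<Sum>b\<le>a. red_P b u * red_P (a - b) v)"
proof -
  obtain u' v' where uv: "u = abs_rmot u'" "v = abs_rmot v'" by (metis rmot_cases)
  have "red_P a (u * v) = abs_rmot (op_P a (u' * v'))"
    unfolding uv abs_rmot_simps(7)[symmetric] by (rule red_P.abs_eq)
  also have "\<dots> = (\<Sum>b\<le>a. red_P b u * red_P (a - b) v)"
    unfolding op_P_mult_odd uv
    by (simp add: abs_rmot_simps abs_rmot_sum red_P.abs_eq)
  finally show ?thesis .
qed

lemma red_P_0: "red_P 0 u = u"
  by transfer (rule rmot_rel_eqI, rule op_P_0)

lemma red_P_gens: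
  "a \<ge> 1 \<Longrightarrow> red_P a 1 = 0" "a \<ge> 1 \<Longrightarrow> red_P a (nx i) = 0"
  "red_P 1 (ny i) = ny i ^ 2" "a \<ge> 2 \<Longrightarrow> red_P a (ny i) = 0" "red_P a 0 = 0"
  unfolding abs_rmot_simps(1,2,4,5)[symmetric] red_P.abs_eq
  by (auto simp: op_P_def coeff_pCons abs_rmot_simps power2_eq_square split: nat.splits)

lemma red_Q_add: "red_Q (u + v) = red_Q u + red_Q v"
  by transfer (rule rmot_rel_eqI, rule op_Q_add)

lemma red_Q_mult: "red_Q (u * v) = red_Q u * v + u * red_Q v"
  by transfer (rule rmot_rel_eqI, rule op_Q_mult)

lemma red_P_Lambda:
  assumes "l \<in> Lambda" "a \<ge> 1"
  shows "red_P a l = 0"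
  using assms(1) unfolding Lambda_def
proof (induction rule: rmot.span_induct_alt)
  case base
  then show ?case by (rule red_P_gens)
next
  case (step c m l)
  then obtain I where m: "m = prod nx I" by auto
  have "\<forall>a \<ge> 1. red_P a (prod nx I) = 0"
  proof (induction I rule: infinite_finite_induct)
    case (insert i I)
    have "red_P b (nx i) * red_P (a - b) (prod nx I) = 0" if "a \<ge> 1" "b \<le> a" for a b
      using insert.IH that by (cases "b = 0") (auto simp: red_P_gens)
    with insert.hyps show ?case by (simp add: red_P_mult)
  qed (simp_all add: red_P_gens)
  with assms(2) step.IH show ?case
    by (simp add: m f2_scale_def red_P_add red_P_gens(5))
qed

theorem reduced_action_exists: "reduced_action red_Q red_P"
proof
  show "red_P a (l * y) = l * red_P a y" if "l \<in> Lambda" "y \<in> Yn" for a and l y :: "'a rmot"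
  proof -
    have "red_P a (l * y) = (\<Sum>b\<in>{0}. red_P b l * red_P (a - b) y)"
      unfolding red_P_mult using that
      by (intro sum.mono_neutral_right) (auto simp: red_P_Lambda)
    then show ?thesis by (simp add: red_P_0)
  qed
  show "red_Q (nx i) = ny i" "red_Q (ny i) = 0" for i :: 'a
    unfolding abs_rmot_simps(4,5)[symmetric] red_Q.abs_eq
    by (simp_all add: op_Q_gens abs_rmot_simps)
qed (auto simp: red_Q_add red_Q_mult red_P_add red_P_mult red_P_gens red_P_0 sum_pairs
    simp del: One_nat_def)

end

theory Submission
  imports Defs "HOL-Combinatorics.Permutations" "HOL-Library.Disjoint_Sets"
begin

text \<open>
  Let \<open>\<Psi>\<close> add up the coefficients of the monomials \<open>x\<^sub>J y\<^sup>e\<close> with \<open>|J| = k\<close> in which every binary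
  digit \<open>0, \<dots>, k - 1\<close> is absent from the exponent of exactly one variable, the \<open>k\<close> variables
  concerned being distinct and indexed by \<open>J\<close>; the \<open>\<sigma>(z\<^sub>k)\<close> are of this kind. If such a monomial
  occurs in \<open>P\<^bsup>a\<^esup>(x\<^sub>J y\<^sup>f)\<close> with \<open>a \<ge> 1\<close>, then \<open>f\<close> takes the same value at two indices of \<open>J\<close>, and
  exchanging them is an involution without fixed points on the occurrences; in \<open>Q\<^sub>0(x\<^sub>I y\<^sup>f)\<close> there
  are none or two of them. So \<open>\<Psi>\<close> vanishes on all hits, and on the lexicographically smaller
  monomials as well. This alone gives (2), and (3) by reduction mod \<open>\<tau>\<close>.

  For (1), \<open>P\<^bsup>2^j\<^esup>\<close> shows that two such monomials with the same \<open>J\<close> agree modulo \<open>G\<close>. Hence none of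
  them belongs to \<open>M\<^sub>0\<close>, so that \<open>\<Psi>\<close> kills \<open>M\<^sub>0\<close> and \<open>\<epsilon> \<circ> \<theta> = \<Psi>\<close> whatever \<open>M\<^sub>0\<close> is. Conversely, suitable
  \<open>Q\<^sub>0(x\<^sub>I y\<^sup>f)\<close> with \<open>|I| = k + 1\<close> identify the classes for two neighbouring \<open>J \<subseteq> I\<close>, and any two
  \<open>k\<close>-subsets are joined by a chain of neighbours.
\<close>

section \<open>Binomial coefficients mod 2\<close>

text \<open>As a rewrite rule this would undo associativity and loop with \<open>mult_ac\<close>.\<close>
declare mult_module.scale_scale [simp del]

text \<open>Lowest digit of Lucas' theorem: modulo 2, (1 + X)^(2m) = (1 + X^2)^m, which has only
  even exponents. The induction applies Pascal's rule twice, and the middle term carries a factor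
  2.\<close>

lemma even_choose_double: "odd ((2 * m) choose (2 * l)) = odd (m choose l)"
  "even ((2 * m) choose (2 * l + 1))"
proof (induction m arbitrary: l)
  case 0
  { case 1 show ?case by (cases l) auto }
  { case 2 show ?case by simp }
next
  case (Suc m)
  { case 1 show ?case
    proof (cases l)
      case (Suc l')
      have "odd (2 * Suc m choose 2 * l) =
         odd ((2 * m choose (2 * l')) + 2 * (2 * m choose (2 * l' + 1)) + (2 * m choose (2 * Suc l')))"
        by (simp add: Suc) blast
      then show ?thesis using Suc.IH(1)[of l'] Suc.IH(1)[of "Suc l'"]
        by (simp only: even_add even_mult_iff even_numeral binomial_Suc_Suc Suc) simp
    qed simp }
  { case 2 show ?case
    proof (cases l)
      case (Suc l')
      have "odd (2 * Suc m choose (2 * l + 1)) =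
         odd ((2 * m choose (2 * l' + 1)) + 2 * (2 * m choose (2 * Suc l')) + (2 * m choose (2 * Suc l' + 1)))"
        by (simp add: Suc) blast
      then show ?thesis using Suc.IH(2)[of l'] Suc.IH(2)[of "Suc l'"] by (simp add: Suc)
    qed (simp) }
qed

lemma odd_choose_double:
  "odd (Suc (2 * m) choose (2 * l)) = odd (m choose l)"
  "odd (Suc (2 * m) choose Suc (2 * l)) = odd (m choose l)"
  using even_choose_double[of m l] even_choose_double(2)[of m "l - 1"]
  by (cases l; simp)+

text \<open>All k digits of f + g are 1, so g is the digitwise complement of f. An odd binomial
  coefficient forces the digits of g below those of f, which leaves only g = 0.\<close>

lemma odd_choose_full:
  assumes "f + g + 1 = 2 ^ k" "odd (f choose g)"
  shows "g = 0"
  using assms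
proof (induction k arbitrary: f g)
  case (Suc k)
  show ?case
  proof (cases "even g")
    case True
    then obtain g' where g: "g = 2 * g'" by (rule evenE)
    then have "odd f" using Suc.prems(1) by (metis even_add even_mult_iff even_numeral odd_one power_Suc)
    then obtain f' where "f = Suc (2 * f')" by (metis oddE Suc_eq_plus1)
    with Suc.prems g have "f' + g' + 1 = 2 ^ k" "odd (f' choose g')"
      by (simp_all add: odd_choose_double)
    from Suc.IH[OF this] show ?thesis by (simp add: g)
  next
    case False
    then obtain g' where g: "g = 2 * g' + 1" by (rule oddE)
    then have "even f" using Suc.prems(1) by (metis False even_add even_mult_iff even_numeral odd_one power_Suc)
    then obtain f' where "f = 2 * f'" by (rule evenE)
    with Suc g even_choose_double(2) show ?thesis by metis
  qed
qed simp

text \<open>Below digit j of the sum, f has digit 1 and g has digit 0. At digit j either both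
  vanish, and the remaining digits are complementary as in \<open>odd_choose_full\<close>, or both
  are 1 and the carry moves the gap one digit up. In the end f itself lacks exactly one
  digit.\<close>

lemma odd_choose_gap:
  assumes "f + g + 1 + 2 ^ j = 2 ^ k" "j < k" "odd (f choose g)"
  shows "\<exists>s<k. f + 1 + 2 ^ s = 2 ^ k"
  using assms
proof (induction k arbitrary: f g j)
  case (Suc k)
  show ?case
  proof (cases j)
    case 0
    show ?thesis
    proof (cases "even g")
      case True
      then obtain g' where g: "g = 2 * g'" by (rule evenE)
      then have "even f" using Suc.prems(1) 0 by (metis even_add even_mult_iff even_numeral odd_one power_Suc power_0)
      then obtain f' where f: "f = 2 * f'" by (rule evenE)
      have "g' = 0" using Suc.prems f g 0 even_choose_double(1)[of f' g']
        by (intro odd_choose_full[of f' g' k]) auto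
      then show ?thesis using Suc.prems f g 0 by auto
    next
      case False
      then obtain g' where g: "g = Suc (2 * g')" by (metis oddE Suc_eq_plus1)
      then have "odd f" using Suc.prems(1) 0 False by (metis even_add even_mult_iff even_numeral odd_one power_Suc power_0)
      then obtain f' where f: "f = Suc (2 * f')" by (metis oddE Suc_eq_plus1)
      \<comment> \<open>The two digits 1 produce a carry, so after halving the sum again has its gap
        at digit 0. This is the induction hypothesis with the gap at 0, and k is positive because
        the left side is at least 2.\<close>
      have e: "f' + g' + 1 + 2 ^ 0 = 2 ^ k" using Suc.prems f g 0 by simp
      then have "0 < k" by (cases k) auto
      from Suc.IH[OF e this] Suc.prems(3) obtain s where "s < k" "f' + 1 + 2 ^ s = 2 ^ k"
        unfolding f g odd_choose_double by blast
      then show ?thesis by (intro exI[of _ "Suc s"]) (simp add: f)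
    qed
  next
    case (Suc j')
    have "even (f + g + 1)" using Suc.prems(1) Suc by (metis even_add even_mult_iff even_numeral power_Suc)
    show ?thesis
    proof (cases "even g")
      case True
      then obtain g' where g: "g = 2 * g'" by (rule evenE)
      then have "odd f" using \<open>even (f + g + 1)\<close> by simp
      then obtain f' where f: "f = Suc (2 * f')" by (metis oddE Suc_eq_plus1)
      have e: "f' + g' + 1 + 2 ^ j' = 2 ^ k" using Suc.prems f g Suc by simp
      have "j' < k" using Suc.prems Suc by simp
      from Suc.IH[OF e this] Suc.prems(3) obtain s where "s < k" "f' + 1 + 2 ^ s = 2 ^ k"
        unfolding f g odd_choose_double by blast
      then show ?thesis by (intro exI[of _ "Suc s"]) (simp add: f)
    next
      case False
      then obtain g' where g: "g = 2 * g' + 1" by (rule oddE)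
      then have "even f" using \<open>even (f + g + 1)\<close> by simp
      then obtain f' where "f = 2 * f'" by (rule evenE)
      with Suc.prems(3) g even_choose_double(2) show ?thesis by metis
    qed
  qed
qed simp

text \<open>One direction of Lucas' theorem; each induction step strips the lowest digit of both
  arguments.\<close>

lemma odd_choose_digit:
  assumes "odd (f choose g)"
  shows "g div 2 ^ l mod 2 \<le> f div 2 ^ l mod 2"
  using assms
proof (induction l arbitrary: f g)
  case 0
  show ?case
  proof (rule ccontr)
    assume "\<not> ?case"
    then have "even f \<and> odd g" by simp presburger
    with 0 show False by (metis evenE oddE even_choose_double(2))
  qed
next
  case (Suc l)
  obtain f' a where f: "f = 2 * f' + a" "a = 0 \<or> a = 1"
    by (metis mod_mult_div_eq parity_cases add.commute)
  obtain g' b where g: "g = 2 * g' + b" "b = 0 \<or> b = 1"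
    by (metis mod_mult_div_eq parity_cases add.commute)
  have "odd (f' choose g')"
    using Suc.prems f g even_choose_double[of f' g'] odd_choose_double[of f' g'] by auto
  from Suc.IH[OF this] show ?case using f g by (auto simp: div_mult2_eq)
qed

section \<open>Binary digits of 2^k - 1 with at most one digit removed\<close>

lemma digit_gap:
  assumes "l < k" "t < k"
  shows "(2 ^ k - 1 - 2 ^ t) div 2 ^ l mod 2 = (if l = t then 0 else 1 :: nat)"
  using assms
proof (induction k arbitrary: l t)
  case (Suc k)
  have pos: "(2::nat) ^ k \<ge> 1" by simp
  show ?case
  proof (cases t)
    case 0
    have e: "(2::nat) ^ Suc k - 1 - 2 ^ t = 2 * (2 ^ k - 1)" using 0 by simp
    show ?thesis
    proof (cases l)
      case (Suc l')
      have "(2 ^ k - 1 :: nat) div 2 ^ l' mod 2 = of_bool (bit (mask k :: nat) l')"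
        by (simp add: bit_iff_odd mask_eq_exp_minus_1 mod_2_eq_odd)
      moreover have "bit (mask k :: nat) l'" using Suc.prems Suc by (simp add: bit_mask_iff)
      moreover have "2 * (2 ^ k - 1) div 2 ^ l = (2 ^ k - 1 :: nat) div 2 ^ l'" by (simp add: Suc)
      ultimately show ?thesis using Suc 0 unfolding e by simp
    qed (simp add: 0 e del: power_Suc)
  next
    case (Suc t')
    have pos': "(2::nat) ^ t' \<ge> 1" by simp
    have le: "(2::nat) ^ Suc t' \<le> 2 ^ k" using Suc.prems Suc by (intro power_increasing) auto
    have e: "(2::nat) ^ Suc k - 1 - 2 ^ t = Suc (2 * (2 ^ k - 1 - 2 ^ t'))" using le pos pos' unfolding Suc power_Suc by linarith
    show ?thesis
    proof (cases l)
      case (Suc l')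
      then show ?thesis using Suc.IH[of l' t'] Suc.prems \<open>t = Suc t'\<close> unfolding e
        by (simp add: div_mult2_eq)
    next
      case 0
      show ?thesis unfolding e using 0 Suc by simp
    qed
  qed
qed simp

lemma digit_full: "l < k \<Longrightarrow> (2 ^ k - 1) div 2 ^ l mod 2 = (1 :: nat)"
proof -
  assume "l < k"
  then have "bit (mask k :: nat) l" by (simp add: bit_mask_iff)
  then show ?thesis by (simp add: bit_iff_odd mask_eq_exp_minus_1 odd_iff_mod_2_eq_one)
qed

section \<open>Characteristic 2 arithmetic and spans in N(n)\<close>

lemma rmot_double: "u + u = (0 :: 'n rmot)"
  by (metis rmot_two mult_2 mult_zero_left)

lemma rmot_uminus: "- u = (u :: 'n rmot)"
  by (rule minus_unique[OF rmot_double])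

lemma rmot_minus: "u - v = (u + v :: 'n rmot)"
  by (simp only: diff_conv_add_uminus rmot_uminus)

lemma rmot_add_self_left: "u + (u + v) = (v :: 'n rmot)"
  by (simp add: rmot_double flip: add.assoc)

text \<open>The only nonzero scalar is 1, so the scalars of the usual span induction
  disappear.\<close>

lemma F2_span_add_induct [consumes 1, case_names zero add]:
  fixes u :: "'n rmot"
  assumes "u \<in> F2_span S" "R 0" "\<And>s u. s \<in> S \<Longrightarrow> u \<in> F2_span S \<Longrightarrow> R u \<Longrightarrow> R (s + u)"
  shows "R u"
proof -
  have "u \<in> F2_span S \<and> R u" using assms(1)
  proof (induction rule: rmot.span_induct_alt)
    case base
    then show ?case by (simp add: assms(2) rmot.span_zero)
  next
    case (step c s u)
    have "f2_scale c s = 0 \<or> f2_scale c s = s" by (simp add: f2_scale_def)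
    with step show ?case
      using assms(3)[of s u] rmot.span_add[OF rmot.span_base[of s S], of u] by auto
  qed
  then show ?thesis ..
qed

text \<open>A generator that is added a second time cancels. This matches the description of
  coordinates by finite sets of monomials in \<open>basis_complement\<close>.\<close>

lemma F2_span_eq_subset_sums:
  fixes S :: "'n rmot set"
  shows "F2_span S = {\<Sum>B | B. finite B \<and> B \<subseteq> S}"
proof (intro equalityI subsetI)
  fix u assume "u \<in> F2_span S"
  then show "u \<in> {\<Sum>B | B. finite B \<and> B \<subseteq> S}"
  proof (induction rule: F2_span_add_induct)
    case zero
    show ?case by (rule CollectI, rule exI[of _ "{}"]) simp
  next
    case (add s u)
    then obtain B where B: "finite B" "B \<subseteq> S" "u = \<Sum>B" by auto
    show ?case
    proof (cases "s \<in> B")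
      case True
      then have "s + u = \<Sum>(B - {s})"
        using B by (simp add: sum.remove[of B s] rmot_add_self_left)
      then show ?thesis using B by (intro CollectI exI[of _ "B - {s}"]) auto
    next
      case False
      then have "s + u = \<Sum>(insert s B)" using B by simp
      then show ?thesis using B add.hyps by (intro CollectI exI[of _ "insert s B"]) auto
    qed
  qed
qed (auto intro: rmot.span_sum rmot.span_base)

section \<open>The monomial basis of N(n)\<close>

abbreviation bmon :: "'n::finite set \<Rightarrow> ('n \<Rightarrow> nat) \<Rightarrow> 'n rmot"
  where "bmon I e \<equiv> prod nx I * ymon e"

text \<open>Exponent vector of the monomial x_I y^e, free of \<tau> and squarefree in the x_i.
  Coefficients at these vectors, read off from a polynomial representative, give the linear
  independence of such monomials in N(n).\<close>

lift_definition expo :: "'n::finite set \<Rightarrow> ('n \<Rightarrow> nat) \<Rightarrow> 'n mvar \<Rightarrow>\<^sub>0 nat"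
  is "\<lambda>I e v. case v of VarT \<Rightarrow> 0 | VarX i \<Rightarrow> of_bool (i \<in> I) | VarY i \<Rightarrow> e i"
proof -
  fix I :: "'n set" and e :: "'n \<Rightarrow> nat"
  have "v \<in> insert VarT (range VarX \<union> range VarY)" for v :: "'n mvar"
    by (cases v) auto
  then have "{v. (case v of VarT \<Rightarrow> 0 | VarX i \<Rightarrow> of_bool (i \<in> I) | VarY i \<Rightarrow> e i) \<noteq> 0}
      \<subseteq> insert VarT (range VarX \<union> range VarY)" by blast
  then show "finite {v. (case v of VarT \<Rightarrow> 0 | VarX i \<Rightarrow> of_bool (i \<in> I) | VarY i \<Rightarrow> e i) \<noteq> 0}"
    by (rule finite_subset) simp
qed

lemma expo_eq_iff: "expo I e = expo J f \<longleftrightarrow> I = J \<and> e = f"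
proof
  assume "expo I e = expo J f"
  then have *: "Poly_Mapping.lookup (expo I e) v = Poly_Mapping.lookup (expo J f) v" for v by simp
  have "i \<in> I \<longleftrightarrow> i \<in> J" for i
    using *[of "VarX i"] by (cases "i \<in> I"; cases "i \<in> J") (simp_all add: expo.rep_eq)
  moreover have "e i = f i" for i
    using *[of "VarY i"] by (simp add: expo.rep_eq)
  ultimately show "I = J \<and> e = f" by auto
qed simp

lemma lookup_single_mult_eq_0:
  fixes q :: "('v \<Rightarrow>\<^sub>0 nat) \<Rightarrow>\<^sub>0 bit"
  assumes "\<And>m'. m + m' \<noteq> l"
  shows "Poly_Mapping.lookup (q * Poly_Mapping.single m 1) l = 0"
proof (induction q rule: bit_pm_induct)
  case (add m' q)
  have "m' + m \<noteq> l" using assms[of m'] by (simp add: add.commute)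
  with add show ?case by (simp add: distrib_right lookup_add mult_single lookup_single when_def)
qed simp

text \<open>Every term of a multiple of x_i^2 + \<tau> y_i is divisible by x_i^2 or by \<tau>,
  whereas x_I y^e is divisible by neither. Hence the coefficient descends to M(n).\<close>

lemma lookup_expo_mot_ideal:
  assumes "r \<in> mot_ideal"
  shows "Poly_Mapping.lookup r (expo I e) = 0"
  using assms unfolding mot_ideal_def
proof (induction rule: mult_module.span_induct_alt)
  case (step c b y)
  then obtain i where b: "b = pvar (VarX i) ^ 2 + pvar VarT * pvar (VarY i)" by auto
  have "Poly_Mapping.single (VarX i) 1 + Poly_Mapping.single (VarX i) 1 + m \<noteq> expo I e" for m
  proof
    assume *: "Poly_Mapping.single (VarX i) 1 + Poly_Mapping.single (VarX i) 1 + m = expo I e"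
    have "2 \<le> Poly_Mapping.lookup (expo I e) (VarX i)"
      unfolding *[symmetric] by (simp add: lookup_add)
    then show False by (cases "i \<in> I") (simp_all add: expo.rep_eq)
  qed
  moreover have "Poly_Mapping.single VarT 1 + Poly_Mapping.single (VarY i) 1 + m \<noteq> expo I e" for m
  proof
    assume *: "Poly_Mapping.single VarT 1 + Poly_Mapping.single (VarY i) 1 + m = expo I e"
    have "1 \<le> Poly_Mapping.lookup (expo I e) VarT"
      unfolding *[symmetric] by (simp add: lookup_add)
    then show False by (simp add: expo.rep_eq)
  qed
  ultimately show ?case
    using step.IH by (simp add: b distrib_left lookup_add pvar_def power2_eq_square mult_single
        lookup_single_mult_eq_0)
qed simp

lift_definition mcoef :: "'n::finite set \<Rightarrow> ('n \<Rightarrow> nat) \<Rightarrow> 'n mot \<Rightarrow> bit"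
  is "\<lambda>I e p. Poly_Mapping.lookup p (expo I e)"
proof -
  fix I :: "'n::finite set" and e and u v :: "'n mpol"
  assume "mot_rel u v"
  then have "Poly_Mapping.lookup (u - v) (expo I e) = 0"
    unfolding mot_rel_def by (rule lookup_expo_mot_ideal)
  moreover have "Poly_Mapping.lookup u (expo I e)
      = Poly_Mapping.lookup (u - v) (expo I e) + Poly_Mapping.lookup v (expo I e)"
    by (simp only: lookup_add[symmetric] diff_add_cancel)
  ultimately show "Poly_Mapping.lookup u (expo I e) = Poly_Mapping.lookup v (expo I e)" by simp
qed

lemma mcoef_add: "mcoef I e (u + v) = mcoef I e u + mcoef I e v"
  by transfer (rule lookup_add)

lemma mcoef_tau: "mcoef I e (tau * u) = 0"
proof transfer
  fix I :: "'n::finite set" and e and u :: "'n mpol"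
  have "Poly_Mapping.single VarT 1 + m \<noteq> expo I e" for m
  proof
    assume *: "Poly_Mapping.single VarT 1 + m = expo I e"
    have "1 \<le> Poly_Mapping.lookup (expo I e) VarT"
      unfolding *[symmetric] by (simp add: lookup_add)
    then show False by (simp add: expo.rep_eq)
  qed
  then show "Poly_Mapping.lookup (pvar VarT * u) (expo I e) = 0"
    by (simp add: pvar_def mult.commute[of _ u] lookup_single_mult_eq_0)
qed

lift_definition coef :: "'n::finite set \<Rightarrow> ('n \<Rightarrow> nat) \<Rightarrow> 'n rmot \<Rightarrow> bit"
  is mcoef
proof -
  fix I :: "'n::finite set" and e and u v :: "'n mot"
  assume "rmot_rel u v"
  then obtain w where "u = v + tau * w"
    unfolding rmot_rel_def by (metis dvdE add.commute diff_add_cancel)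
  then show "mcoef I e u = mcoef I e v" by (simp add: mcoef_add mcoef_tau)
qed

lemma coef_add: "coef I e (u + v) = coef I e u + coef I e v"
  by transfer (rule mcoef_add)

lemma abs_rmot_prod: "abs_rmot (\<Prod>i\<in>A. f i) = (\<Prod>i\<in>A. abs_rmot (f i))"
  by (induction A rule: infinite_finite_induct) (simp_all add: abs_rmot_simps)

lemma abs_rmot_power: "abs_rmot (u ^ a) = abs_rmot u ^ a"
  by (induction a) (simp_all add: abs_rmot_simps)

lemma abs_mot_mult: "abs_mot (p * q) = abs_mot p * abs_mot q"
  by (simp add: times_mot.abs_eq)

lemma abs_mot_prod: "abs_mot (\<Prod>i\<in>A. f i) = (\<Prod>i\<in>A. abs_mot (f i))"
  by (induction A rule: infinite_finite_induct) (simp_all add: abs_mot_mult one_mot_def[symmetric])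

lemma abs_mot_power: "abs_mot (u ^ a) = abs_mot u ^ a"
  by (induction a) (simp_all add: abs_mot_mult one_mot_def[symmetric])

lemma pvar_power: "pvar v ^ a = Poly_Mapping.single (Poly_Mapping.single v a) 1"
  by (induction a) (simp_all add: pvar_def mult_single flip: single_add)

lemma prod_single: "(\<Prod>i\<in>A. Poly_Mapping.single (m i) 1) = Poly_Mapping.single (\<Sum>i\<in>A. m i) (1::bit)"
  by (induction A rule: infinite_finite_induct) (simp_all add: mult_single)

text \<open>Identifies the product formed in the quotient ring with the class of a single polynomial
  monomial, on which \<open>coef\<close> can be evaluated.\<close>

lemma bmon_eq_abs: "bmon I e = abs_rmot (abs_mot (Poly_Mapping.single (expo I e) 1))"
proof -
  have "expo I e = (\<Sum>i\<in>I. Poly_Mapping.single (VarX i) 1) + (\<Sum>i\<in>UNIV. Poly_Mapping.single (VarY i) (e i))"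
    (is "_ = ?m")
  proof (rule poly_mapping_eqI)
    fix v
    show "Poly_Mapping.lookup (expo I e) v = Poly_Mapping.lookup ?m v"
      by (cases v) (auto simp: expo.rep_eq lookup_add lookup_sum lookup_single when_def)
  qed
  then have "Poly_Mapping.single (expo I e) 1 = (\<Prod>i\<in>I. pvar (VarX i)) * (\<Prod>i\<in>UNIV. pvar (VarY i) ^ e i)"
    by (simp add: pvar_power prod_single mult_single) (simp add: pvar_def prod_single mult_single)
  moreover have "abs_mot (pvar (VarX i)) = mx i" "abs_mot (pvar (VarY i)) = my i" for i :: 'a
    by (simp_all add: mx_def my_def)
  ultimately show ?thesis
    by (simp add: abs_mot_mult abs_mot_prod abs_mot_power abs_rmot_simps abs_rmot_prod abs_rmot_power
        ymon_def)
qed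

lemma coef_bmon: "coef I e (bmon J f) = of_bool (I = J \<and> e = f)"
  unfolding bmon_eq_abs coef.abs_eq mcoef.abs_eq
  by (auto simp: lookup_single when_def expo_eq_iff)

lemma coef_0: "coef I e 0 = 0"
  using coef_add[of I e 0 0] by simp

section \<open>Products of monomials, spanning and independence\<close>

lemma nx_square: "nx i * nx i = (0 :: 'n rmot)"
proof -
  have "abs_rmot (mx i * mx i + tau * my i) = (0 :: 'n rmot)"
    using mot_relation[of i] by (simp add: power2_eq_square abs_rmot_simps)
  then show ?thesis by (simp add: abs_rmot_simps)
qed

lemma prod_nx_mult: "prod nx I * prod nx J = (if I \<inter> J = {} then prod nx (I \<union> J) else (0 :: 'n::finite rmot))"
proof (cases "I \<inter> J = {}")
  case True
  then show ?thesis by (simp add: prod.union_disjoint)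
next
  case False
  then obtain i where i: "i \<in> I" "i \<in> J" by auto
  then have "prod nx I * prod nx J = (nx i * nx i) * (prod nx (I - {i}) * prod nx (J - {i}))"
    by (subst prod.remove[of I i nx], simp, simp, subst prod.remove[of J i nx], simp, simp)
      (simp only: mult_ac)
  with False show ?thesis by (simp add: nx_square)
qed

lemma ymon_add: "ymon (\<lambda>i. e i + f i) = ymon e * ymon f"
  by (simp add: ymon_def power_add prod.distrib)

lemma nx_eq_bmon: "nx i = bmon {i} (\<lambda>_. 0)"
  and ny_eq_bmon: "ny i = bmon {} (\<lambda>j. of_bool (j = i))"
  and one_eq_bmon: "1 = bmon {} (\<lambda>_. 0)"
proof -
  have "ny j ^ of_bool (j = i) = (if j = i then ny j else 1)" for j by simp
  then show "ny i = bmon {} (\<lambda>j. of_bool (j = i))" by (simp add: ymon_def)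
qed (simp_all add: ymon_def)

lemma bmon_mult: "bmon I e * bmon J f = (if I \<inter> J = {} then bmon (I \<union> J) (\<lambda>i. e i + f i) else 0)"
proof -
  have "bmon I e * bmon J f = (prod nx I * prod nx J) * (ymon e * ymon f)" by (simp only: mult_ac)
  then show ?thesis unfolding prod_nx_mult ymon_add by simp
qed

lemma F2_span_mult_closed:
  fixes S :: "'n rmot set"
  assumes "\<And>s t. s \<in> S \<Longrightarrow> t \<in> T \<Longrightarrow> s * t \<in> F2_span W" "u \<in> F2_span S" "v \<in> F2_span T"
  shows "u * v \<in> F2_span W"
  using assms(2)
proof (induction rule: F2_span_add_induct)
  case (add s u)
  have "s * v \<in> F2_span W" using assms(3)
  proof (induction rule: F2_span_add_induct)
    case (add t v)
    then show ?case using assms(1)[OF \<open>s \<in> S\<close>] by (simp add: distrib_left rmot.span_add)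
  qed (simp add: rmot.span_zero)
  with add show ?case by (simp add: distrib_right rmot.span_add)
qed (simp add: rmot.span_zero)

text \<open>Induction over the ring generators: \<tau> becomes 0, and a product of two such
  monomials is again one or vanishes because x_i^2 = 0.\<close>

lemma rmot_in_span: "(u :: 'n::finite rmot) \<in> F2_span {bmon I e | I e. True}" (is "_ \<in> ?S")
proof -
  have b: "bmon I e \<in> ?S" for I e by (rule rmot.span_base) auto
  have "abs_rmot v \<in> ?S" for v :: "'n mot"
  proof (induction v rule: mot_induct)
    case one
    show ?case by (simp only: abs_rmot_simps(2)) (subst one_eq_bmon, rule b)
  next
    case tau
    then show ?case by (simp add: abs_rmot_simps rmot.span_zero)
  next
    case (x i)
    show ?case by (simp only: abs_rmot_simps(4)) (subst nx_eq_bmon, rule b)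
  next
    case (y i)
    show ?case by (simp only: abs_rmot_simps(5)) (subst ny_eq_bmon, rule b)
  next
    case (add u v)
    then show ?case by (simp add: abs_rmot_simps rmot.span_add)
  next
    case (mult u v)
    have "s * t \<in> ?S" if "s \<in> {bmon I e | I e. True}" "t \<in> {bmon I e | I e. True}" for s t :: "'n rmot"
    proof -
      from that obtain I e J f where st: "s = bmon I e" "t = bmon J f" by blast
      show ?thesis unfolding st bmon_mult using b rmot.span_zero by (cases "I \<inter> J = {}") simp_all
    qed
    from this mult have "abs_rmot u * abs_rmot v \<in> ?S" by (rule F2_span_mult_closed)
    then show ?case unfolding abs_rmot_simps .
  qed
  then show ?thesis using rmot_cases[of u] by metis
qed

lemma rmot_induct [case_names zero add]:
  fixes u :: "'n::finite rmot"
  assumes "R 0" "\<And>I e u. R u \<Longrightarrow> R (bmon I e + u)"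
  shows "R u"
  using rmot_in_span[of u] by (induction rule: F2_span_add_induct) (auto intro: assms)

lemma coef_sum: "finite B \<Longrightarrow> coef I e (\<Sum>b\<in>B. h b) = (\<Sum>b\<in>B. coef I e (h b))"
  by (induction B rule: finite_induct) (simp_all add: coef_0 coef_add del: add_bit_eq_xor)

text \<open>The coefficient functionals are dual to the spanning monomials: an element written as a
  sum of distinct monomials has coefficient 1 at each of them.\<close>

lemma rmot_eq_0:
  assumes "\<And>I e. coef I e u = 0"
  shows "u = 0"
proof -
  obtain B where B: "finite B" "B \<subseteq> {bmon I e | I e. True}" "u = \<Sum>B"
    using rmot_in_span[of u] unfolding F2_span_eq_subset_sums by auto
  have "B = {}"
  proof (rule ccontr)
    assume "B \<noteq> {}"
    then obtain I e where b: "bmon I e \<in> B" using B(2) by blast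
    have "coef I e u = (\<Sum>b\<in>B. coef I e b)" unfolding B(3) using B(1) by (rule coef_sum)
    also have "\<dots> = (\<Sum>b\<in>{bmon I e}. coef I e b)"
    proof (rule sum.mono_neutral_right)
      show "\<forall>c \<in> B - {bmon I e}. coef I e c = 0"
      proof
        fix c assume c: "c \<in> B - {bmon I e}"
        then obtain J f where "c = bmon J f" using B(2) by blast
        with c show "coef I e c = 0" by (auto simp: coef_bmon)
      qed
    qed (use B(1) b in auto)
    finally show False by (simp add: assms coef_bmon)
  qed
  with B show ?thesis by simp
qed

section \<open>The reduced operations on the monomial basis\<close>

text \<open>The total operation sends y to y (1 + y), hence y^m to y^m (1 + y)^m. In the induction
  on m only P^0 and P^1 act on the new factor, and the result is Pascal's rule.\<close>

lemma red_P_ny_power: "red_P a (ny i ^ m) = (if odd (m choose a) then ny i ^ (m + a) else 0)"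
proof (induction m arbitrary: a)
  case 0
  then show ?case by (cases a) (simp_all add: red_P_0 red_P_gens)
next
  case (Suc m)
  show ?case
  proof (cases a)
    case (Suc a')
    have "red_P b (ny i) * red_P (a - b) (ny i ^ m) = 0" if "b \<in> {..a} - {0, 1}" for b
    proof -
      have "b \<ge> 2" using that by auto
      then show ?thesis by (simp add: red_P_gens(4))
    qed
    then have "red_P a (ny i * ny i ^ m) = (\<Sum>b\<in>{0, 1}. red_P b (ny i) * red_P (a - b) (ny i ^ m))"
      unfolding red_P_mult using Suc by (intro sum.mono_neutral_right) auto
    also have "\<dots> = ny i * red_P a (ny i ^ m) + ny i ^ 2 * red_P a' (ny i ^ m)"
      using Suc by (simp add: red_P_0 red_P_gens(3)[unfolded One_nat_def])
    finally show ?thesis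
      using Suc by (simp add: Suc.IH power2_eq_square rmot_double mult_ac)
  qed (simp add: red_P_0)
qed

text \<open>Index set of the terms that survive mod 2 when P^a(y^f) is expanded: g distributes the
  degree a over the variables, and its coefficient is the product of the binomials.\<close>

definition bit_summands :: "('n::finite \<Rightarrow> nat) \<Rightarrow> nat \<Rightarrow> ('n \<Rightarrow> nat) set"
  where "bit_summands f a = {g. sum g UNIV = a \<and> (\<forall>i. odd (f i choose g i))}"

lemma finite_bounded_functions: "finite {g :: 'n::finite \<Rightarrow> nat. \<forall>i. g i \<le> b i}"
proof -
  have "{g. \<forall>i. g i \<le> b i} = PiE UNIV (\<lambda>i. {..b i})" by (auto simp: PiE_def)
  then show ?thesis by (simp add: finite_PiE)
qed

lemma odd_choose_le: "odd (m choose a) \<Longrightarrow> a \<le> m"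
  by (metis binomial_eq_0 even_zero not_le_imp_less)

lemma finite_bit_summands: "finite (bit_summands f a)"
  by (rule finite_subset[OF _ finite_bounded_functions[of f]])
    (auto simp: bit_summands_def odd_choose_le)

lemma red_P_ymon: "red_P a (ymon f) = (\<Sum>g\<in>bit_summands f a. ymon (\<lambda>i. f i + g i))"
proof -
  \<comment> \<open>Summands supported on A, so that the Cartan formula can be applied one variable
    at a time; A = UNIV gives back \<open>bit_summands f a\<close>.\<close>
  define S where "S A a = {g \<in> bit_summands f a. \<forall>i. i \<notin> A \<longrightarrow> g i = 0}" for A a
  have "red_P a (\<Prod>i\<in>A. ny i ^ f i) = (\<Sum>g\<in>S A a. \<Prod>i\<in>A. ny i ^ (f i + g i))" for A
    using finite[of A]
  proof (induction A arbitrary: a rule: finite_induct)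
    case empty
    have "S {} a = (if a = 0 then {\<lambda>_. 0} else {})"
      by (auto simp: S_def bit_summands_def fun_eq_iff)
    then show ?case by (auto simp: red_P_0 red_P_gens)
  next
    case (insert x A)
    have "red_P a (\<Prod>i\<in>insert x A. ny i ^ f i)
        = (\<Sum>b\<le>a. if odd (f x choose b) then (\<Sum>g\<in>S A (a - b). ny x ^ (f x + b) * (\<Prod>i\<in>A. ny i ^ (f i + g i))) else 0)"
      using insert by (auto simp: red_P_mult red_P_ny_power sum_distrib_left intro!: sum.cong)
    also have "\<dots> = (\<Sum>b\<in>{b\<in>{..a}. odd (f x choose b)}. \<Sum>g\<in>S A (a - b). ny x ^ (f x + b) * (\<Prod>i\<in>A. ny i ^ (f i + g i)))"
      by (rule sum.inter_filter[symmetric]) simp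
    also have "\<dots> = (\<Sum>(b, g)\<in>Sigma {b\<in>{..a}. odd (f x choose b)} (\<lambda>b. S A (a - b)).
        ny x ^ (f x + b) * (\<Prod>i\<in>A. ny i ^ (f i + g i)))"
      by (rule sum.Sigma) (auto simp: S_def finite_bit_summands)
    also have "\<dots> = (\<Sum>g\<in>S (insert x A) a. \<Prod>i\<in>insert x A. ny i ^ (f i + g i))"
    proof (rule sum.reindex_bij_witness[of _ "\<lambda>h. (h x, h(x := 0))" "\<lambda>(b, g). g(x := b)"])
      fix bg assume "bg \<in> Sigma {b\<in>{..a}. odd (f x choose b)} (\<lambda>b. S A (a - b))"
      then obtain b g where bg: "bg = (b, g)" "b \<le> a" "odd (f x choose b)" "g \<in> S A (a - b)" by auto
      have gx: "g x = 0" using bg(4) insert.hyps by (auto simp: S_def)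
      then show "(\<lambda>h. (h x, h(x := 0))) ((\<lambda>(b, g). g(x := b)) bg) = bg"
        by (auto simp: bg(1))
      have "sum (g(x := b)) UNIV = b + sum g (UNIV - {x})"
        by (simp add: sum.remove[of UNIV x])
      also have "sum g (UNIV - {x}) = a - b"
        using gx bg(4) by (simp add: S_def bit_summands_def sum.remove[of UNIV x])
      finally show "(\<lambda>(b, g). g(x := b)) bg \<in> S (insert x A) a"
        using bg by (auto simp: S_def bit_summands_def)
      show "(\<Prod>i\<in>insert x A. ny i ^ (f i + (\<lambda>(b, g). g(x := b)) bg i)) =
         (case bg of (b, g) \<Rightarrow> ny x ^ (f x + b) * (\<Prod>i\<in>A. ny i ^ (f i + g i)))"
        using insert.hyps by (auto simp: bg(1) intro!: arg_cong2[where f = "(*)"] prod.cong)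
    next
      fix h assume h: "h \<in> S (insert x A) a"
      show "(\<lambda>(b, g). g(x := b)) ((\<lambda>h. (h x, h(x := 0))) h) = h" by simp
      have "sum h UNIV = h x + sum (h(x := 0)) UNIV"
        by (simp add: sum.remove[of UNIV x])
      then show "(\<lambda>h. (h x, h(x := 0))) h \<in> Sigma {b\<in>{..a}. odd (f x choose b)} (\<lambda>b. S A (a - b))"
        using h by (auto simp: S_def bit_summands_def)
    qed
    finally show ?case .
  qed
  from this[of UNIV] show ?thesis by (simp add: S_def ymon_def)
qed

lemma red_P_prod_nx: "red_P a (prod nx I * v) = prod nx I * red_P a v" for I :: "'n::finite set"
proof -
  have "prod nx I \<in> Lambda" unfolding Lambda_def by (rule rmot.span_base) auto
  then have "red_P a (prod nx I * v) = (\<Sum>b\<in>{0}. red_P b (prod nx I) * red_P (a - b) v)"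
    unfolding red_P_mult by (intro sum.mono_neutral_right) (auto simp: red_P_Lambda)
  then show ?thesis by (simp add: red_P_0)
qed

lemma red_P_bmon: "red_P a (bmon I f) = (\<Sum>g\<in>bit_summands f a. bmon I (\<lambda>i. f i + g i))"
  by (simp add: red_P_prod_nx red_P_ymon sum_distrib_left)

lemma red_Q_0: "red_Q 0 = 0"
  using red_Q_add[of 0 0] by simp

lemma red_Q_1: "red_Q 1 = 0"
  using red_Q_mult[of 1 1] by (simp add: rmot_double)

lemma red_Q_gens: "red_Q (nx i) = ny i" "red_Q (ny i) = 0"
  unfolding abs_rmot_simps(4,5)[symmetric] red_Q.abs_eq
  by (simp_all add: op_Q_gens abs_rmot_simps)

lemma red_Q_prod_nx: "red_Q (prod nx I) = (\<Sum>i\<in>I. prod nx (I - {i}) * ny i)"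
proof (induction I rule: infinite_finite_induct)
  case (insert x I)
  have "(\<Sum>i\<in>I. prod nx (insert x I - {i}) * ny i) = (\<Sum>i\<in>I. nx x * (prod nx (I - {i}) * ny i))"
  proof (rule sum.cong)
    fix i assume "i \<in> I"
    then have "insert x I - {i} = insert x (I - {i})" using insert.hyps by auto
    then show "prod nx (insert x I - {i}) * ny i = nx x * (prod nx (I - {i}) * ny i)"
      using insert.hyps by (simp add: mult_ac)
  qed simp
  then show ?case
    using insert by (simp add: red_Q_mult red_Q_gens sum_distrib_left mult_ac)
qed (simp_all add: red_Q_1)

lemma red_Q_ymon: "red_Q (ymon e) = 0"
proof -
  have "red_Q (ny i ^ m) = 0" for i :: 'a and m
    by (induction m) (simp_all add: red_Q_1 red_Q_mult red_Q_gens)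
  then have "red_Q (\<Prod>i\<in>A. ny i ^ e i) = 0" for A
    by (induction A rule: infinite_finite_induct) (simp_all add: red_Q_1 red_Q_mult)
  then show ?thesis by (simp add: ymon_def)
qed

lemma ny_mult_ymon: "ny i * ymon e = ymon (e(i := Suc (e i)))"
  by (simp add: ymon_def prod.remove[of UNIV i] mult.assoc)

lemma red_Q_bmon: "red_Q (bmon I e) = (\<Sum>i\<in>I. bmon (I - {i}) (e(i := Suc (e i))))"
  by (simp add: red_Q_mult red_Q_ymon red_Q_prod_nx sum_distrib_right mult.assoc ny_mult_ymon)

section \<open>The invariant functional\<close>

text \<open>For \<open>t i < k\<close> the value on J has all k binary digits equal to 1 except
  digit \<open>t i\<close>, and the truncated subtraction is exact.\<close>

definition gap_exp :: "nat \<Rightarrow> 'n set \<Rightarrow> ('n \<Rightarrow> nat) \<Rightarrow> 'n \<Rightarrow> nat"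
  where "gap_exp k J t i = (if i \<in> J then 2 ^ k - 1 - 2 ^ t i else 2 ^ k - 1)"

text \<open>The set collects exponents rather than bijections, so two functions t that agree on J
  count once.\<close>

definition top_pairs :: "nat \<Rightarrow> ('n::finite set \<times> ('n \<Rightarrow> nat)) set"
  where "top_pairs k = {(J, gap_exp k J t) | J t. card J = k \<and> bij_betw t J {..<k}}"

definition Psi :: "nat \<Rightarrow> 'n::finite rmot \<Rightarrow> bit"
  where "Psi k u = (\<Sum>(J, e)\<in>top_pairs k. coef J e u)"

lemma finite_top_pairs: "finite (top_pairs k)"
proof (rule finite_subset)
  show "top_pairs k \<subseteq> UNIV \<times> {e. \<forall>i. e i \<le> 2 ^ k}"
    by (auto simp: top_pairs_def gap_exp_def)
qed (simp add: finite_bounded_functions)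

lemma Psi_add: "Psi k (u + v) = Psi k u + Psi k v"
  by (simp add: Psi_def coef_add sum.distrib case_prod_beta del: add_bit_eq_xor)

lemma Psi_0: "Psi k 0 = 0"
  by (simp add: Psi_def coef_0)

lemma Psi_sum: "Psi k (\<Sum>b\<in>B. h b) = (\<Sum>b\<in>B. Psi k (h b))"
  by (induction B rule: infinite_finite_induct) (simp_all add: Psi_0 Psi_add del: add_bit_eq_xor)

lemma Psi_bmon: "Psi k (bmon I e) = of_bool ((I, e) \<in> top_pairs k)"
proof -
  have "Psi k (bmon I e) = (\<Sum>p\<in>top_pairs k. if (I, e) = p then 1 else 0)"
    unfolding Psi_def by (intro sum.cong) (auto simp: coef_bmon)
  then show ?thesis by (simp add: finite_top_pairs)
qed

lemma sum_of_bool_bit: "finite B \<Longrightarrow> (\<Sum>b\<in>B. of_bool (R b) :: bit) = of_bool (odd (card {b \<in> B. R b}))"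
proof (induction B rule: finite_induct)
  case (insert x B)
  have "{b \<in> insert x B. R b} = (if R x then insert x {b \<in> B. R b} else {b \<in> B. R b})" by auto
  with insert show ?case by simp
qed simp

lemma even_card_involution:
  assumes "finite X" "\<And>x. x \<in> X \<Longrightarrow> h x \<in> X \<and> h (h x) = x \<and> h x \<noteq> x"
  shows "even (card X)"
proof -
  have "(\<Sum>x\<in>X. 1 :: bit) = 0"
    using assms(2) by (intro sum_involution_eq_0[where h = h]) auto
  then show ?thesis using sum_of_bool_bit[OF assms(1), of "\<lambda>_. True"] by simp
qed

lemma power_2_le_pred: "t < k \<Longrightarrow> (2::nat) ^ t \<le> 2 ^ k - 1"
  using power_strict_increasing[of t k "2::nat"] by linarith

text \<open>The removed powers 2^0, ..., 2^(k-1) add up to 2^k - 1, so the degree does not depend on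
  t. The additive form avoids truncated subtraction.\<close>

lemma sum_gap_exp:
  fixes J :: "'n::finite set"
  assumes "bij_betw t J {..<k}"
  shows "sum (gap_exp k J t) UNIV + (2 ^ k - 1) = CARD('n) * (2 ^ k - 1)"
proof -
  have "(\<Sum>i\<in>J. 2 ^ t i) = (\<Sum>l<k. 2 ^ l :: nat)"
    using assms by (rule sum.reindex_bij_betw)
  then have s: "2 ^ k - 1 = (\<Sum>i\<in>UNIV. if i \<in> J then 2 ^ t i else 0 :: nat)"
    by (simp add: sum.If_cases) (simp add: mask_eq_sum_exp_nat[symmetric] lessThan_def)
  have "t i < k" if "i \<in> J" for i using assms that by (auto simp: bij_betw_def)
  then have "2 ^ t i \<le> (2::nat) ^ k - 1" if "i \<in> J" for i
    using that by (simp only: power_2_le_pred)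
  then have "gap_exp k J t i + (if i \<in> J then 2 ^ t i else 0) = 2 ^ k - 1" for i
    by (cases "i \<in> J") (simp_all add: gap_exp_def del: One_nat_def diff_diff_left)
  then have "(\<Sum>i\<in>UNIV. gap_exp k J t i + (if i \<in> J then 2 ^ t i else 0)) = CARD('n) * (2 ^ k - 1)" by simp
  then show ?thesis unfolding sum.distrib s[symmetric] .
qed

lemma gap_exp_inj_on: "bij_betw t J {..<k} \<Longrightarrow> inj_on (gap_exp k J t) J"
proof (rule inj_onI)
  fix i j assume t: "bij_betw t J {..<k}" and ij: "i \<in> J" "j \<in> J" "gap_exp k J t i = gap_exp k J t j"
  have "t i < k" "t j < k" using t ij by (auto simp: bij_betw_def)
  then have "(2::nat) ^ t i \<le> 2 ^ k - 1" "(2::nat) ^ t j \<le> 2 ^ k - 1"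
    by (simp_all only: power_2_le_pred)
  moreover have "2 ^ k - 1 - 2 ^ t i = (2 ^ k - 1 - 2 ^ t j :: nat)" using ij by (simp add: gap_exp_def)
  ultimately have "(2::nat) ^ t i = 2 ^ t j" by linarith
  then have "t i = t j" by simp
  with t ij show "i = j" by (auto simp: bij_betw_def inj_on_def)
qed

lemma Psi_red_P:
  assumes "a \<ge> 1"
  shows "Psi k (red_P a u) = 0"
proof (induction u rule: rmot_induct)
  case zero
  then show ?case by (simp add: red_P_gens Psi_0)
next
  case (add I f u)
  define X where "X = {g \<in> bit_summands f a. (I, \<lambda>i. f i + g i) \<in> top_pairs k}"
  have "even (card X)"
  proof (cases "X = {}")
    case False
    then obtain g0 t0 where g0: "g0 \<in> bit_summands f a" "card I = k" "bij_betw t0 I {..<k}"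
      "(\<lambda>i. f i + g0 i) = gap_exp k I t0" by (auto simp: X_def top_pairs_def)
    have fg: "f i + g0 i = gap_exp k I t0 i" and od: "odd (f i choose g0 i)" for i
      using g0 by (simp_all add: fun_eq_iff bit_summands_def)
    \<comment> \<open>A source of a top monomial is itself nearly one: outside I nothing can have
      been added to a full exponent, and inside I the exponent of the source also lacks exactly one
      digit, called \<open>s i\<close> below.\<close>
    have out: "f i = 2 ^ k - 1" if "i \<notin> I" for i
    proof -
      have "f i + g0 i + 1 = 2 ^ k" using fg[of i] that by (simp add: gap_exp_def)
      with odd_choose_full[OF this od] show ?thesis by simp
    qed
    have "\<exists>s<k. f i + 1 + 2 ^ s = 2 ^ k" if "i \<in> I" for i
    proof -
      have t: "t0 i < k" using g0(3) that by (auto simp: bij_betw_def)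
      then have "(2::nat) ^ t0 i < 2 ^ k" by simp
      moreover have "f i + g0 i = 2 ^ k - 1 - 2 ^ t0 i" using fg[of i] that by (simp add: gap_exp_def)
      ultimately have "f i + g0 i + 1 + 2 ^ t0 i = 2 ^ k" by linarith
      from odd_choose_gap[OF this \<open>t0 i < k\<close> od] show ?thesis .
    qed
    then obtain s where s: "\<And>i. i \<in> I \<Longrightarrow> s i < k \<and> f i + 1 + 2 ^ s i = 2 ^ k" by metis
    \<comment> \<open>If the levels \<open>s i\<close> were distinct, f would already have the
      degree of the target, leaving nothing for the a >= 1 units added by g0.\<close>
    have "\<not> inj_on s I"
    proof
      assume "inj_on s I"
      then have "bij_betw s I {..<k}"
        using s g0(2) by (intro bij_betw_imageI card_subset_eq) (auto simp: card_image)
      then have "sum (gap_exp k I s) UNIV = sum (gap_exp k I t0) UNIV"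
        using sum_gap_exp[of s I k] sum_gap_exp[OF g0(3)] by linarith
      moreover have "gap_exp k I s i = f i" for i using s[of i] out[of i] by (auto simp: gap_exp_def)
      ultimately have "sum f UNIV = (\<Sum>i\<in>UNIV. f i + g0 i)" by (simp add: fg)
      then show False using g0(1) assms by (simp add: sum.distrib bit_summands_def)
    qed
    then obtain i j where ij: "i \<in> I" "j \<in> I" "i \<noteq> j" "s i = s j" by (auto simp: inj_on_def)
    then have "f i = f j" using s[of i] s[of j] by simp
    \<comment> \<open>Two indices with the same missing digit have the same exponent in f. Their
      transposition therefore preserves f and I and acts on the occurrences g.\<close>
    then have f_swap: "f (Transposition.transpose i j l) = f l" for l
      by (simp add: Transposition.transpose_def)
    have I_swap: "Transposition.transpose i j l \<in> I \<longleftrightarrow> l \<in> I" for l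
      using ij by (simp add: Transposition.transpose_def)
    have bij: "bij_betw (Transposition.transpose i j) I I"
      using I_swap by (intro bij_betw_byWitness[where f' = "Transposition.transpose i j"]) auto
    show ?thesis
    proof (rule even_card_involution)
      show "finite X" by (simp add: X_def finite_bit_summands)
    next
      fix g assume g: "g \<in> X"
      then obtain t where t: "bij_betw t I {..<k}" "(\<lambda>i. f i + g i) = gap_exp k I t"
        by (auto simp: X_def top_pairs_def)
      let ?h = "g \<circ> Transposition.transpose i j"
      have "sum ?h UNIV = sum g UNIV"
        unfolding o_def by (rule sum.reindex_bij_betw) (rule involuntory_imp_bij, simp)
      then have "?h \<in> bit_summands f a"
        using g f_swap unfolding X_def bit_summands_def mem_Collect_eq o_def by metis
      moreover have "f l + ?h l = gap_exp k I (t \<circ> Transposition.transpose i j) l" for l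
        using fun_cong[OF t(2), of "Transposition.transpose i j l"]
        by (simp add: f_swap I_swap gap_exp_def)
      moreover have "bij_betw (t \<circ> Transposition.transpose i j) I {..<k}"
        using bij t(1) by (rule bij_betw_trans)
      ultimately have "?h \<in> X"
        using g0(2) unfolding X_def top_pairs_def by auto
      \<comment> \<open>The target exponents at i and j differ while those of f agree; hence the
        involution has no fixed point.\<close>
      moreover have "g i \<noteq> g j"
        using inj_onD[OF gap_exp_inj_on[OF t(1)] _ ij(1,2)] ij(3) \<open>f i = f j\<close> fun_cong[OF t(2)] by metis
      then have "?h \<noteq> g" by (metis comp_apply transpose_apply_first)
      ultimately show "?h \<in> X \<and> ?h \<circ> Transposition.transpose i j = g \<and> ?h \<noteq> g"
        by (auto simp: o_assoc[symmetric])
    qed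
  qed simp
  then have "Psi k (red_P a (bmon I f)) = 0"
    by (simp only: red_P_bmon Psi_sum Psi_bmon sum_of_bool_bit[OF finite_bit_summands] flip: X_def) simp
  then show ?case by (simp add: red_P_add Psi_add add)
qed

text \<open>If raising y_i yields a top monomial, then f i = 2^k - 2, which is also the exponent at
  the index c whose gap is at level 0. Raising c instead gives the top monomial with i and c
  exchanged, and no third index works.\<close>

lemma Psi_red_Q:
  assumes "k \<ge> 1"
  shows "Psi k (red_Q u) = 0"
proof (induction u rule: rmot_induct)
  case zero
  then show ?case by (simp add: red_Q_0 Psi_0)
next
  case (add I f u)
  define X where "X = {i \<in> I. (I - {i}, f(i := Suc (f i))) \<in> top_pairs k}"
  have "even (card X)"
  proof (cases "X = {}")
    case False
    then obtain i t where i: "i \<in> I" "card (I - {i}) = k" "bij_betw t (I - {i}) {..<k}"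
      "f(i := Suc (f i)) = gap_exp k (I - {i}) t"
      by (auto simp: X_def top_pairs_def)
    \<comment> \<open>Level 0 exists because k >= 1; c is the index whose exponent lacks the lowest
      digit.\<close>
    have "0 \<in> t ` (I - {i})" using i(3) assms by (simp add: bij_betw_def)
    then obtain c where c: "c \<in> I - {i}" "t c = 0" by (metis imageE)
    have f: "f l = (if l \<in> I then (if l = i then 2 ^ k - 2 else 2 ^ k - 1 - 2 ^ t l) else 2 ^ k - 1)" for l
    proof (cases "l = i")
      case True
      then have "Suc (f l) = 2 ^ k - 1" using fun_cong[OF i(4), of l] by (simp add: gap_exp_def)
      then show ?thesis using True i(1) by simp
    next
      case False
      then have "f l = gap_exp k (I - {i}) t l" using fun_cong[OF i(4), of l] by simp
      then show ?thesis using False by (simp add: gap_exp_def)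
    qed
    let ?t = "t \<circ> Transposition.transpose i c"
    have bij: "bij_betw ?t (I - {c}) {..<k}"
    proof (rule bij_betw_trans[OF _ i(3)])
      show "bij_betw (Transposition.transpose i c) (I - {c}) (I - {i})"
        using i(1) c(1) by (intro bij_betw_byWitness[where f' = "Transposition.transpose i c"])
          (auto simp: Transposition.transpose_def)
    qed
    have k2: "(2::nat) ^ k \<ge> 2" using assms by (cases k) auto
    have "f(c := Suc (f c)) = gap_exp k (I - {c}) ?t"
      using c i(1) k2 by (auto simp: fun_eq_iff f gap_exp_def Transposition.transpose_def)
    moreover have "card (I - {c}) = k" using i(1,2) c(1) by simp
    ultimately have "c \<in> X" using bij c by (auto simp: X_def top_pairs_def)
    moreover have "i \<in> X" using i by (auto simp: X_def top_pairs_def)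
    \<comment> \<open>At any other l in I the gap has size at least 2, so adding 1 to the exponent
      cannot fill it.\<close>
    moreover have "l = i \<or> l = c" if "l \<in> X" for l
    proof (rule ccontr)
      assume l: "\<not> (l = i \<or> l = c)"
      from that have "l \<in> I" and "\<exists>t'. f(l := Suc (f l)) = gap_exp k (I - {l}) t'"
        by (auto simp: X_def top_pairs_def)
      then obtain t' where "f(l := Suc (f l)) = gap_exp k (I - {l}) t'" by blast
      from fun_cong[OF this, of l] have "Suc (f l) = 2 ^ k - 1" by (simp add: gap_exp_def)
      moreover have "t l \<noteq> t c" "t l < k" using l \<open>l \<in> I\<close> c(1) i(3) by (auto simp: bij_betw_def inj_on_def)
      then have "(2::nat) ^ t l \<ge> 2" using c(2) by (cases "t l") auto
      moreover have "f l = 2 ^ k - 1 - 2 ^ t l" using l \<open>l \<in> I\<close> by (simp add: f)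
      ultimately show False using power_2_le_pred[OF \<open>t l < k\<close>] by linarith
    qed
    ultimately have "X = {i, c}" by auto
    then show ?thesis using c(1) by auto
  qed simp
  then have "Psi k (red_Q (bmon I f)) = 0"
    by (simp only: red_Q_bmon Psi_sum Psi_bmon sum_of_bool_bit[OF finite] flip: X_def) simp
  then show ?case by (simp add: red_Q_add Psi_add add)
qed

section \<open>Values of positive-degree operations\<close>

text \<open>All generators have positive degree, so an operation of degree 0 is one of the scalars 0
  and 1. In a composite of positive degree the outer factor is either of positive degree or such a
  scalar, so a property of all values of the generators that is closed under sums carries
  over.\<close>

lemma homog_op_value:
  fixes R :: "'a::comm_ring_1 \<Rightarrow> bool"
  assumes two: "(2 :: 'a) = 0"
    and R0: "R 0" and R_add: "\<And>u v. R u \<Longrightarrow> R v \<Longrightarrow> R (u + v)"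
    and gens: "\<And>r s f u. (r, s, f) \<in> gens \<Longrightarrow> r + s > 0 \<and> R (f u)"
    and "homog_op gens r s f"
  shows "if r + s > 0 then \<forall>u. R (f u) else \<exists>c. \<forall>u. f u = f2_scale c u"
  using assms(5)
proof (induction rule: homog_op.induct)
  case (gen r s f)
  then show ?case using gens by force
next
  case unit
  show ?case by (auto simp: f2_scale_def intro!: exI[of _ 1])
next
  case (zero r s)
  show ?case by (auto simp: f2_scale_def R0 intro!: exI[of _ 0])
next
  case (add r s f g)
  show ?case
  proof (cases "r + s > 0")
    case False
    with add.IH obtain c d where "f u = f2_scale c u" "g u = f2_scale d u" for u by auto
    then have "f u + g u = f2_scale (c + d) u" for u by (simp only: f2_scale_add_left[OF two])
    with False show ?thesis by (simp del: add_bit_eq_xor) blast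
  qed (use add.IH R_add in auto)
next
  case (comp r s f r' s' g)
  consider "r + s > 0" | "r + s = 0" "r' + s' > 0" | "r + s = 0" "r' + s' = 0" by blast
  then show ?case
  proof cases
    case 2
    with comp.IH obtain c where "f u = f2_scale c u" "R (g u)" for u by auto
    then show ?thesis using 2 R0 by (auto simp: f2_scale_def)
  next
    case 3
    with comp.IH obtain c d where "f u = f2_scale c u" "g u = f2_scale d u" for u by auto
    then have "f (g u) = f2_scale (c * d) u" for u by (simp add: f2_scale_def)
    with 3 show ?thesis by auto
  qed (use comp.IH in auto)
qed

text \<open>Reduces an additive property of all hits to the values of the generators, at arbitrary
  arguments.\<close>

lemma positive_values_induct [consumes 1, case_names two zero add gen]:
  fixes R :: "'a::comm_ring_1 \<Rightarrow> bool"
  assumes "u \<in> positive_values gens C" "(2 :: 'a) = 0"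
    and "R 0" "\<And>u v. R u \<Longrightarrow> R v \<Longrightarrow> R (u + v)"
    and "\<And>r s f u. (r, s, f) \<in> gens \<Longrightarrow> r + s > 0 \<and> R (f u)"
  shows "R u"
proof -
  interpret vs: vector_space "f2_scale :: bit \<Rightarrow> 'a \<Rightarrow> 'a"
    using assms(2) by (rule vector_space_f2_scale)
  from assms(1) show ?thesis unfolding positive_values_def
  proof (induction rule: vs.span_induct_alt)
    case (step c v w)
    then obtain f r s u where v: "v = f u" "homog_op gens r s f" "r + s > 0" by blast
    have "if r + s > 0 then \<forall>u. R (f u) else \<exists>c. \<forall>u. f u = f2_scale c u"
      using assms(2-5) v(2) by (rule homog_op_value)
    then have "R v" using v(3) by (simp add: v(1))
    then show ?case using step.IH assms(3,4) by (simp add: f2_scale_def)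
  qed (rule assms(3))
qed

section \<open>Uniqueness of the operations\<close>

text \<open>Meant for r a = P^a(1): by induction, the Cartan formula for 1 = 1 1 leaves only the two
  equal end terms, which cancel.\<close>

lemma unit_cartan:
  fixes r :: "nat \<Rightarrow> 'n rmot"
  assumes "r 0 = 1" "\<And>a. r a = (\<Sum>b\<le>a. r b * r (a - b))" "a \<ge> 1"
  shows "r a = 0"
  using assms(3)
proof (induction a rule: less_induct)
  case (less a)
  have "r a = (\<Sum>b\<in>{0, a}. r b * r (a - b))"
    unfolding assms(2)[of a] using less by (intro sum.mono_neutral_right) auto
  then show ?case using less.prems by (simp add: assms(1) rmot_double)
qed

lemma Yn_mult: "u \<in> Yn \<Longrightarrow> v \<in> Yn \<Longrightarrow> u * v \<in> Yn"
  unfolding Yn_def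
proof (rule F2_span_mult_closed)
  show "s * t \<in> F2_span (range ymon)" if "s \<in> range ymon" "t \<in> range ymon" for s t :: "'n::finite rmot"
    using that by (auto simp flip: ymon_add intro: rmot.span_base)
qed

lemma ymon_in_Yn: "ymon e \<in> Yn"
  unfolding Yn_def by (rule rmot.span_base) simp

lemma one_in_Yn: "1 \<in> Yn"
  using ymon_in_Yn[of "\<lambda>_. 0"] by (simp add: ymon_def)

lemma ny_in_Yn: "ny i \<in> Yn"
  using ymon_in_Yn[of "\<lambda>j. of_bool (j = i)"] by (simp add: ny_eq_bmon)

text \<open>The Cartan formula determines p on monomials in the y_i, and linearity over the exterior
  part extends this to all basis monomials. Later arguments can then work with the concrete
  \<open>red_P\<close>.\<close>

lemma (in reduced_action) p_eq_red_P: "p a u = red_P a u"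
proof -
  have p_zero: "p a 0 = 0" for a using p_add[of a 0 0] by simp
  have mult: "\<forall>a. p a (u * v) = red_P a (u * v)"
    if "u \<in> Yn" "v \<in> Yn" "\<forall>a. p a u = red_P a u" "\<forall>a. p a v = red_P a v" for u v
    using that by (simp add: p_mult red_P_mult sum_pairs)
  have one: "p a 1 = red_P a 1" for a
  proof (cases "a = 0")
    case False
    have "p a 1 = 0"
    proof (rule unit_cartan)
      show "p a 1 = (\<Sum>b\<le>a. p b 1 * p (a - b) 1)" for a
        using p_mult[OF one_in_Yn one_in_Yn, of a] unfolding sum_pairs mult_1_left .
    qed (use False p_0 in auto)
    with False show ?thesis by (simp add: red_P_gens)
  qed (simp add: p_0 red_P_0)
  have ny: "p a (ny i) = red_P a (ny i)" for a i
  proof -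
    consider "a = 0" | "a = 1" | "a \<ge> 2" by linarith
    then show ?thesis
      by cases (simp_all only: p_0 red_P_0 p1_y p_y red_P_gens(3,4))
  qed
  have pow: "ny i ^ m \<in> Yn \<and> (\<forall>a. p a (ny i ^ m) = red_P a (ny i ^ m))" for i m
    by (induction m) (auto simp: one one_in_Yn ny ny_in_Yn Yn_mult intro!: mult[rule_format])
  have "(\<Prod>i\<in>A. ny i ^ e i) \<in> Yn \<and> (\<forall>a. p a (\<Prod>i\<in>A. ny i ^ e i) = red_P a (\<Prod>i\<in>A. ny i ^ e i))" for A e
    by (induction A rule: infinite_finite_induct)
      (auto simp: one one_in_Yn pow Yn_mult intro!: mult[rule_format])
  then have "p a (ymon e) = red_P a (ymon e)" for a e by (simp add: ymon_def)
  moreover have "prod nx I \<in> Lambda" for I :: "'n set"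
    unfolding Lambda_def by (rule rmot.span_base) auto
  ultimately have "p a (bmon I e) = red_P a (bmon I e)" for a I e
    by (simp add: p_Lambda ymon_in_Yn red_P_prod_nx)
  then show ?thesis
    by (induction u rule: rmot_induct) (simp_all add: p_zero red_P_gens p_add red_P_add)
qed

lemma (in reduced_action) q_eq_red_Q: "q u = red_Q u"
proof -
  have one: "q 1 = red_Q 1" using q_mult[of 1 1] by (simp add: rmot_double red_Q_1)
  have mult: "q (u * v) = red_Q (u * v)" if "q u = red_Q u" "q v = red_Q v" for u v
    using that by (simp add: q_mult red_Q_mult)
  have pow: "q (ny i ^ m) = red_Q (ny i ^ m)" for i m
    by (induction m) (auto simp: one q_y red_Q_gens intro!: mult)
  have "q (prod nx A) = red_Q (prod nx A)" "q (\<Prod>i\<in>A. ny i ^ e i) = red_Q (\<Prod>i\<in>A. ny i ^ e i)" for A e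
    by (induction A rule: infinite_finite_induct) (auto simp: one q_x red_Q_gens pow intro!: mult)
  then have "q (bmon I e) = red_Q (bmon I e)" for I e
    unfolding ymon_def by (rule mult)
  moreover have "q 0 = 0" using q_add[of 0 0] by simp
  ultimately show ?thesis
    by (induction u rule: rmot_induct) (simp_all add: red_Q_0 q_add red_Q_add)
qed

section \<open>Compatibility of the operations with reduction mod \<tau>\<close>

lemma (in motivic_action) abs_rmot_Q: "abs_rmot (Q u) = red_Q (abs_rmot u)"
proof (induction u rule: mot_induct)
  case one
  have "Q 1 = 0" using Q_mult[of 1 1] by (simp add: mot_double)
  then show ?case by (simp add: abs_rmot_simps red_Q_1)
qed (simp_all add: Q_tau Q_x Q_y Q_add Q_mult abs_rmot_simps red_Q_0 red_Q_gens red_Q_add red_Q_mult)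

text \<open>The correction term of the motivic Cartan formula is a multiple of \<tau>, so after
  reduction P satisfies the same product rule as \<open>red_P\<close>; both agree on ring
  generators.\<close>

lemma (in motivic_action) abs_rmot_P: "abs_rmot (P a u) = red_P a (abs_rmot u)"
proof (induction u arbitrary: a rule: mot_induct)
  have cartan: "abs_rmot (P a (u * v)) = (\<Sum>b\<le>a. abs_rmot (P b u) * abs_rmot (P (a - b) v))" for a u v
    by (simp add: P_mult abs_rmot_simps sum_pairs abs_rmot_sum)
  {
    case one
    show ?case
    proof (cases "a = 0")
      case False
      have "abs_rmot (P a 1) = 0"
      proof (rule unit_cartan)
        show "abs_rmot (P a 1) = (\<Sum>b\<le>a. abs_rmot (P b 1) * abs_rmot (P (a - b) 1))" for a
          using cartan[of a 1 1] unfolding mult_1_left .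
      qed (use False P_0 abs_rmot_simps(2) in auto)
      with False show ?thesis by (simp add: abs_rmot_simps red_P_gens)
    qed (simp add: P_0 red_P_0)
  next
    case tau
    show ?case by (cases "a = 0") (simp_all add: P_0 P_tau abs_rmot_simps red_P_gens)
  next
    case (x i)
    show ?case by (cases "a = 0") (simp_all add: P_0 red_P_0 P_x abs_rmot_simps red_P_gens)
  next
    case (y i)
    consider "a = 0" | "a = 1" | "a \<ge> 2" by linarith
    then show ?case
      by cases (simp_all only: P_0 red_P_0 P1_y P_y red_P_gens(3,4) abs_rmot_simps abs_rmot_power)
  next
    case (add u v)
    then show ?case by (simp add: P_add abs_rmot_simps red_P_add)
  next
    case (mult u v)
    then show ?case by (simp add: cartan abs_rmot_simps red_P_mult)
  }
qed

lemma Psi_A_plus_N: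
  assumes "k \<ge> 1" "u \<in> A_plus_N red_Q red_P"
  shows "Psi k u = 0"
  using assms(2) unfolding A_plus_N_def
proof (induction rule: positive_values_induct)
  case (gen r s f u)
  then show ?case using assms(1) by (auto simp: powers_def Psi_red_P Psi_red_Q)
qed (simp_all add: rmot_two Psi_0 Psi_add)

text \<open>After reduction the generator \<tau> has value 0, and Q and P become the operations on
  N(n) for which the vanishing is known.\<close>

lemma Psi_A_plus_M:
  fixes u :: "'n::finite mot"
  assumes "motivic_action Q P" "k \<ge> 1" "u \<in> A_plus_M Q P"
  shows "Psi k (abs_rmot u) = 0"
proof -
  interpret motivic_action Q P by (rule assms(1))
  show ?thesis using assms(3) unfolding A_plus_M_def
  proof (induction rule: positive_values_induct)
    case (gen r s f u)
    then show ?case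
      using assms(2) by (auto simp: powers_def Psi_red_P Psi_red_Q Psi_0 abs_rmot_Q abs_rmot_P abs_rmot_simps)
  qed (simp_all add: mot_two Psi_0 Psi_add abs_rmot_simps)
qed

section \<open>Binary digits and the local relations\<close>

text \<open>The doubling of exponents in \<open>omega\<close> shifts the digits by one: index l + 1
  refers to digit l of e.\<close>

lemma omega_Suc: "omega (Suc l) e = (\<Sum>i\<in>UNIV. e i div 2 ^ l mod 2)"
  by (simp add: omega_def div_mult2_eq)

text \<open>The first k weights equal (n - 1, ..., n - 1), the bound in the lexicographic condition
  of \<open>Gn\<close>.\<close>

definition level_full :: "nat \<Rightarrow> ('n::finite \<Rightarrow> nat) \<Rightarrow> bool"
  where "level_full k e \<longleftrightarrow> (\<forall>l<k. (\<Sum>i\<in>UNIV. e i div 2 ^ l mod 2) = CARD('n) - 1)"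

lemma sum_indicator_compl: "(\<Sum>i\<in>UNIV. if i \<in> A then 0 else 1) = CARD('n) - card A"
  for A :: "'n::finite set"
  by (simp add: sum.If_cases Compl_eq_Diff_UNIV card_Diff_subset)

text \<open>Two zero digits on one level bound its digit sum by n - 2.\<close>

lemma level_full_two_zeros:
  fixes e :: "'n::finite \<Rightarrow> nat"
  assumes "level_full k e" "l < k" "b \<noteq> c" "even (e b div 2 ^ l)" "even (e c div 2 ^ l)"
  shows False
proof -
  have "(\<Sum>i\<in>UNIV. e i div 2 ^ l mod 2) \<le> (\<Sum>i\<in>UNIV. if i \<in> {b, c} then 0 else 1)"
    using assms(4,5) by (intro sum_mono) auto
  also have "\<dots> = CARD('n) - 2"
    unfolding sum_indicator_compl using assms(3) by simp
  finally have "CARD('n) - 1 \<le> CARD('n) - 2" using assms(1,2) by (simp add: level_full_def)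
  moreover have "CARD('n) \<ge> card {b, c}" by (rule card_mono) auto
  then have "CARD('n) \<ge> 2" using assms(3) by simp
  ultimately show False by linarith
qed

text \<open>
  If the digit sums of all lower levels are \<open>n - 1\<close>, the degree fixes the parity of the next one,
  which therefore is \<open>n - 1\<close> or at most \<open>n - 3\<close>.
\<close>
lemma level_full_or_less:
  fixes e :: "'n::finite \<Rightarrow> nat"
  assumes "sum e UNIV = (CARD('n) - 1) * (2 ^ k - 1)"
  shows "level_full k e \<or> (\<exists>r<k. omega (Suc r) e < CARD('n) - 1 \<and> (\<forall>l<r. omega (Suc l) e = CARD('n) - 1))"
  using assms
proof (induction k arbitrary: e)
  case 0
  then show ?case by (simp add: level_full_def)
next
  case (Suc k)
  let ?n = "CARD('n)" and ?h = "\<lambda>i. e i div 2"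
  have n: "?n \<ge> 1" by (simp add: Suc_leI)
  have split: "sum e UNIV = 2 * sum ?h UNIV + omega (Suc 0) e"
    unfolding omega_Suc sum_distrib_left sum.distrib[symmetric] by (rule sum.cong) simp_all
  have "omega (Suc 0) e \<le> (\<Sum>i\<in>(UNIV :: 'n set). 1)"
    unfolding omega_Suc by (intro sum_mono) (simp add: less_Suc_eq_le[symmetric])
  then have le: "omega (Suc 0) e \<le> ?n" by simp
  have pw: "(2::nat) ^ Suc k - 1 = 2 * (2 ^ k - 1) + 1" using one_le_power[of "2::nat" k] unfolding power_Suc by linarith
  have total: "2 * sum ?h UNIV + omega (Suc 0) e = 2 * ((?n - 1) * (2 ^ k - 1)) + (?n - 1)"
  proof -
    have "a * (2 * m + 1) = 2 * (a * m) + a" for a m :: nat by simp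
    then show ?thesis using Suc.prems unfolding split pw by metis
  qed
  show ?case
  proof (cases "omega (Suc 0) e = ?n - 1")
    case True
    then have "sum ?h UNIV = (?n - 1) * (2 ^ k - 1)" using total by simp
    from Suc.IH[OF this] show ?thesis
    proof
      assume "level_full k ?h"
      then have "(\<Sum>i\<in>UNIV. e i div 2 ^ l mod 2) = ?n - 1" if "l < Suc k" for l
        using that True by (cases l) (simp_all add: level_full_def omega_Suc div_mult2_eq)
      then show ?thesis by (simp add: level_full_def)
    next
      assume "\<exists>r<k. omega (Suc r) ?h < ?n - 1 \<and> (\<forall>l<r. omega (Suc l) ?h = ?n - 1)"
      then obtain r where r: "r < k" "omega (Suc r) ?h < ?n - 1" "\<forall>l<r. omega (Suc l) ?h = ?n - 1" by blast
      have h: "omega (Suc l) ?h = omega (Suc (Suc l)) e" for l by (simp add: omega_Suc div_mult2_eq)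
      have "omega (Suc l) e = ?n - 1" if "l < Suc r" for l
        using that True r(3) h by (cases l) auto
      then show ?thesis using r h by (intro disjI2 exI[of _ "Suc r"]) simp
    qed
  next
    case False
    have "omega (Suc 0) e \<noteq> ?n"
    proof
      assume "omega (Suc 0) e = ?n"
      then have "even (?n + (?n - 1))" using total by presburger
      then show False using n by presburger
    qed
    then show ?thesis using False le by (intro disjI2 exI[of _ 0]) auto
  qed
qed

lemma lex_less_replicate:
  fixes h :: "nat \<Rightarrow> nat"
  assumes "r < k" "h (Suc r) < c" "\<And>l. l < r \<Longrightarrow> h (Suc l) = c"
  shows "(map h [1..<Suc k], replicate k c) \<in> lex less_than"
proof -
  have 1: "map h [1..<Suc k] = map h [1..<Suc r] @ h (Suc r) # map h [Suc (Suc r)..<Suc k]"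
  proof -
    have "[1..<Suc k] = [1..<Suc r] @ Suc r # [Suc (Suc r)..<Suc k]"
      using upt_add_eq_append[of 1 "Suc r" "k - r"] upt_conv_Cons[of "Suc r" "Suc k"] assms(1)
      by (simp del: upt_Suc)
    then show ?thesis by (simp only: map_append list.map)
  qed
  have 2: "replicate k c = map h [1..<Suc r] @ c # replicate (k - Suc r) c"
  proof -
    have "map h [1..<Suc r] = replicate r c"
      by (rule nth_equalityI) (use assms(3) in \<open>auto simp del: upt_Suc\<close>)
    then show ?thesis using assms(1)
      by (simp add: replicate_add[symmetric] flip: replicate_Suc del: upt_Suc replicate.simps)
  qed
  show ?thesis unfolding lex_conv
    by (rule CollectI, unfold case_prod_conv, intro conjI exI, simp, rule 1, rule 2) (use assms(2) in simp)
qed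

lemma level_full_not_less:
  fixes e :: "'n::finite \<Rightarrow> nat"
  assumes "level_full k e"
  shows "(map (\<lambda>j. omega j e) [1..<Suc k], replicate k (CARD('n) - 1)) \<notin> lex less_than"
proof -
  have "map (\<lambda>j. omega j e) [1..<Suc k] = replicate k (CARD('n) - 1)"
    using assms by (intro nth_equalityI) (auto simp: level_full_def omega_Suc simp del: upt_Suc)
  then show ?thesis by (simp add: irrefl_def)
qed

lemma digit_gap_exp:
  assumes "\<And>i. i \<in> J \<Longrightarrow> s i < k" "l < k"
  shows "gap_exp k J s i div 2 ^ l mod 2 = (if i \<in> J \<and> s i = l then 0 else 1)"
  using digit_gap[of l k "s i"] digit_full[of l k] assms by (auto simp: gap_exp_def)

lemma sum_digits_gap_exp:
  fixes J :: "'n::finite set"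
  assumes "\<And>i. i \<in> J \<Longrightarrow> s i < k" "l < k"
  shows "(\<Sum>i\<in>UNIV. gap_exp k J s i div 2 ^ l mod 2) = CARD('n) - card {i \<in> J. s i = l}"
proof -
  have "(\<Sum>i\<in>UNIV. gap_exp k J s i div 2 ^ l mod 2) = (\<Sum>i\<in>UNIV. if i \<in> {i \<in> J. s i = l} then 0 else 1)"
    using assms by (simp add: digit_gap_exp)
  also have "\<dots> = CARD('n) - card {i \<in> J. s i = l}" by (rule sum_indicator_compl)
  finally show ?thesis .
qed

lemma card_bij_fibre: "bij_betw t J {..<k} \<Longrightarrow> l < k \<Longrightarrow> card {i \<in> J. t i = l} = 1"
proof -
  assume t: "bij_betw t J {..<k}" "l < k"
  then obtain b where b: "b \<in> J" "t b = l" unfolding bij_betw_def by (metis imageE lessThan_iff)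
  then have "{i \<in> J. t i = l} = {b}" using t by (auto simp: bij_betw_def inj_on_def)
  then show ?thesis by simp
qed

lemma level_full_gap_exp: "bij_betw t J {..<k} \<Longrightarrow> level_full k (gap_exp k J t)"
  unfolding level_full_def
  by (intro allI impI, subst sum_digits_gap_exp) (auto simp: card_bij_fibre bij_betw_def)

lemma level_full_top_pairs: "(J, e) \<in> top_pairs k \<Longrightarrow> level_full k e"
  by (auto simp: top_pairs_def level_full_gap_exp)

lemma sum_top_pairs:
  fixes e :: "'n::finite \<Rightarrow> nat"
  assumes "(J, e) \<in> top_pairs k"
  shows "sum e UNIV = (CARD('n) - 1) * (2 ^ k - 1)"
proof -
  obtain t where "e = gap_exp k J t" "bij_betw t J {..<k}" using assms by (auto simp: top_pairs_def)
  then show ?thesis using sum_gap_exp[of t J k] by (metis add_diff_cancel_right' diff_mult_distrib mult_1)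
qed

text \<open>In this degree the weight is never lexicographically larger than (n - 1, ..., n - 1): at
  the first level where it differs, it is smaller.\<close>

lemma ymon_in_Gn:
  fixes e :: "'n::finite \<Rightarrow> nat"
  assumes "sum e UNIV = (CARD('n) - 1) * (2 ^ k - 1)" "\<not> level_full k e"
  shows "ymon e \<in> Gn p k"
proof -
  obtain r where "r < k" "omega (Suc r) e < CARD('n) - 1" "\<And>l. l < r \<Longrightarrow> omega (Suc l) e = CARD('n) - 1"
    using level_full_or_less[OF assms(1)] assms(2) by blast
  then have "(map (\<lambda>j. omega j e) [1..<Suc k], replicate k (CARD('n) - 1)) \<in> lex less_than"
    by (rule lex_less_replicate)
  then show ?thesis unfolding Gn_def by (intro rmot.span_base) auto
qed

lemma red_P_in_Gn: "a \<ge> 1 \<Longrightarrow> v \<in> Yn \<Longrightarrow> red_P a v \<in> Gn red_P k"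
  unfolding Gn_def
proof (intro rmot.span_base UnI1)
  assume a: "a \<ge> 1" "v \<in> Yn"
  have "homog_op (powers red_P) (2 * a) a (red_P a)"
    using a by (intro homog_op.gen) (auto simp: powers_def)
  then show "red_P a v \<in> P_plus_Y red_P"
    unfolding P_plus_Y_def positive_values_def using a by (intro rmot.span_base) fastforce
qed

lemma Gn_add: "u \<in> Gn p k \<Longrightarrow> v \<in> Gn p k \<Longrightarrow> u + v \<in> Gn p k"
  unfolding Gn_def by (rule rmot.span_add)

lemma Gn_sum: "(\<And>g. g \<in> A \<Longrightarrow> h g \<in> Gn p k) \<Longrightarrow> sum h A \<in> Gn p k"
  unfolding Gn_def by (rule rmot.span_sum)

section \<open>Exchanging gaps between levels modulo G\<close>

lemma odd_choose_power: "odd (m div 2 ^ j) \<Longrightarrow> odd (m choose 2 ^ j)"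
proof (induction j arbitrary: m)
  case (Suc j)
  obtain m' where "m = 2 * m' \<or> m = Suc (2 * m')" by (metis evenE oddE Suc_eq_plus1)
  then have m': "odd (m' div 2 ^ j)" "m = 2 * m' \<or> m = Suc (2 * m')"
    using Suc.prems by (auto simp: div_mult2_eq)
  from Suc.IH[OF m'(1)] m'(2) show ?case
    by (metis power_Suc even_choose_double(1) odd_choose_double(1))
qed simp

text \<open>
  Two gaps on consecutive levels \<open>j\<close> and \<open>j + 1\<close> are exchanged by \<open>P\<^bsup>2^j\<^esup>\<close>, applied to the
  monomial with a full level \<open>j\<close> and two gaps on level \<open>j + 1\<close>.
\<close>
lemma adjacent_swap:
  fixes J :: "'n::finite set"
  assumes t: "bij_betw t J {..<k}" and j: "Suc j < k"
  shows "ymon (gap_exp k J t) + ymon (gap_exp k J (Transposition.transpose j (Suc j) \<circ> t)) \<in> Gn red_P k"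
proof -
  have tk: "t i < k" if "i \<in> J" for i using t that by (auto simp: bij_betw_def)
  have inj: "i = i'" if "i \<in> J" "i' \<in> J" "t i = t i'" for i i'
    using t that by (auto simp: bij_betw_def inj_on_def)
  have "j \<in> t ` J" "Suc j \<in> t ` J" using t j by (auto simp: bij_betw_def)
  then obtain b c where bc: "b \<in> J" "t b = j" "c \<in> J" "t c = Suc j" by auto
  then have "b \<noteq> c" by auto
  define s where "s = t(b := Suc j)"
  define f where "f = gap_exp k J s"
  have sk: "s i < k" if "i \<in> J" for i using tk[OF that] j by (simp add: s_def)
  have digit: "f i div 2 ^ l mod 2 = (if i \<in> J \<and> s i = l then 0 else 1)" if "l < k" for i l
    unfolding f_def using sk that by (rule digit_gap_exp)
  \<comment> \<open>The two distinguished ways to add the degree 2^j: raising b or c by 2^j moves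
    its gap from level j + 1 down to level j. Raising b gives t, raising c gives t with the two
    levels exchanged.\<close>
  define \<delta> where "\<delta> i = (\<lambda>l. if l = i then 2 ^ j else 0 :: nat)" for i :: 'n
  have pw: "(2::nat) ^ Suc j \<le> 2 ^ k - 1" by (rule power_2_le_pred[OF j])
  have fb: "(\<lambda>i. f i + \<delta> b i) = gap_exp k J t"
    using bc \<open>b \<noteq> c\<close> pw by (auto simp: fun_eq_iff f_def gap_exp_def s_def \<delta>_def)
  have fc: "(\<lambda>i. f i + \<delta> c i) = gap_exp k J (Transposition.transpose j (Suc j) \<circ> t)"
  proof
    fix i
    have "t i \<noteq> j" "t i \<noteq> Suc j" if "i \<in> J" "i \<noteq> b" "i \<noteq> c"
      using inj[OF that(1) bc(1)] inj[OF that(1) bc(3)] bc that by auto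
    then show "f i + \<delta> c i = gap_exp k J (Transposition.transpose j (Suc j) \<circ> t) i"
      using bc \<open>b \<noteq> c\<close> pw
      by (cases "i = b"; cases "i = c") (auto simp: f_def gap_exp_def s_def \<delta>_def)
  qed
  have fbj: "odd (f b div 2 ^ j)" "odd (f c div 2 ^ j)"
    using digit[of j b] digit[of j c] j bc \<open>b \<noteq> c\<close> by (auto simp: s_def odd_iff_mod_2_eq_one)
  then have mem: "\<delta> b \<in> bit_summands f (2 ^ j)" "\<delta> c \<in> bit_summands f (2 ^ j)"
    by (auto simp: bit_summands_def \<delta>_def odd_choose_power)
  have "\<delta> b b \<noteq> \<delta> c b" using \<open>b \<noteq> c\<close> by (simp add: \<delta>_def)
  then have ne: "\<delta> b \<noteq> \<delta> c" by auto
  have total: "sum f UNIV + 2 ^ j = (CARD('n) - 1) * (2 ^ k - 1)"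
  proof -
    have "sum f UNIV + 2 ^ j = (\<Sum>i\<in>UNIV. f i + \<delta> b i)" by (simp add: sum.distrib \<delta>_def)
    also have "\<dots> = (CARD('n) - 1) * (2 ^ k - 1)"
      unfolding fb using sum_gap_exp[OF t] by (metis add_diff_cancel_right' diff_mult_distrib mult_1)
    finally show ?thesis .
  qed
  have low: "ymon (\<lambda>i. f i + g i) \<in> Gn red_P k"
    if g: "g \<in> bit_summands f (2 ^ j) - {\<delta> b, \<delta> c}" for g
  proof (rule ymon_in_Gn)
    have g1: "sum g UNIV = 2 ^ j" "\<And>i. odd (f i choose g i)" using g by (auto simp: bit_summands_def)
    then show "(\<Sum>i\<in>UNIV. f i + g i) = (CARD('n) - 1) * (2 ^ k - 1)"
      using total by (simp add: sum.distrib)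
    show "\<not> level_full k (\<lambda>i. f i + g i)"
    proof
      assume full: "level_full k (\<lambda>i. f i + g i)"
      \<comment> \<open>Below level j the monomial f is already full. Each digit of g on such a
        level clears a digit of f, so for a full result g has none there and is divisible by
        2^j.\<close>
      have dvd: "\<forall>i. 2 ^ l dvd g i" if "l \<le> j" for l
        using that
      proof (induction l)
        case (Suc l)
        then have IH: "2 ^ l dvd g i" for i by simp
        have l: "l < k" "l \<noteq> Suc j" "l < j" using Suc.prems j by auto
        have "f i div 2 ^ l mod 2 = (f i + g i) div 2 ^ l mod 2 + g i div 2 ^ l mod 2" for i
        proof -
          have "(f i + g i) div 2 ^ l = f i div 2 ^ l + g i div 2 ^ l"
            using IH[of i] by (rule div_plus_div_distrib_dvd_right)
          moreover have "g i div 2 ^ l mod 2 \<le> f i div 2 ^ l mod 2" by (rule odd_choose_digit[OF g1(2)])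
          moreover have "x mod 2 = (x + y) mod 2 + y mod 2" if "y mod 2 \<le> x mod 2" for x y :: nat
            using that by (cases "even x"; cases "even y") (simp_all add: mod_2_eq_odd)
          ultimately show ?thesis by simp
        qed
        then have "(\<Sum>i\<in>UNIV. f i div 2 ^ l mod 2)
            = (\<Sum>i\<in>UNIV. (f i + g i) div 2 ^ l mod 2) + (\<Sum>i\<in>UNIV. g i div 2 ^ l mod 2)"
          by (simp add: sum.distrib)
        moreover have "(\<Sum>i\<in>UNIV. (f i + g i) div 2 ^ l mod 2) = CARD('n) - 1"
          using full l by (simp add: level_full_def)
        moreover have "(\<Sum>i\<in>UNIV. f i div 2 ^ l mod 2) = CARD('n) - 1"
        proof -
          have "{i \<in> J. s i = l} = {i \<in> J. t i = l}" using l bc by (auto simp: s_def)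
          then show ?thesis
            unfolding f_def using sum_digits_gap_exp[of J s k l] sk l card_bij_fibre[OF t l(1)] by simp
        qed
        ultimately have "(\<Sum>i\<in>UNIV. g i div 2 ^ l mod 2) = 0" by linarith
        then have z: "g i div 2 ^ l mod 2 = 0" for i by (simp add: sum_eq_0_iff)
        show ?case
        proof
          fix i
          obtain m where m: "g i = 2 ^ l * m" using IH by (auto elim: dvdE)
          then have "even m" using z[of i] by auto
          then show "2 ^ Suc l dvd g i" by (auto simp: m elim!: evenE)
        qed
      qed simp
      have "\<exists>i. g i \<noteq> 0" using g1(1) by (metis power_not_zero sum.neutral zero_neq_numeral)
      then obtain i where i: "g i \<noteq> 0" by blast
      then have "g i \<ge> 2 ^ j" using dvd[of j] by (simp add: dvd_imp_le)
      moreover have "sum g UNIV = g i + sum g (UNIV - {i})" by (simp add: sum.remove)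
      ultimately have "g i = 2 ^ j" "sum g (UNIV - {i}) = 0" using g1(1) by auto
      then have gi: "g = \<delta> i" by (auto simp: fun_eq_iff \<delta>_def sum_eq_0_iff)
      \<comment> \<open>With total degree 2^j, divisibility concentrates g at one index. If that is
        neither b nor c, both gaps of f on level j + 1 remain, which contradicts fullness.\<close>
      then have "i \<noteq> b" "i \<noteq> c" using g by auto
      then have "g b = 0" "g c = 0" by (simp_all add: gi \<delta>_def)
      then have "even ((f b + g b) div 2 ^ Suc j)" "even ((f c + g c) div 2 ^ Suc j)"
        using digit[OF j, of b] digit[OF j, of c] bc \<open>b \<noteq> c\<close>
        by (auto simp: s_def even_iff_mod_2_eq_zero simp del: power_Suc)
      with full j \<open>b \<noteq> c\<close> show False by (rule level_full_two_zeros)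
    qed
  qed
  have "red_P (2 ^ j) (ymon f) = (\<Sum>g\<in>{\<delta> b, \<delta> c}. ymon (\<lambda>i. f i + g i))
      + (\<Sum>g\<in>bit_summands f (2 ^ j) - {\<delta> b, \<delta> c}. ymon (\<lambda>i. f i + g i))"
    unfolding red_P_ymon using mem
    by (subst sum.subset_diff[of "{\<delta> b, \<delta> c}"]) (auto simp: finite_bit_summands add.commute)
  then have "red_P (2 ^ j) (ymon f) + (\<Sum>g\<in>bit_summands f (2 ^ j) - {\<delta> b, \<delta> c}. ymon (\<lambda>i. f i + g i))
      = ymon (gap_exp k J t) + ymon (gap_exp k J (Transposition.transpose j (Suc j) \<circ> t))"
    using ne by (simp add: add.assoc rmot_double flip: fb fc)
  moreover have "red_P (2 ^ j) (ymon f) + (\<Sum>g\<in>bit_summands f (2 ^ j) - {\<delta> b, \<delta> c}. ymon (\<lambda>i. f i + g i))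
      \<in> Gn red_P k"
    using low by (intro Gn_add Gn_sum red_P_in_Gn) (auto simp: ymon_in_Yn)
  ultimately show ?thesis by simp
qed

text \<open>Transitivity of congruence modulo G, with differences written as sums.\<close>

lemma Gn_chain:
  assumes "u + v \<in> Gn p k" "v + w \<in> Gn p k"
  shows "u + w \<in> Gn p k"
proof -
  have "(u + v) + (v + w) = u + w" by (simp add: add.assoc rmot_add_self_left)
  with Gn_add[OF assms] show ?thesis by simp
qed

lemma bij_betw_transpose_lessThan:
  "a < k \<Longrightarrow> b < k \<Longrightarrow> bij_betw t J {..<k} \<Longrightarrow> bij_betw (Transposition.transpose a b \<circ> t) J {..<k :: nat}"
  by (rule bij_betw_trans, assumption, rule bij_betw_byWitness[where f' = "Transposition.transpose a b"])
    (auto simp: Transposition.transpose_def)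

text \<open>Conjugation: the transposition of j and l + 1 is (j l) followed by (l l+1) followed by
  (j l), so distant levels reduce to neighbouring ones.\<close>

lemma level_swap:
  fixes J :: "'n::finite set"
  assumes "bij_betw t J {..<k}" "j < l" "l < k"
  shows "ymon (gap_exp k J t) + ymon (gap_exp k J (Transposition.transpose j l \<circ> t)) \<in> Gn red_P k"
  using assms
proof (induction l arbitrary: t)
  case (Suc l)
  show ?case
  proof (cases "l = j")
    case True
    with Suc.prems show ?thesis using adjacent_swap by blast
  next
    case False
    with Suc.prems have l: "j < l" "l < k" by auto
    let ?t1 = "Transposition.transpose j l \<circ> t"
    let ?t2 = "Transposition.transpose l (Suc l) \<circ> ?t1"
    have t1: "bij_betw ?t1 J {..<k}" and t2: "bij_betw ?t2 J {..<k}"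
      using Suc.prems l by (auto intro!: bij_betw_transpose_lessThan simp: o_assoc[symmetric])
    have "Transposition.transpose j l \<circ> ?t2 = Transposition.transpose j (Suc l) \<circ> t"
      using l by (auto simp: fun_eq_iff Transposition.transpose_def)
    with Suc.IH[OF Suc.prems(1) l] adjacent_swap[OF t1 Suc.prems(3)] Suc.IH[OF t2 l] show ?thesis
      by (metis Gn_chain)
  qed
qed simp

lemma gap_exp_cong: "(\<And>i. i \<in> J \<Longrightarrow> s i = t i) \<Longrightarrow> gap_exp k J s = gap_exp k J t"
  by (auto simp: gap_exp_def fun_eq_iff)

text \<open>Two bijections from J to the levels differ by a permutation of the levels, which is a
  product of transpositions.\<close>

lemma top_pairs_congruent:
  fixes J :: "'n::finite set"
  assumes "(J, e) \<in> top_pairs k" "(J, e') \<in> top_pairs k"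
  shows "ymon e + ymon e' \<in> Gn red_P k"
proof -
  obtain t t' where t: "e = gap_exp k J t" "bij_betw t J {..<k}" "e' = gap_exp k J t'" "bij_betw t' J {..<k}"
    using assms by (auto simp: top_pairs_def)
  \<comment> \<open>The change of levels from t to t', extended by the identity above k so that it
    is a permutation in the sense of \<open>permutes\<close>.\<close>
  define h where "h l = (if l < k then t' (inv_into J t l) else l)" for l
  have "bij_betw (t' \<circ> inv_into J t) {..<k} {..<k}"
    by (rule bij_betw_trans[OF bij_betw_inv_into[OF t(2)] t(4)])
  then have "bij_betw h {..<k} {..<k}"
    by (rule bij_betw_cong[THEN iffD1, rotated]) (simp add: h_def)
  then have "h permutes {..<k}"
    by (rule bij_imp_permutes) (simp add: h_def)
  have "ymon (gap_exp k J t) + ymon (gap_exp k J (h \<circ> t)) \<in> Gn red_P k"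
    if "h permutes {..<k}" for h
    using that finite_lessThan
  proof (induction h rule: permutes_induct)
    case id
    have "0 \<in> Gn red_P k" unfolding Gn_def by (rule rmot.span_zero)
    then show ?case by (simp add: rmot_double)
  next
    case (swap a b h)
    have "bij_betw (h \<circ> t) J {..<k}"
      using t(2) permutes_imp_bij[OF swap.hyps(4)] by (rule bij_betw_trans)
    with swap have "ymon (gap_exp k J (h \<circ> t)) + ymon (gap_exp k J (Transposition.transpose a b \<circ> (h \<circ> t))) \<in> Gn red_P k"
      using level_swap[of "h \<circ> t" J k a b] level_swap[of "h \<circ> t" J k b a]
      by (cases "a < b") (auto simp: transpose_commute)
    with swap.IH show ?case by (metis Gn_chain o_assoc)
  qed
  from this[OF \<open>h permutes {..<k}\<close>] have "ymon e + ymon (gap_exp k J (h \<circ> t)) \<in> Gn red_P k" by (simp add: t)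
  moreover have "gap_exp k J (h \<circ> t) = e'"
    unfolding t(3) using t(2) by (intro gap_exp_cong) (auto simp: h_def bij_betw_def)
  ultimately show ?thesis by simp
qed

section \<open>The classes \<open>\<sigma>(z\<^sub>k)\<close>\<close>

text \<open>The exponent 2^k - 2^(k-j) - 1 of y at \<sigma>(j) lacks digit k - j;
  \<open>inv_into\<close> recovers j from the index i = \<sigma>(j).\<close>

definition mono_gap :: "nat \<Rightarrow> (nat \<Rightarrow> 'n) \<Rightarrow> 'n \<Rightarrow> nat"
  where "mono_gap k \<sigma> i = k - inv_into {1..k} \<sigma> i"

lemma Mono_maps_inj: "\<sigma> \<in> Mono_maps k \<Longrightarrow> inj_on \<sigma> {1..k}"
  by (auto simp: Mono_maps_def intro: strict_mono_on_imp_inj_on)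

lemma bij_betw_mono_gap:
  assumes "\<sigma> \<in> Mono_maps k"
  shows "bij_betw (mono_gap k \<sigma>) (\<sigma> ` {1..k}) {..<k}"
proof -
  have "bij_betw (inv_into {1..k} \<sigma>) (\<sigma> ` {1..k}) {1..k}"
    using Mono_maps_inj[OF assms] by (intro bij_betw_inv_into inj_on_imp_bij_betw)
  moreover have "bij_betw (\<lambda>j. k - j) {1..k} {..<k}"
    by (rule bij_betw_byWitness[where f' = "\<lambda>j. k - j"]) auto
  ultimately have "bij_betw ((\<lambda>j. k - j) \<circ> inv_into {1..k} \<sigma>) (\<sigma> ` {1..k}) {..<k}"
    by (rule bij_betw_trans)
  then show ?thesis by (simp add: mono_gap_def[abs_def] o_def)
qed

text \<open>Stated for arbitrary families x and y so that it applies in both M(n) and N(n).\<close>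

lemma sigma_z_eq:
  fixes \<sigma> :: "nat \<Rightarrow> 'n::{finite,linorder}"
  assumes "\<sigma> \<in> Mono_maps k"
  shows "sigma_z x y k \<sigma> = prod x (\<sigma> ` {1..k}) * (\<Prod>i\<in>UNIV. y i ^ gap_exp k (\<sigma> ` {1..k}) (mono_gap k \<sigma>) i)"
proof -
  let ?J = "\<sigma> ` {1..k}"
  have inj: "inj_on \<sigma> {1..k}" by (rule Mono_maps_inj[OF assms])
  have "y i ^ gap_exp k ?J (mono_gap k \<sigma>) i
      = (if i \<in> ?J then y i ^ (2 ^ k - 1 - 2 ^ mono_gap k \<sigma> i) else y i ^ (2 ^ k - 1))" for i
    by (simp add: gap_exp_def)
  then have "(\<Prod>i\<in>UNIV. y i ^ gap_exp k ?J (mono_gap k \<sigma>) i)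
      = (\<Prod>i\<in>?J. y i ^ (2 ^ k - 1 - 2 ^ mono_gap k \<sigma> i)) * (\<Prod>i\<in>- ?J. y i ^ (2 ^ k - 1))"
    by (simp only: prod.If_cases finite Collect_mem_eq Int_UNIV_left)
  also have "(\<Prod>i\<in>?J. y i ^ (2 ^ k - 1 - 2 ^ mono_gap k \<sigma> i)) = (\<Prod>j=1..k. y (\<sigma> j) ^ (2 ^ k - 2 ^ (k - j) - 1))"
    unfolding prod.reindex[OF inj] using inj by (intro prod.cong) (auto simp: mono_gap_def)
  finally show ?thesis
    unfolding sigma_z_def prod.reindex[OF inj] o_def by (simp only: mult.assoc)
qed

lemma sigma_z_top:
  fixes \<sigma> :: "nat \<Rightarrow> 'n::{finite,linorder}"
  assumes "\<sigma> \<in> Mono_maps k"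
  shows "(\<sigma> ` {1..k}, gap_exp k (\<sigma> ` {1..k}) (mono_gap k \<sigma>)) \<in> top_pairs k"
  using bij_betw_mono_gap[OF assms] card_image[OF Mono_maps_inj[OF assms]] by (auto simp: top_pairs_def)

lemma sigma_z_bmon:
  fixes \<sigma> :: "nat \<Rightarrow> 'n::{finite,linorder}"
  assumes "\<sigma> \<in> Mono_maps k"
  obtains e where "sigma_z nx ny k \<sigma> = bmon (\<sigma> ` {1..k}) e" "(\<sigma> ` {1..k}, e) \<in> top_pairs k"
  using that sigma_z_eq[OF assms, of nx ny] sigma_z_top[OF assms] by (simp add: ymon_def)

lemma Psi_sigma_z: "\<sigma> \<in> Mono_maps k \<Longrightarrow> Psi k (sigma_z nx ny k \<sigma>) = 1"
  by (erule sigma_z_bmon) (simp add: Psi_bmon)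

lemma Mono_maps_exists:
  fixes J :: "'n::{finite,linorder} set"
  assumes "card J = k"
  shows "\<exists>\<sigma>\<in>Mono_maps k. \<sigma> ` {1..k} = J"
proof -
  let ?xs = "sorted_list_of_set J"
  define \<sigma> where "\<sigma> = restrict (\<lambda>j. ?xs ! (j - 1)) {1..k}"
  have len: "length ?xs = k" using assms by simp
  have "?xs ! (i - 1) < ?xs ! (j - 1)" if "i \<in> {1..k}" "j \<in> {1..k}" "i < j" for i j
    using that len by (intro sorted_wrt_nth_less[OF strict_sorted_list_of_set]) auto
  then have "\<sigma> \<in> Mono_maps k" by (auto simp: Mono_maps_def \<sigma>_def intro!: strict_mono_onI)
  moreover have "\<sigma> ` {1..k} = set ?xs"
  proof -
    have "\<sigma> ` {1..k} = (\<lambda>j. ?xs ! (j - 1)) ` Suc ` {..<k}"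
      by (auto simp: \<sigma>_def image_Suc_lessThan)
    also have "\<dots> = set ?xs" unfolding image_image set_conv_nth len by auto
    finally show ?thesis .
  qed
  ultimately show ?thesis by auto
qed

lemma finite_Mono_maps: "finite (Mono_maps k :: (nat \<Rightarrow> 'n::{finite,linorder}) set)"
  by (rule finite_subset[of _ "{1..k} \<rightarrow>\<^sub>E UNIV"]) (auto simp: Mono_maps_def intro: finite_PiE)

section \<open>Gradings and the projection\<close>

lemma prod_of_bool_power: "(\<Prod>i\<in>UNIV. h i ^ of_bool (i \<in> J)) = prod h J" for J :: "'n::finite set"
proof -
  have "h i ^ of_bool (i \<in> J) = (if i \<in> J then h i else 1)" for i by simp
  then show ?thesis by (simp add: prod.If_cases)
qed

lemma bmon_in_span: "R I e \<Longrightarrow> bmon I e \<in> F2_span {bmon I e | I e. R I e}"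
  by (rule rmot.span_base) blast

text \<open>A generator with some x-exponent at least 2 vanishes because x_i^2 = 0, so only
  squarefree exterior factors remain.\<close>

lemma rmot_deg_eq: "rmot_deg d = F2_span {bmon I e | I e. card I + 2 * sum e UNIV = d}"
proof -
  let ?G = "{(\<Prod>i\<in>UNIV. nx i ^ a i) * (\<Prod>i\<in>UNIV. ny i ^ e i) | a e.
    sum a UNIV + 2 * sum e (UNIV :: 'a set) = d}"
  let ?B = "{bmon I e | I e. card I + 2 * sum e (UNIV :: 'a set) = d}"
  have "?G \<subseteq> F2_span ?B"
  proof
    fix u assume "u \<in> ?G"
    then obtain a e where u: "u = (\<Prod>i\<in>UNIV. nx i ^ a i) * ymon e"
      "sum a UNIV + 2 * sum e UNIV = d" by (auto simp: ymon_def)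
    show "u \<in> F2_span ?B"
    proof (cases "\<exists>i. a i \<ge> 2")
      case True
      then obtain i where "a i \<ge> 2" by blast
      then have "nx i ^ a i = nx i ^ (a i - 2) * nx i ^ 2"
        by (metis le_add_diff_inverse2 power_add)
      then have "nx i ^ a i = 0" by (simp add: power2_eq_square nx_square)
      then have "(\<Prod>i\<in>UNIV. nx i ^ a i) = 0" by (auto simp: prod.remove[of UNIV i])
      then show ?thesis by (simp add: u rmot.span_zero)
    next
      case False
      then have "a i \<le> 1" for i by (metis not_less_eq_eq numeral_2_eq_2 One_nat_def)
      then have "a i = of_bool (i \<in> {i. a i = 1})" for i
        using le_Suc_eq[of "a i" 0] by auto
      then have a: "a = (\<lambda>i. of_bool (i \<in> {i. a i = 1}))" by blast
      have "(\<Prod>i\<in>UNIV. nx i ^ a i) = prod nx {i. a i = 1}" "sum a UNIV = card {i. a i = 1}"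
        by (subst a, rule prod_of_bool_power) (subst a, simp)
      then have "u = bmon {i. a i = 1} e" "card {i. a i = 1} + 2 * sum e UNIV = d" using u by simp_all
      then show ?thesis by (simp only: bmon_in_span)
    qed
  qed
  moreover have "?B \<subseteq> ?G"
  proof
    fix u assume "u \<in> ?B"
    then obtain I e where u: "u = bmon I e" "card I + 2 * sum e (UNIV :: 'a set) = d" by blast
    then have "u = (\<Prod>i\<in>UNIV. nx i ^ of_bool (i \<in> I)) * (\<Prod>i\<in>UNIV. ny i ^ e i)"
      "(\<Sum>i\<in>UNIV. of_bool (i \<in> I)) + 2 * sum e UNIV = d"
      by (simp_all add: prod_of_bool_power ymon_def)
    then show "u \<in> ?G"
      by (intro CollectI exI[of _ "\<lambda>i. of_bool (i \<in> I)"] exI[of _ e] conjI)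
  qed
  then have "?B \<subseteq> F2_span ?G" using rmot.span_superset by (rule subset_trans)
  ultimately show ?thesis
    unfolding rmot_deg_def by (intro subset_antisym rmot.span_minimal rmot.subspace_span)
qed

lemma sigma_z_rmot_deg:
  fixes \<sigma> :: "nat \<Rightarrow> 'n::{finite,linorder}"
  assumes "\<sigma> \<in> Mono_maps k"
  shows "sigma_z nx ny k \<sigma> \<in> rmot_deg (k + 2 * ((CARD('n) - 1) * (2 ^ k - 1)))"
  using assms
proof (rule sigma_z_bmon)
  fix e assume e: "sigma_z nx ny k \<sigma> = bmon (\<sigma> ` {1..k}) e" "(\<sigma> ` {1..k}, e) \<in> top_pairs k"
  then have "card (\<sigma> ` {1..k}) = k" "sum e UNIV = (CARD('n) - 1) * (2 ^ k - 1)"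
    using sum_top_pairs by (auto simp: top_pairs_def)
  then show ?thesis unfolding rmot_deg_eq e(1) by (intro bmon_in_span) simp
qed

lemma sigma_z_mot_deg:
  fixes \<sigma> :: "nat \<Rightarrow> 'n::{finite,linorder}"
  assumes "\<sigma> \<in> Mono_maps k"
  shows "sigma_z mx my k \<sigma> \<in> mot_deg (k + 2 * ((CARD('n) - 1) * (2 ^ k - 1)))"
  unfolding mot_deg_def
proof (rule mot.span_base, rule CollectI, intro exI conjI)
  let ?J = "\<sigma> ` {1..k}"
  show "sigma_z mx my k \<sigma> = tau ^ 0 * (\<Prod>i\<in>UNIV. mx i ^ of_bool (i \<in> ?J))
      * (\<Prod>i\<in>UNIV. my i ^ gap_exp k ?J (mono_gap k \<sigma>) i)"
    unfolding prod_of_bool_power power_0 mult_1_left by (rule sigma_z_eq[OF assms])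
  have "card ?J = k" using card_image[OF Mono_maps_inj[OF assms]] by simp
  then show "(\<Sum>i\<in>UNIV. of_bool (i \<in> ?J)) + 2 * sum (gap_exp k ?J (mono_gap k \<sigma>)) UNIV
      = k + 2 * ((CARD('n) - 1) * (2 ^ k - 1))"
    using sum_top_pairs[OF sigma_z_top[OF assms]] by simp
qed

lemma abs_rmot_sigma_z: "abs_rmot (sigma_z mx my k \<sigma>) = sigma_z nx ny k \<sigma>"
  by (simp add: sigma_z_def abs_rmot_simps abs_rmot_prod abs_rmot_power)

lemma tensor_parts_eq: "tensor (Lambda_part a) (Yn_part b) = F2_span {bmon I e | I e. card I = a \<and> sum e UNIV = b}"
  (is "_ = F2_span ?B")
proof
  have "u * v \<in> F2_span ?B" if "u \<in> Lambda_part a" "v \<in> Yn_part b" for u v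
    using that unfolding Lambda_part_def Yn_part_def
    by (rule F2_span_mult_closed[rotated]) (auto intro!: rmot.span_base)
  then show "tensor (Lambda_part a) (Yn_part b) \<subseteq> F2_span ?B"
    unfolding tensor_def by (intro rmot.span_minimal rmot.subspace_span) auto
  have "?B \<subseteq> {u * v | u v. u \<in> Lambda_part a \<and> v \<in> Yn_part b}"
    unfolding Lambda_part_def Yn_part_def by (fastforce intro: rmot.span_base)
  then show "F2_span ?B \<subseteq> tensor (Lambda_part a) (Yn_part b)"
    unfolding tensor_def by (rule rmot.span_mono)
qed

lemma top_part_eq: "top_part k d1 = F2_span {bmon I e | I e. card I = k \<and> sum e UNIV = d1}"
  unfolding top_part_def by (rule tensor_parts_eq)

lemma top_part_add: "u \<in> top_part k d1 \<Longrightarrow> v \<in> top_part k d1 \<Longrightarrow> u + v \<in> top_part k d1"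
  unfolding top_part_eq by (rule rmot.span_add)

lemma bmon_top_part: "card I = k \<Longrightarrow> sum e UNIV = d1 \<Longrightarrow> bmon I e \<in> top_part k d1"
  unfolding top_part_eq by (rule bmon_in_span) simp

lemma top_part_subset_rmot_deg: "top_part k d1 \<subseteq> rmot_deg (k + 2 * d1)"
  unfolding top_part_eq rmot_deg_eq by (rule rmot.span_mono) auto

section \<open>The projection onto the summand of exterior degree k\<close>

definition off_part :: "nat \<Rightarrow> nat \<Rightarrow> 'n::finite rmot set"
  where "off_part k d1 = F2_span (\<Union>{tensor (Lambda_part a) (Yn_part b) | a b. a + 2 * b = k + 2 * d1 \<and> a \<noteq> k})"

lemma coef_top_part: "v \<in> top_part k d1 \<Longrightarrow> card I \<noteq> k \<Longrightarrow> coef I e v = 0"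
  unfolding top_part_eq
  by (induction rule: F2_span_add_induct) (auto simp: coef_0 coef_add coef_bmon)

lemma coef_off_part: "w \<in> off_part k d1 \<Longrightarrow> card I = k \<Longrightarrow> coef I e w = 0"
  unfolding off_part_def
proof (induction rule: F2_span_add_induct)
  case (add s u)
  then obtain a b where "s \<in> tensor (Lambda_part a) (Yn_part b)" "a \<noteq> k" by auto
  then have "coef I e s = 0"
    unfolding tensor_parts_eq using add.prems
    by (induction rule: F2_span_add_induct) (auto simp: coef_0 coef_add coef_bmon)
  with add show ?case by (simp add: coef_add)
qed (simp add: coef_0)

text \<open>Coefficients at x_I y^e with |I| = k vanish on the complement, the others on the top
  summand. The decomposition in the definite description of \<open>pr\<close> is therefore
  unique.\<close>

lemma pr_add:
  assumes "v \<in> top_part k d1" "w \<in> off_part k d1"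
  shows "pr k d1 (v + w) = v"
  unfolding pr_def off_part_def[symmetric]
proof (rule the_equality)
  fix v' assume "v' \<in> top_part k d1 \<and> (\<exists>w' \<in> off_part k d1. v + w = v' + w')"
  then obtain w' where v': "v' \<in> top_part k d1" "w' \<in> off_part k d1" "v + w = v' + w'" by blast
  have "v + v' = 0"
  proof (rule rmot_eq_0)
    fix I and e :: "'a \<Rightarrow> nat"
    show "coef I e (v + v') = 0"
    proof (cases "card I = k")
      case True
      have "coef I e v + coef I e w = coef I e v' + coef I e w'"
        using v'(3) by (metis coef_add)
      then have "coef I e v = coef I e v'"
        using True assms(2) v'(2) by (simp only: coef_off_part add_0_right)
      then show ?thesis by (simp add: coef_add)
    next
      case False
      then show ?thesis using assms(1) v'(1) by (simp add: coef_add coef_top_part)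
    qed
  qed
  then show "v' = v" by (metis rmot_minus eq_iff_diff_eq_0)
qed (use assms in auto)

lemma off_part_add: "u \<in> off_part k d1 \<Longrightarrow> v \<in> off_part k d1 \<Longrightarrow> u + v \<in> off_part k d1"
  unfolding off_part_def by (rule rmot.span_add)

lemma zero_off_part: "0 \<in> off_part k d1"
  unfolding off_part_def by (rule rmot.span_zero)

lemma zero_top_part: "0 \<in> top_part k d1"
  unfolding top_part_eq by (rule rmot.span_zero)

lemma pr_top_part: "v \<in> top_part k d1 \<Longrightarrow> pr k d1 v = v"
  using pr_add[OF _ zero_off_part, of v] by simp

lemma rmot_deg_split:
  assumes "u \<in> rmot_deg (k + 2 * d1)"
  obtains v w where "v \<in> top_part k d1" "w \<in> off_part k d1" "u = v + w"
proof -
  have "\<exists>v\<in>top_part k d1. \<exists>w\<in>off_part k d1. u = v + w"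
    using assms unfolding rmot_deg_eq
  proof (induction rule: F2_span_add_induct)
    case zero
    then show ?case using zero_off_part zero_top_part by (metis add_0_left)
  next
    case (add s u)
    then obtain I e v w where s: "s = bmon I e" "card I + 2 * sum e UNIV = k + 2 * d1"
      "v \<in> top_part k d1" "w \<in> off_part k d1" "u = v + w" by blast
    show ?case
    proof (cases "card I = k")
      case True
      with s have "s \<in> top_part k d1" by (auto intro: bmon_top_part)
      then show ?thesis using s top_part_add by (metis add.assoc)
    next
      case False
      have "s \<in> tensor (Lambda_part (card I)) (Yn_part (sum e UNIV))"
        unfolding tensor_parts_eq s(1) by (rule bmon_in_span) simp
      then have "s \<in> off_part k d1"
        unfolding off_part_def using s(2) False by (intro rmot.span_base) auto
      then show ?thesis using s off_part_add by (metis add.left_commute)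
    qed
  qed
  then show ?thesis using that by blast
qed

lemma Psi_off_part: "w \<in> off_part k d1 \<Longrightarrow> Psi k w = 0"
  unfolding Psi_def by (rule sum.neutral) (auto simp: coef_off_part top_pairs_def)

section \<open>The local quotient\<close>

lemma top_G_add: "u \<in> top_G p k d1 \<Longrightarrow> v \<in> top_G p k d1 \<Longrightarrow> u + v \<in> top_G p k d1"
  unfolding top_G_def tensor_def by (rule rmot.span_add)

lemma top_G_zero: "0 \<in> top_G p k d1"
  unfolding top_G_def tensor_def by (rule rmot.span_zero)

lemma top_G_sum: "(\<And>b. b \<in> B \<Longrightarrow> h b \<in> top_G p k d1) \<Longrightarrow> sum h B \<in> top_G p k d1"
  unfolding top_G_def tensor_def by (rule rmot.span_sum)

lemma top_G_subset: "top_G p k d1 \<subseteq> top_part k d1"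
  unfolding top_G_def top_part_def tensor_def by (rule rmot.span_mono) auto

lemma mult_top_G:
  assumes "card I = k" "v \<in> Gn p k" "v \<in> Yn_part d1"
  shows "prod nx I * v \<in> top_G p k d1"
proof -
  have "prod nx I \<in> Lambda_part k" unfolding Lambda_part_def using assms(1) by (intro rmot.span_base) auto
  then show ?thesis unfolding top_G_def tensor_def using assms by (intro rmot.span_base) auto
qed

lemma ymon_Yn_part: "sum e UNIV = d1 \<Longrightarrow> ymon e \<in> Yn_part d1"
  unfolding Yn_part_def by (rule rmot.span_base) auto

lemma top_pairs_top_G:
  fixes J :: "'n::finite set"
  assumes "(J, e) \<in> top_pairs k" "(J, e') \<in> top_pairs k" "d1 = (CARD('n) - 1) * (2 ^ k - 1)"
  shows "bmon J e + bmon J e' \<in> top_G red_P k d1"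
proof -
  have "ymon e \<in> Yn_part d1" "ymon e' \<in> Yn_part d1"
    using sum_top_pairs[OF assms(1)] sum_top_pairs[OF assms(2)] assms(3) by (simp_all only: ymon_Yn_part)
  then have "ymon e + ymon e' \<in> Yn_part d1"
    unfolding Yn_part_def by (rule rmot.span_add)
  moreover have "card J = k" using assms(1) by (auto simp: top_pairs_def)
  ultimately have "prod nx J * (ymon e + ymon e') \<in> top_G red_P k d1"
    using top_pairs_congruent[OF assms(1,2)] by (intro mult_top_G)
  then show ?thesis by (simp add: distrib_left)
qed

lemma not_level_full_top_G:
  fixes I :: "'n::finite set"
  assumes "card I = k" "sum e UNIV = d1" "d1 = (CARD('n) - 1) * (2 ^ k - 1)" "\<not> level_full k e"
  shows "bmon I e \<in> top_G p k d1"
  using assms by (intro mult_top_G ymon_in_Gn ymon_Yn_part) auto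

text \<open>The factor x_I can be moved inside each P^a, so values of positive operations on Y
  contribute 0; lexicographically smaller monomials are not level full and hence are not top
  monomials.\<close>

lemma Psi_top_G: "u \<in> top_G red_P k d1 \<Longrightarrow> Psi k u = 0"
  unfolding top_G_def tensor_def
proof (induction rule: F2_span_add_induct)
  case (add s u)
  then obtain l v where s: "s = l * v" "l \<in> Lambda_part k" "v \<in> Gn red_P k" by auto
  have nx: "Psi k (prod nx I * v) = 0" for I
    using s(3) unfolding Gn_def
  proof (induction rule: F2_span_add_induct)
    case (add t v)
    from add.hyps(1) have "Psi k (prod nx I * t) = 0"
    proof
      assume "t \<in> P_plus_Y red_P"
      then show ?thesis unfolding P_plus_Y_def
      proof (induction rule: positive_values_induct)
        case (gen r s f u)
        then show ?case by (auto simp: powers_def Psi_red_P simp flip: red_P_prod_nx)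
      qed (simp_all add: rmot_two Psi_0 Psi_add distrib_left)
    next
      assume "t \<in> {ymon e |e. (map (\<lambda>j. omega j e) [1..<Suc k], replicate k (CARD('a) - 1)) \<in> lex less_than}"
      then obtain e where "t = ymon e" "\<not> level_full k e" using level_full_not_less by blast
      then show ?thesis using level_full_top_pairs by (auto simp: Psi_bmon)
    qed
    with add.IH show ?case by (simp add: distrib_left Psi_add)
  qed (simp add: Psi_0)
  have "Psi k (l * v) = 0"
    using s(2) unfolding Lambda_part_def
  proof (induction rule: F2_span_add_induct)
    case (add m u)
    then obtain I where "m = prod nx I" by blast
    with add.IH nx show ?case by (simp add: distrib_right Psi_add)
  qed (simp add: Psi_0)
  with add.IH show ?case by (simp add: s(1) Psi_add)
qed (simp add: Psi_0)

lemma quo_map_eq: "quo_map p k d1 u = (\<lambda>h. h + u) ` top_G p k d1"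
  by (auto simp: quo_map_def r_coset_def add_grp_def)

lemma quo_map_eq_iff: "quo_map p k d1 u = quo_map p k d1 v \<longleftrightarrow> u + v \<in> top_G p k d1"
proof
  assume "quo_map p k d1 u = quo_map p k d1 v"
  moreover have "u \<in> quo_map p k d1 u"
    unfolding quo_map_eq using top_G_zero by (intro image_eqI[of _ _ 0]) simp_all
  ultimately obtain h where "h \<in> top_G p k d1" "u = h + v" unfolding quo_map_eq by auto
  then show "u + v \<in> top_G p k d1" by (simp add: add.assoc rmot_double)
next
  have sub: "quo_map p k d1 u \<subseteq> quo_map p k d1 v" if "u + v \<in> top_G p k d1" for u v
  proof
    fix x assume "x \<in> quo_map p k d1 u"
    then obtain h where h: "h \<in> top_G p k d1" "x = h + u" by (auto simp: quo_map_eq)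
    then have "x = (h + (u + v)) + v" by (simp add: add.assoc rmot_double)
    with top_G_add[OF h(1) that] show "x \<in> quo_map p k d1 v" unfolding quo_map_eq by blast
  qed
  assume "u + v \<in> top_G p k d1"
  with sub[of u v] sub[of v u] show "quo_map p k d1 u = quo_map p k d1 v" by (simp add: add.commute)
qed

section \<open>Group structure of the local quotient\<close>

lemma comm_group_add_grp:
  fixes C :: "'a::ab_group_add set"
  assumes "0 \<in> C" "\<And>u v. u \<in> C \<Longrightarrow> v \<in> C \<Longrightarrow> u + v \<in> C" "\<And>u. u \<in> C \<Longrightarrow> - u \<in> C"
  shows "comm_group (add_grp C)"
proof (rule comm_groupI)
  show "\<exists>y\<in>carrier (add_grp C). y \<otimes>\<^bsub>add_grp C\<^esub> x = \<one>\<^bsub>add_grp C\<^esub>" if "x \<in> carrier (add_grp C)" for x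
    using that assms(3)[of x] by (auto simp: add_grp_def intro!: bexI[of _ "- x"])
qed (use assms in \<open>auto simp: add_grp_def add_ac\<close>)

lemma comm_group_top_part: "comm_group (add_grp (top_part k d1))"
  by (rule comm_group_add_grp) (simp_all add: zero_top_part top_part_add rmot_uminus)

lemma subgroup_add_grp:
  fixes C :: "'n rmot set"
  assumes "comm_group (add_grp C)" "H \<subseteq> C" "0 \<in> H" "\<And>u v. u \<in> H \<Longrightarrow> v \<in> H \<Longrightarrow> u + v \<in> H"
  shows "subgroup H (add_grp C)"
proof -
  interpret comm_group "add_grp C" by (rule assms(1))
  show ?thesis
  proof (rule subgroupI)
    fix u assume "u \<in> H"
    then have "inv\<^bsub>add_grp C\<^esub> u = u"
      using assms(2) by (intro inv_equality) (auto simp: add_grp_def rmot_double)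
    with \<open>u \<in> H\<close> show "inv\<^bsub>add_grp C\<^esub> u \<in> H" by simp
  qed (use assms in \<open>auto simp: add_grp_def\<close>)
qed

lemma normal_top_G: "top_G p k d1 \<lhd> add_grp (top_part k d1)"
  by (rule comm_group.subgroup_imp_normal[OF comm_group_top_part subgroup_add_grp])
    (simp_all add: comm_group_top_part top_G_subset top_G_zero top_G_add)

lemma group_quo: "group (quo p k d1)"
  unfolding quo_def by (rule normal.factorgroup_is_group[OF normal_top_G])

lemma quo_map_hom: "quo_map p k d1 \<in> hom (add_grp (top_part k d1)) (quo p k d1)"
  unfolding quo_def quo_map_def[abs_def] by (rule normal.r_coset_hom_Mod[OF normal_top_G])

lemma quo_map_add:
  "u \<in> top_part k d1 \<Longrightarrow> v \<in> top_part k d1 \<Longrightarrow>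
    quo_map p k d1 u \<otimes>\<^bsub>quo p k d1\<^esub> quo_map p k d1 v = quo_map p k d1 (u + v)"
  using hom_mult[OF quo_map_hom, of u k d1 v p] by (simp add: add_grp_def)

lemma carrier_quo: "carrier (quo p k d1) = quo_map p k d1 ` top_part k d1"
  by (auto simp: quo_def FactGroup_def RCOSETS_def quo_map_def add_grp_def)

section \<open>The image of the Bockstein\<close>

lemma zero_A_plus_N: "0 \<in> A_plus_N q p"
  unfolding A_plus_N_def positive_values_def by (rule rmot.span_zero)

lemma A_plus_N_add: "u \<in> A_plus_N q p \<Longrightarrow> v \<in> A_plus_N q p \<Longrightarrow> u + v \<in> A_plus_N q p"
  unfolding A_plus_N_def positive_values_def by (rule rmot.span_add)

lemma red_Q_in_A_plus_N: "red_Q u \<in> A_plus_N red_Q red_P"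
proof -
  have "homog_op ({(1, 0, red_Q)} \<union> powers red_P) 1 0 red_Q"
    by (rule homog_op.gen) simp
  then show ?thesis unfolding A_plus_N_def positive_values_def
    by (intro rmot.span_base) fastforce
qed

lemma sum_Suc_upd: "sum (f(i := Suc (f i))) UNIV = Suc (sum f UNIV)" for i :: "'n::finite"
  by (simp add: sum.remove[of UNIV i])

text \<open>
  For \<open>|I| = k + 1\<close> a suitable monomial \<open>x\<^sub>I y\<^sup>f\<close> has exactly two terms of
  \<open>Q\<^sub>0(x\<^sub>I y\<^sup>f)\<close> that are nonzero locally.
\<close>
lemma red_Q_exchange:
  fixes I :: "'n::finite set"
  assumes "k \<ge> 1" "card I = Suc k" "b \<in> I" "c \<in> I" "b \<noteq> c"
    and d1: "d1 = (CARD('n) - 1) * (2 ^ k - 1)"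
  shows "\<exists>e e' f. (I - {b}, e) \<in> top_pairs k \<and> (I - {c}, e') \<in> top_pairs k \<and>
    red_Q (bmon I f) \<in> top_part k d1 \<and>
    red_Q (bmon I f) + (bmon (I - {b}) e + bmon (I - {c}) e') \<in> top_G red_P k d1"
proof -
  have card_k: "card (I - {i}) = k" if "i \<in> I" for i using assms(2) that by simp
  obtain t0 where t0: "bij_betw t0 (I - {b}) {..<k}"
    using finite_same_card_bij[of "I - {b}" "{..<k}"] card_k[OF assms(3)] by auto
  \<comment> \<open>Renumbers the levels so that c has its gap at level 0; its exponent is then 2^k
    - 2, the value that will also be given to b.\<close>
  define t where "t = Transposition.transpose (t0 c) 0 \<circ> t0"
  have "t0 c < k" using t0 assms(4,5) by (auto simp: bij_betw_def)
  then have t: "bij_betw t (I - {b}) {..<k}"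
    unfolding t_def using assms(1) t0 by (intro bij_betw_transpose_lessThan) auto
  have tc: "t c = 0" by (simp add: t_def)
  define e where "e = gap_exp k (I - {b}) t"
  \<comment> \<open>One less than the full exponent at b. Raising b returns e, and raising c returns
    the monomial with the roles of b and c exchanged.\<close>
  define f where "f = e(b := 2 ^ k - 2)"
  define h where "h i = f(i := Suc (f i))" for i
  have k2: "(2::nat) ^ k \<ge> 2" using assms(1) by (cases k) auto
  have "Suc (2 ^ k - 2) = e b"
    using k2 by (simp add: e_def gap_exp_def del: One_nat_def)
  then have hb: "h b = e" by (simp add: h_def f_def)
  have top_b: "(I - {b}, e) \<in> top_pairs k"
    using t card_k[OF assms(3)] by (auto simp: top_pairs_def e_def)
  have "bij_betw (Transposition.transpose b c) (I - {c}) (I - {b})"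
    using assms(3,4) by (intro bij_betw_byWitness[where f' = "Transposition.transpose b c"])
      (auto simp: Transposition.transpose_def)
  then have bij: "bij_betw (t \<circ> Transposition.transpose b c) (I - {c}) {..<k}"
    using t by (rule bij_betw_trans)
  have "h c = gap_exp k (I - {c}) (t \<circ> Transposition.transpose b c)"
    using assms(3-5) tc k2
    by (auto simp: fun_eq_iff h_def f_def e_def gap_exp_def Transposition.transpose_def)
  then have top_c: "(I - {c}, h c) \<in> top_pairs k"
    using bij card_k[OF assms(4)] by (auto simp: top_pairs_def)
  have sum_h: "sum (h i) UNIV = d1" for i
  proof -
    have "sum (h i) UNIV = sum (h b) UNIV" unfolding h_def sum_Suc_upd ..
    then show ?thesis using sum_top_pairs[OF top_b] by (simp only: hb d1)
  qed
  have Q: "red_Q (bmon I f) = (\<Sum>i\<in>I. bmon (I - {i}) (h i))"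
    unfolding h_def by (rule red_Q_bmon)
  have "red_Q (bmon I f) \<in> top_part k d1"
    unfolding Q top_part_eq using card_k sum_h by (intro rmot.span_sum bmon_in_span) simp
  \<comment> \<open>For the other indices both b and c keep an even exponent, so level 0 has two
    zero digits and the term lies in G.\<close>
  moreover have "bmon (I - {i}) (h i) \<in> top_G red_P k d1" if "i \<in> I - {b, c}" for i
  proof (rule not_level_full_top_G[OF card_k sum_h d1])
    have "h i b = 2 * (2 ^ (k - 1) - 1)" "h i c = 2 * (2 ^ (k - 1) - 1)"
      using that assms(1,4,5) tc k2 by (cases k; auto simp: h_def f_def e_def gap_exp_def)+
    then show "\<not> level_full k (h i)"
      using level_full_two_zeros[of k "h i" 0 b c] assms(1,5) by auto
  qed (use that in simp)
  then have "(\<Sum>i\<in>I - {b, c}. bmon (I - {i}) (h i)) \<in> top_G red_P k d1" by (rule top_G_sum)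
  moreover have "red_Q (bmon I f) + (bmon (I - {b}) e + bmon (I - {c}) (h c))
      = (\<Sum>i\<in>I - {b, c}. bmon (I - {i}) (h i))"
  proof -
    have "red_Q (bmon I f) = (\<Sum>i\<in>I - {b, c}. bmon (I - {i}) (h i)) + (\<Sum>i\<in>{b, c}. bmon (I - {i}) (h i))"
      unfolding Q using assms(3,4) by (intro sum.subset_diff) auto
    also have "(\<Sum>i\<in>{b, c}. bmon (I - {i}) (h i)) = bmon (I - {b}) e + bmon (I - {c}) (h c)"
      using assms(5) by (simp add: hb)
    finally show ?thesis by (simp add: add.assoc rmot_double)
  qed
  ultimately show ?thesis
    using top_b top_c by (intro exI[of _ e] exI[of _ "h c"] exI[of _ f] conjI) (simp_all only:)
qed

text \<open>The hit is required to lie in the top summand, where \<open>pr\<close> is the identity,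
  so that its image under \<open>theta\<close> can be read off.\<close>

definition local_hit :: "nat \<Rightarrow> nat \<Rightarrow> 'n::finite rmot \<Rightarrow> bool"
  where "local_hit k d1 m \<longleftrightarrow> (\<exists>a \<in> A_plus_N red_Q red_P \<inter> top_part k d1. a + m \<in> top_G red_P k d1)"

lemma local_hit_add:
  assumes "local_hit k d1 u" "local_hit k d1 v"
  shows "local_hit k d1 (u + v)"
proof -
  obtain a b where ab: "a \<in> A_plus_N red_Q red_P \<inter> top_part k d1" "a + u \<in> top_G red_P k d1"
    "b \<in> A_plus_N red_Q red_P \<inter> top_part k d1" "b + v \<in> top_G red_P k d1"
    using assms by (auto simp: local_hit_def)
  have "(a + u) + (b + v) = (a + b) + (u + v)" by (simp add: add_ac)
  with top_G_add[OF ab(2,4)] have "(a + b) + (u + v) \<in> top_G red_P k d1" by simp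
  moreover have "a + b \<in> A_plus_N red_Q red_P \<inter> top_part k d1"
    using ab A_plus_N_add top_part_add by blast
  ultimately show ?thesis unfolding local_hit_def by blast
qed

lemma local_hit_top_G: "u \<in> top_G red_P k d1 \<Longrightarrow> local_hit k d1 u"
  unfolding local_hit_def using zero_A_plus_N zero_top_part by (intro bexI[of _ 0]) auto

lemma local_hit_chain:
  assumes "local_hit k d1 (u + v)" "local_hit k d1 (v + w)"
  shows "local_hit k d1 (u + w)"
proof -
  have "(u + v) + (v + w) = u + w" by (simp add: add.assoc rmot_add_self_left)
  with local_hit_add[OF assms] show ?thesis by simp
qed

text \<open>Induction on |J - J'|: exchange some c in J - J' for some b in J' - J. First the
  exponent is changed for fixed J modulo G, then the Bockstein makes the exchange, and the rest is
  the induction hypothesis.\<close>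

lemma local_hit_top_pairs:
  fixes J J' :: "'n::finite set"
  assumes "k \<ge> 1" "d1 = (CARD('n) - 1) * (2 ^ k - 1)"
    and "(J, e) \<in> top_pairs k" "(J', e') \<in> top_pairs k"
  shows "local_hit k d1 (bmon J e + bmon J' e')"
  using assms(3,4)
proof (induction "card (J - J')" arbitrary: J e)
  case 0
  then have "card J = k" "card J' = k" "J \<subseteq> J'" by (auto simp: top_pairs_def)
  then have "J = J'" by (metis card_subset_eq finite)
  have "bmon J e + bmon J' e' \<in> top_G red_P k d1"
    using 0(2,3) assms(2) unfolding \<open>J = J'\<close> by (rule top_pairs_top_G)
  then show ?case by (rule local_hit_top_G)
next
  case (Suc m)
  have cards: "card J = k" "card J' = k" using Suc.prems by (auto simp: top_pairs_def)
  obtain c where c: "c \<in> J" "c \<notin> J'" using Suc.hyps(2) by (metis Diff_eq_empty_iff card.empty nat.distinct(1) subsetI)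
  have "\<not> J' \<subseteq> J" using cards c by (metis card_subset_eq finite)
  then obtain b where b: "b \<in> J'" "b \<notin> J" by blast
  let ?I = "insert b J"
  have "b \<noteq> c" using b c by auto
  moreover have "card ?I = Suc k" using b cards by simp
  moreover have "?I - {b} = J" using b by auto
  ultimately obtain e1 e2 f where Q: "(J, e1) \<in> top_pairs k" "(?I - {c}, e2) \<in> top_pairs k"
    "red_Q (bmon ?I f) \<in> top_part k d1"
    "red_Q (bmon ?I f) + (bmon J e1 + bmon (?I - {c}) e2) \<in> top_G red_P k d1"
    using red_Q_exchange[OF assms(1), of ?I b c d1] assms(2) c by auto
  have "local_hit k d1 (bmon J e + bmon J e1)"
    using Suc.prems(1) Q(1) assms(2) by (intro local_hit_top_G top_pairs_top_G)
  moreover have "local_hit k d1 (bmon J e1 + bmon (?I - {c}) e2)"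
    unfolding local_hit_def using Q(3,4) red_Q_in_A_plus_N by blast
  moreover have "local_hit k d1 (bmon (?I - {c}) e2 + bmon J' e')"
  proof (rule Suc.hyps(1)[OF _ Q(2) Suc.prems(2)])
    have "?I - {c} - J' = (J - J') - {c}" using b by auto
    then show "m = card (?I - {c} - J')" using Suc.hyps(2) c by (simp del: Diff_insert)
  qed
  ultimately show ?case by (blast intro: local_hit_chain)
qed

lemma M1_cases:
  assumes "m \<in> M1 k"
  obtains J e where "m = bmon J e" "(J, e) \<in> top_pairs k"
  using assms unfolding M1_def by (auto elim: sigma_z_bmon)

lemma Psi_M1: "m \<in> M1 k \<Longrightarrow> Psi k m = 1"
  by (auto elim!: M1_cases simp: Psi_bmon)

text \<open>Modulo local hits each element of M1 equals the reference z, so the sum over B equals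
  |B| z.\<close>

lemma local_hit_M1_sum:
  fixes B :: "'n::{finite,linorder} rmot set"
  assumes "k \<ge> 1" "d1 = (CARD('n) - 1) * (2 ^ k - 1)" "z \<in> M1 k" "finite B" "B \<subseteq> M1 k"
  shows "local_hit k d1 (\<Sum>B + (if odd (card B) then z else 0))"
  using assms(4,5)
proof (induction B rule: finite_induct)
  case empty
  show ?case by (simp add: local_hit_top_G top_G_zero)
next
  case (insert s B)
  have "local_hit k d1 (s + z)"
    using assms(1-3) insert.prems by (auto elim!: M1_cases intro!: local_hit_top_pairs)
  moreover have "local_hit k d1 (\<Sum>B + (if odd (card B) then z else 0))"
    using insert.prems by (intro insert.IH) simp
  ultimately have "local_hit k d1 ((s + z) + (\<Sum>B + (if odd (card B) then z else 0)))"
    by (rule local_hit_add)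
  moreover have "(s + z) + (\<Sum>B + (if odd (card B) then z else 0))
      = \<Sum>(insert s B) + (if odd (card (insert s B)) then z else 0)"
    using insert.hyps by (simp add: add_ac rmot_add_self_left rmot_two)
  ultimately show ?case by simp
qed

lemma local_hit_span_M1:
  fixes m :: "'n::{finite,linorder} rmot"
  assumes "k \<ge> 1" "d1 = (CARD('n) - 1) * (2 ^ k - 1)" "m \<in> F2_span (M1 k)" "Psi k m = 0"
  shows "local_hit k d1 m"
proof -
  obtain B where B: "finite B" "B \<subseteq> M1 k" "m = \<Sum>B"
    using assms(3) unfolding F2_span_eq_subset_sums by blast
  have "Psi k m = (\<Sum>b\<in>B. of_bool True)"
    unfolding B(3) Psi_sum using B(2) by (intro sum.cong) (auto simp: Psi_M1)
  then have even: "even (card B)" using assms(4) by (simp only: sum_of_bool_bit[OF B(1)]) simp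
  show ?thesis
  proof (cases "B = {}")
    case True
    then show ?thesis by (simp add: B(3) local_hit_top_G top_G_zero)
  next
    case False
    then obtain z where "z \<in> B" by blast
    then have "z \<in> M1 k" using B(2) by blast
    from local_hit_M1_sum[OF assms(1,2) this B(1,2)] even show ?thesis by (simp add: B(3))
  qed
qed

section \<open>The functional \<open>\<epsilon>\<close> and the projection \<open>\<theta>\<close>\<close>

lemma Psi_quo_map: "quo_map red_P k d1 u = quo_map red_P k d1 v \<Longrightarrow> Psi k u = Psi k v"
  unfolding quo_map_eq_iff using Psi_top_G[of "u + v" k d1]
  by (cases "Psi k u"; cases "Psi k v") (simp_all add: Psi_add)

lemma span_M1_coefficients:
  assumes "m \<in> F2_span (M1 k)"
  shows "\<exists>c. m = (\<Sum>\<sigma>\<in>Mono_maps k. f2_scale (c \<sigma>) (sigma_z nx ny k \<sigma>))"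
  using assms
proof (induction rule: F2_span_add_induct)
  case zero
  show ?case by (rule exI[of _ "\<lambda>_. 0"]) (simp add: f2_scale_def)
next
  case (add s u)
  then obtain c where c: "u = (\<Sum>\<sigma>\<in>Mono_maps k. f2_scale (c \<sigma>) (sigma_z nx ny k \<sigma>))" by blast
  obtain \<rho> where \<rho>: "\<rho> \<in> Mono_maps k" "s = sigma_z nx ny k \<rho>" using add.hyps by (auto simp: M1_def)
  have "(\<Sum>\<sigma>\<in>Mono_maps k. f2_scale (of_bool (\<sigma> = \<rho>)) (sigma_z nx ny k \<sigma>)) = s"
    using \<rho> by (simp add: finite_Mono_maps f2_scale_def sum.delta' cong: if_cong)
  then have "s + u = (\<Sum>\<sigma>\<in>Mono_maps k. f2_scale (of_bool (\<sigma> = \<rho>) + c \<sigma>) (sigma_z nx ny k \<sigma>))"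
    by (simp only: f2_scale_add_left[OF rmot_two] sum.distrib c)
  then show ?case by (rule exI[of _ "\<lambda>\<sigma>. of_bool (\<sigma> = \<rho>) + c \<sigma>"])
qed

lemma Psi_combination:
  "Psi k (\<Sum>\<sigma>\<in>Mono_maps k. f2_scale (c \<sigma>) (sigma_z nx ny k \<sigma>)) = (\<Sum>\<sigma>\<in>Mono_maps k. c \<sigma>)"
proof -
  have "Psi k (f2_scale (c \<sigma>) (sigma_z nx ny k \<sigma>)) = c \<sigma>" if "\<sigma> \<in> Mono_maps k" for \<sigma>
    using that by (cases "c \<sigma>") (simp_all add: f2_scale_def Psi_0 Psi_sigma_z)
  then show ?thesis unfolding Psi_sum by (rule sum.cong[OF refl])
qed

text \<open>The coefficient sum is the value of \<open>Psi\<close>, which vanishes on G; it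
  therefore depends only on the class, which makes the definite description in \<open>eps\<close>
  meaningful.\<close>

lemma eps_quo_map:
  assumes "m \<in> F2_span (M1 k)"
  shows "eps red_P k d1 (quo_map red_P k d1 m) = Psi k m"
  unfolding eps_def
proof (rule the_equality)
  obtain c where c: "m = (\<Sum>\<sigma>\<in>Mono_maps k. f2_scale (c \<sigma>) (sigma_z nx ny k \<sigma>))"
    using span_M1_coefficients[OF assms] by blast
  then show "\<exists>c. Psi k m = sum c (Mono_maps k) \<and>
      quo_map red_P k d1 m = quo_map red_P k d1 (\<Sum>\<sigma>\<in>Mono_maps k. f2_scale (c \<sigma>) (sigma_z nx ny k \<sigma>))"
    using Psi_combination by blast
next
  fix e assume "\<exists>c. e = sum c (Mono_maps k) \<and>
      quo_map red_P k d1 m = quo_map red_P k d1 (\<Sum>\<sigma>\<in>Mono_maps k. f2_scale (c \<sigma>) (sigma_z nx ny k \<sigma>))"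
  then show "e = Psi k m" using Psi_quo_map Psi_combination by metis
qed

section \<open>Consequences of a chosen basis complement M0\<close>

locale local_basis =
  fixes k d1 :: nat and M0 :: "'n::{finite,linorder} rmot set"
  assumes k_pos: "k \<ge> 1" and k_less: "k < CARD('n)"
    and d1: "d1 = (CARD('n) - 1) * (2 ^ k - 1)"
    and basis: "basis_complement red_P k d1 M0"
begin

lemma M0_monomials: "M0 \<subseteq> {bmon I e | I e. card I = k \<and> sum e UNIV = d1}"
  and M0_M1_disjoint: "M0 \<inter> M1 k = {}"
  and quo_map_inj: "inj_on (quo_map red_P k d1) (M0 \<union> M1 k)"
  and quo_basis: "Z \<in> carrier (quo red_P k d1) \<Longrightarrow>
    \<exists>!B. finite B \<and> B \<subseteq> M0 \<union> M1 k \<and> Z = quo_map red_P k d1 (\<Sum>B)"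
  using basis unfolding basis_complement_def by simp_all

lemma span_M0_subset: "F2_span M0 \<subseteq> top_part k d1"
  unfolding top_part_eq by (rule rmot.span_mono[OF M0_monomials])

lemma span_M1_subset: "F2_span (M1 k :: 'n rmot set) \<subseteq> top_part k d1"
  unfolding top_part_eq
proof (rule rmot.span_mono, rule subsetI)
  fix m :: "'n rmot" assume "m \<in> M1 k"
  then obtain J e where "m = bmon J e" "(J, e) \<in> top_pairs k" by (rule M1_cases)
  moreover from this(2) have "card J = k" by (auto simp: top_pairs_def)
  moreover note sum_top_pairs[OF \<open>(J, e) \<in> top_pairs k\<close>]
  ultimately show "m \<in> {bmon I e | I e. card I = k \<and> sum e UNIV = d1}" unfolding d1 by blast
qed

text \<open>A top monomial x_I y^e has the same class as the \<sigma>(z_k) with image I. Injectivity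
  of the classes on M0 and M1 together would put that \<sigma>(z_k) into M0, contrary to
  disjointness.\<close>

lemma Psi_M0:
  assumes "m \<in> M0"
  shows "Psi k m = 0"
proof -
  obtain I e where m: "m = bmon I e" "card I = k" using assms M0_monomials by blast
  have "(I, e) \<notin> top_pairs k"
  proof
    assume top: "(I, e) \<in> top_pairs k"
    obtain \<sigma> where \<sigma>: "\<sigma> \<in> Mono_maps k" "\<sigma> ` {1..k} = I" using Mono_maps_exists[OF m(2)] by blast
    obtain e' where e': "sigma_z nx ny k \<sigma> = bmon I e'" "(I, e') \<in> top_pairs k"
      using sigma_z_bmon[OF \<sigma>(1)] unfolding \<sigma>(2) by blast
    have M1: "sigma_z nx ny k \<sigma> \<in> M1 k" using \<sigma>(1) by (simp add: M1_def)
    have "quo_map red_P k d1 m = quo_map red_P k d1 (sigma_z nx ny k \<sigma>)"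
      unfolding quo_map_eq_iff m e'(1) using top e'(2) d1 by (rule top_pairs_top_G)
    then have "m = sigma_z nx ny k \<sigma>" using assms M1 by (intro inj_onD[OF quo_map_inj]) simp_all
    then show False using assms M1 M0_M1_disjoint by auto
  qed
  then show ?thesis by (simp add: m(1) Psi_bmon)
qed

lemma Psi_span_M0: "m \<in> F2_span M0 \<Longrightarrow> Psi k m = 0"
  by (induction rule: F2_span_add_induct) (simp_all add: Psi_0 Psi_add Psi_M0)

lemma quo_map_decomposition:
  assumes "u \<in> top_part k d1"
  obtains m0 m1 where "m0 \<in> F2_span M0" "m1 \<in> F2_span (M1 k)"
    "quo_map red_P k d1 u = quo_map red_P k d1 (m0 + m1)"
proof -
  have "quo_map red_P k d1 u \<in> carrier (quo red_P k d1)" using assms by (simp add: carrier_quo)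
  from ex1_implies_ex[OF quo_basis[OF this]]
  obtain B where B: "finite B" "B \<subseteq> M0 \<union> M1 k" "quo_map red_P k d1 u = quo_map red_P k d1 (\<Sum>B)"
    by (elim exE conjE)
  have "\<Sum>B = \<Sum>(B - M1 k) + \<Sum>(B \<inter> M1 k)"
    using B(1) by (simp add: sum.Int_Diff[of B _ "M1 k"] add.commute)
  moreover have "\<Sum>(B - M1 k) \<in> F2_span M0" "\<Sum>(B \<inter> M1 k) \<in> F2_span (M1 k)"
    using B(2) by (auto intro!: rmot.span_sum intro: rmot.span_base)
  ultimately show ?thesis using that B(3) by metis
qed

lemma proj_M1_quo_map:
  assumes m0: "m0 \<in> F2_span M0" and m1: "m1 \<in> F2_span (M1 k)"
  shows "proj_M1 red_P k d1 M0 (quo_map red_P k d1 (m0 + m1)) = quo_map red_P k d1 m1"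
  unfolding proj_M1_def
proof (rule the_equality)
  show "quo_map red_P k d1 m1 \<in> V_space red_P k d1 \<and> (\<exists>u\<in>U0 red_P k d1 M0.
      quo_map red_P k d1 (m0 + m1) = u \<otimes>\<^bsub>quo red_P k d1\<^esub> quo_map red_P k d1 m1)"
    using assms span_M0_subset span_M1_subset
    by (auto simp: V_space_def U0_def subset_iff quo_map_add intro!: bexI[of _ m0])
next
  fix v assume "v \<in> V_space red_P k d1 \<and> (\<exists>u\<in>U0 red_P k d1 M0.
      quo_map red_P k d1 (m0 + m1) = u \<otimes>\<^bsub>quo red_P k d1\<^esub> v)"
  then obtain m0' m1' where m': "m0' \<in> F2_span M0" "m1' \<in> F2_span (M1 k)" "v = quo_map red_P k d1 m1'"
    "quo_map red_P k d1 (m0 + m1) = quo_map red_P k d1 m0' \<otimes>\<^bsub>quo red_P k d1\<^esub> quo_map red_P k d1 m1'"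
    by (auto simp: V_space_def U0_def)
  have in_top: "m0 \<in> top_part k d1" "m1 \<in> top_part k d1" "m0' \<in> top_part k d1" "m1' \<in> top_part k d1"
    using m0 m1 m'(1,2) span_M0_subset span_M1_subset by auto
  then have eq: "quo_map red_P k d1 (m0 + m1) = quo_map red_P k d1 (m0' + m1')"
    using m'(4) by (simp add: quo_map_add)
  \<comment> \<open>A pair of span elements corresponds to one finite set B, with the second
    component recovered from the part of B in M1. Uniqueness of B for a class then gives uniqueness
    of the projection.\<close>
  have "\<exists>B. finite B \<and> B \<subseteq> M0 \<union> M1 k \<and> n0 + n1 = \<Sum>B \<and> n1 = \<Sum>(B \<inter> M1 k)"
    if n: "n0 \<in> F2_span M0" "n1 \<in> F2_span (M1 k)" for n0 n1 :: "'n rmot"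
  proof -
    obtain B0 where B0: "n0 = \<Sum>B0" "finite B0" "B0 \<subseteq> M0"
      using n(1) unfolding F2_span_eq_subset_sums by (elim CollectE exE conjE)
    obtain B1 where B1: "n1 = \<Sum>B1" "finite B1" "B1 \<subseteq> M1 k"
      using n(2) unfolding F2_span_eq_subset_sums by (elim CollectE exE conjE)
    from B0 B1 have "(B0 \<union> B1) \<inter> M1 k = B1" "B0 \<inter> B1 = {}" using M0_M1_disjoint by auto
    with B0 B1 show ?thesis by (intro exI[of _ "B0 \<union> B1"]) (auto simp: sum.union_disjoint)
  qed
  from this[OF m0 m1] this[OF m'(1,2)] obtain B B' where
    B: "finite B" "B \<subseteq> M0 \<union> M1 k" "m0 + m1 = \<Sum>B" "m1 = \<Sum>(B \<inter> M1 k)" and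
    B': "finite B'" "B' \<subseteq> M0 \<union> M1 k" "m0' + m1' = \<Sum>B'" "m1' = \<Sum>(B' \<inter> M1 k)"
    by (elim exE conjE)
  have "quo_map red_P k d1 (m0 + m1) \<in> carrier (quo red_P k d1)"
    using in_top by (simp add: carrier_quo top_part_add)
  then have "\<exists>!B. finite B \<and> B \<subseteq> M0 \<union> M1 k \<and> quo_map red_P k d1 (m0 + m1) = quo_map red_P k d1 (\<Sum>B)"
    by (rule quo_basis)
  then have "B = B'" by (rule ex1E) (use B B' eq in metis)
  then show "v = quo_map red_P k d1 m1" using m'(3) B(4) B'(4) by simp
qed

lemma theta_top_part:
  assumes "a \<in> top_part k d1" "m0 \<in> F2_span M0" "m1 \<in> F2_span (M1 k)" "a + (m0 + m1) \<in> top_G red_P k d1"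
  shows "theta red_P k d1 M0 a = quo_map red_P k d1 m1"
proof -
  have "quo_map red_P k d1 a = quo_map red_P k d1 (m0 + m1)" using assms(4) by (simp add: quo_map_eq_iff)
  then show ?thesis
    unfolding theta_def pr_top_part[OF assms(1)] using proj_M1_quo_map[OF assms(2,3)] by simp
qed

text \<open>None of the discarded parts matters for \<open>Psi\<close>: it vanishes on the other
  exterior degrees, on G and on the span of M0. This yields the identity of
  \<open>eps_theta\<close>.\<close>

lemma theta_rmot_deg:
  assumes "u \<in> rmot_deg (k + 2 * d1)"
  obtains m where "m \<in> F2_span (M1 k)" "theta red_P k d1 M0 u = quo_map red_P k d1 m" "Psi k m = Psi k u"
proof -
  obtain v w where vw: "v \<in> top_part k d1" "w \<in> off_part k d1" "u = v + w"
    using assms by (rule rmot_deg_split)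
  obtain m0 m1 where m: "m0 \<in> F2_span M0" "m1 \<in> F2_span (M1 k)"
    "quo_map red_P k d1 v = quo_map red_P k d1 (m0 + m1)"
    using vw(1) by (rule quo_map_decomposition)
  have "theta red_P k d1 M0 u = quo_map red_P k d1 m1"
    unfolding theta_def vw(3) pr_add[OF vw(1,2)] m(3) by (rule proj_M1_quo_map[OF m(1,2)])
  moreover have "Psi k m1 = Psi k u"
    using Psi_quo_map[OF m(3)] by (simp add: vw(3) Psi_add Psi_off_part[OF vw(2)] Psi_span_M0[OF m(1)])
  ultimately show ?thesis using m(2) that by blast
qed

lemma eps_theta: "u \<in> rmot_deg (k + 2 * d1) \<Longrightarrow> eps red_P k d1 (theta red_P k d1 M0 u) = Psi k u"
  by (erule theta_rmot_deg) (simp add: eps_quo_map)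

lemma group_V_grp: "group (V_grp red_P k d1 :: 'n rmot set monoid)"
proof -
  interpret group_hom "add_grp (top_part k d1 :: 'n rmot set)" "quo red_P k d1" "quo_map red_P k d1"
    by (intro group_hom.intro group_hom_axioms.intro comm_group.axioms(2) comm_group_top_part
        group_quo quo_map_hom)
  have "subgroup (F2_span (M1 k)) (add_grp (top_part k d1 :: 'n rmot set))"
    using comm_group_top_part span_M1_subset rmot.span_zero rmot.span_add by (rule subgroup_add_grp)
  then have "subgroup (V_space red_P k d1) (quo red_P k d1 :: 'n rmot set monoid)"
    unfolding V_space_def by (rule subgroup_img_is_subgroup)
  then show ?thesis unfolding V_grp_def by (rule subgroup.subgroup_is_group[OF _ group_quo])
qed

lemma eps_hom: "eps red_P k d1 \<in> hom (V_grp red_P k d1 :: 'n rmot set monoid) (add_grp UNIV)"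
proof (rule homI)
  fix v w :: "'n rmot set" assume "v \<in> carrier (V_grp red_P k d1)" "w \<in> carrier (V_grp red_P k d1)"
  then obtain m m' where m: "m \<in> F2_span (M1 k)" "v = quo_map red_P k d1 m"
    "m' \<in> F2_span (M1 k)" "w = quo_map red_P k d1 m'"
    by (auto simp: V_grp_def V_space_def)
  then have "v \<otimes>\<^bsub>V_grp red_P k d1\<^esub> w = quo_map red_P k d1 (m + m')"
    using span_M1_subset by (auto simp: V_grp_def quo_map_add subset_iff)
  with m show "eps red_P k d1 (v \<otimes>\<^bsub>V_grp red_P k d1\<^esub> w)
      = eps red_P k d1 v \<otimes>\<^bsub>add_grp UNIV\<^esub> eps red_P k d1 w"
    by (simp add: eps_quo_map rmot.span_add Psi_add add_grp_def del: add_bit_eq_xor)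
qed (simp add: add_grp_def)

lemma eps_surj: "eps red_P k d1 ` (V_space red_P k d1 :: 'n rmot set set) = UNIV"
proof -
  obtain J :: "'n set" where "card J = k"
    \<comment> \<open>The bound k < n supplies a k-subset, hence some \<sigma>(z_k), whose image
      under \<open>eps\<close> is 1.\<close>
    using obtain_subset_with_card_n[of k "UNIV :: 'n set"] k_less by auto
  then obtain \<sigma> :: "nat \<Rightarrow> 'n" where \<sigma>: "\<sigma> \<in> Mono_maps k" using Mono_maps_exists by blast
  let ?z = "sigma_z nx ny k \<sigma>"
  have "?z \<in> F2_span (M1 k)" using \<sigma> by (intro rmot.span_base) (simp add: M1_def)
  then have "eps red_P k d1 (quo_map red_P k d1 ?z) = 1" "quo_map red_P k d1 ?z \<in> V_space red_P k d1"
    using \<sigma> by (simp_all add: V_space_def eps_quo_map Psi_sigma_z)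
  then have one: "1 \<in> eps red_P k d1 ` (V_space red_P k d1 :: 'n rmot set set)"
    by (intro image_eqI[of _ _ "quo_map red_P k d1 ?z"]) simp_all
  have "0 \<in> F2_span (M1 k :: 'n rmot set)" by (rule rmot.span_zero)
  then have "eps red_P k d1 (quo_map red_P k d1 (0 :: 'n rmot)) = 0"
    "quo_map red_P k d1 (0 :: 'n rmot) \<in> V_space red_P k d1"
    by (simp_all add: V_space_def eps_quo_map Psi_0)
  then have zero: "0 \<in> eps red_P k d1 ` (V_space red_P k d1 :: 'n rmot set set)"
    by (intro image_eqI[of _ _ "quo_map red_P k d1 (0 :: 'n rmot)"]) simp_all
  have "x \<in> eps red_P k d1 ` (V_space red_P k d1 :: 'n rmot set set)" for x
    using zero one by (cases x) simp_all
  then show ?thesis by blast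
qed

text \<open>\<open>Psi\<close> vanishes on hits, which gives one inclusion. Conversely, a class with
  even coefficient sum is congruent modulo G to a hit in the top summand.\<close>

lemma theta_image:
  "theta red_P k d1 M0 ` (A_plus_N red_Q red_P \<inter> rmot_deg (k + 2 * d1)) =
    kernel (V_grp red_P k d1) (add_grp UNIV) (eps red_P k d1)"
proof (intro equalityI subsetI)
  fix v assume "v \<in> theta red_P k d1 M0 ` (A_plus_N red_Q red_P \<inter> rmot_deg (k + 2 * d1))"
  then obtain u where u: "u \<in> A_plus_N red_Q red_P" "u \<in> rmot_deg (k + 2 * d1)" "v = theta red_P k d1 M0 u"
    by blast
  obtain m where "m \<in> F2_span (M1 k)" "v = quo_map red_P k d1 m"
    using u(2,3) theta_rmot_deg by metis
  then have "v \<in> V_space red_P k d1" by (simp add: V_space_def)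
  moreover have "eps red_P k d1 v = 0"
    using u Psi_A_plus_N[OF k_pos u(1)] by (simp add: eps_theta)
  ultimately show "v \<in> kernel (V_grp red_P k d1) (add_grp UNIV) (eps red_P k d1)"
    by (simp add: kernel_def V_grp_def add_grp_def)
next
  fix v :: "'n rmot set" assume "v \<in> kernel (V_grp red_P k d1) (add_grp UNIV) (eps red_P k d1)"
  then obtain m where m: "m \<in> F2_span (M1 k)" "v = quo_map red_P k d1 m" "Psi k m = 0"
    by (auto simp: kernel_def V_grp_def V_space_def add_grp_def eps_quo_map)
  then have "local_hit k d1 m" using local_hit_span_M1[OF k_pos d1] by blast
  then obtain a where a: "a \<in> A_plus_N red_Q red_P" "a \<in> top_part k d1" "a + m \<in> top_G red_P k d1"
    by (auto simp: local_hit_def)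
  \<comment> \<open>The M0-component is 0 here, since a is congruent to m in the span of M1.\<close>
  then have "v = theta red_P k d1 M0 a"
    using theta_top_part[OF a(2) rmot.span_zero m(1)] m(2) by simp
  with a top_part_subset_rmot_deg show "v \<in> theta red_P k d1 M0 ` (A_plus_N red_Q red_P \<inter> rmot_deg (k + 2 * d1))"
    by blast
qed

end

section \<open>Nonzero classes modulo hits, and assembly of the results\<close>

lemma coset_neq_one:
  fixes C :: "'a::ab_group_add set"
  assumes "0 \<in> H" "u \<notin> H"
  shows "H #>\<^bsub>add_grp C\<^esub> u \<noteq> \<one>\<^bsub>add_grp C Mod H\<^esub>"
proof -
  have "u \<in> H #>\<^bsub>add_grp C\<^esub> u" using assms(1) by (force simp: r_coset_def add_grp_def)
  then show ?thesis using assms(2) by (auto simp: FactGroup_def)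
qed

lemma Psi_sum_sigma_z:
  assumes "S \<subseteq> Mono_maps k" "odd (card S)"
  shows "Psi k (\<Sum>\<sigma>\<in>S. sigma_z nx ny k \<sigma>) = 1"
proof -
  have "finite S" using assms(2) by (metis card.infinite even_zero)
  have "Psi k (\<Sum>\<sigma>\<in>S. sigma_z nx ny k \<sigma>) = (\<Sum>\<sigma>\<in>S. of_bool True)"
    unfolding Psi_sum using assms(1) by (intro sum.cong) (auto simp: Psi_sigma_z)
  then show ?thesis using assms(2) by (simp only: sum_of_bool_bit[OF \<open>finite S\<close>]) simp
qed

lemma sum_sigma_z_not_hit:
  fixes S :: "(nat \<Rightarrow> 'n::{finite,linorder}) set"
  assumes "k \<ge> 1" "d = k + 2 * ((CARD('n) - 1) * (2 ^ k - 1))" "S \<subseteq> Mono_maps k" "odd (card S)"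
  shows "(\<Sum>\<sigma>\<in>S. sigma_z nx ny k \<sigma>) \<in> rmot_deg d"
    and "(A_plus_N red_Q red_P \<inter> rmot_deg d) #>\<^bsub>add_grp (rmot_deg d)\<^esub> (\<Sum>\<sigma>\<in>S. sigma_z nx ny k \<sigma>)
      \<noteq> \<one>\<^bsub>add_grp (rmot_deg d) Mod (A_plus_N red_Q red_P \<inter> rmot_deg d)\<^esub>"
proof -
  show "(\<Sum>\<sigma>\<in>S. sigma_z nx ny k \<sigma>) \<in> rmot_deg d"
    using assms(3) sigma_z_rmot_deg unfolding assms(2) by (subst rmot_deg_def) (auto simp: rmot_deg_def intro!: rmot.span_sum)
  show "(A_plus_N red_Q red_P \<inter> rmot_deg d) #>\<^bsub>add_grp (rmot_deg d)\<^esub> (\<Sum>\<sigma>\<in>S. sigma_z nx ny k \<sigma>)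
      \<noteq> \<one>\<^bsub>add_grp (rmot_deg d) Mod (A_plus_N red_Q red_P \<inter> rmot_deg d)\<^esub>"
  proof (rule coset_neq_one)
    show "0 \<in> A_plus_N red_Q red_P \<inter> rmot_deg d"
      by (simp add: zero_A_plus_N rmot_deg_def rmot.span_zero)
    show "(\<Sum>\<sigma>\<in>S. sigma_z nx ny k \<sigma>) \<notin> A_plus_N red_Q red_P \<inter> rmot_deg d"
      using Psi_A_plus_N[OF assms(1)] Psi_sum_sigma_z[OF assms(3,4)] by force
  qed
qed

lemma motivic_sum_sigma_z_not_hit:
  fixes S :: "(nat \<Rightarrow> 'n::{finite,linorder}) set"
  assumes "motivic_action Q P"
    and "k \<ge> 1" "d = k + 2 * ((CARD('n) - 1) * (2 ^ k - 1))" "S \<subseteq> Mono_maps k" "odd (card S)"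
  shows "(\<Sum>\<sigma>\<in>S. sigma_z mx my k \<sigma>) \<in> mot_deg d"
    and "(A_plus_M Q P \<inter> mot_deg d) #>\<^bsub>add_grp (mot_deg d)\<^esub> (\<Sum>\<sigma>\<in>S. sigma_z mx my k \<sigma>)
      \<noteq> \<one>\<^bsub>add_grp (mot_deg d) Mod (A_plus_M Q P \<inter> mot_deg d)\<^esub>"
proof -
  show "(\<Sum>\<sigma>\<in>S. sigma_z mx my k \<sigma>) \<in> mot_deg d"
    using assms(4) sigma_z_mot_deg unfolding assms(3) by (subst mot_deg_def) (auto simp: mot_deg_def intro!: mot.span_sum)
  have "finite S" using assms(5) by (metis card.infinite even_zero)
  then have abs: "abs_rmot (\<Sum>\<sigma>\<in>S. sigma_z mx my k \<sigma>) = (\<Sum>\<sigma>\<in>S. sigma_z nx ny k \<sigma>)"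
    by (simp add: abs_rmot_sum abs_rmot_sigma_z)
  show "(A_plus_M Q P \<inter> mot_deg d) #>\<^bsub>add_grp (mot_deg d)\<^esub> (\<Sum>\<sigma>\<in>S. sigma_z mx my k \<sigma>)
      \<noteq> \<one>\<^bsub>add_grp (mot_deg d) Mod (A_plus_M Q P \<inter> mot_deg d)\<^esub>"
  proof (rule coset_neq_one)
    show "0 \<in> A_plus_M Q P \<inter> mot_deg d"
      by (simp add: A_plus_M_def positive_values_def mot_deg_def mot.span_zero)
    show "(\<Sum>\<sigma>\<in>S. sigma_z mx my k \<sigma>) \<notin> A_plus_M Q P \<inter> mot_deg d"
      using Psi_A_plus_M[OF assms(1,2), of "\<Sum>\<sigma>\<in>S. sigma_z mx my k \<sigma>"] Psi_sum_sigma_z[OF assms(4,5)]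
      by (auto simp: abs)
  qed
qed

theorem proposition4p2:
  fixes Q :: "'n::{finite,linorder} mot \<Rightarrow> 'n mot" and P :: "nat \<Rightarrow> 'n mot \<Rightarrow> 'n mot"
    and q :: "'n rmot \<Rightarrow> 'n rmot" and p :: "nat \<Rightarrow> 'n rmot \<Rightarrow> 'n rmot"
    and M0 :: "'n rmot set" and k d1 d :: nat
  assumes "CHAR('k::alg_closed_field) \<noteq> 2"
    and "2 \<le> CARD('n)" and "1 \<le> k" and "k < CARD('n)"
    and "d1 = (CARD('n) - 1) * (2 ^ k - 1)" and "d = k + 2 * d1"
    and "motivic_action Q P" and "reduced_action q p"
    and "basis_complement p k d1 M0"
  shows
    "(theta p k d1 M0 ` (A_plus_N q p \<inter> rmot_deg d) =
       kernel (V_grp p k d1) (add_grp UNIV) (eps p k d1)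
     \<and> eps p k d1 \<in> hom (V_grp p k d1) (add_grp UNIV)
     \<and> eps p k d1 ` V_space p k d1 = UNIV
     \<and> V_grp p k d1 Mod (theta p k d1 M0 ` (A_plus_N q p \<inter> rmot_deg d)) \<cong> add_grp (UNIV :: bit set)
     \<and> (\<forall>u \<in> rmot_deg d. eps p k d1 (theta p k d1 M0 u) = 1 \<longrightarrow> u \<notin> A_plus_N q p))
     \<and> (\<forall>S. S \<subseteq> Mono_maps k \<and> odd (card S) \<longrightarrow>
       (\<Sum>\<sigma>\<in>S. sigma_z nx ny k \<sigma>) \<in> rmot_deg d \<and>
       (A_plus_N q p \<inter> rmot_deg d) #>\<^bsub>add_grp (rmot_deg d)\<^esub> (\<Sum>\<sigma>\<in>S. sigma_z nx ny k \<sigma>)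
         \<noteq> \<one>\<^bsub>add_grp (rmot_deg d) Mod (A_plus_N q p \<inter> rmot_deg d)\<^esub>)
     \<and> (\<forall>S. S \<subseteq> Mono_maps k \<and> odd (card S) \<longrightarrow>
       (\<Sum>\<sigma>\<in>S. sigma_z mx my k \<sigma>) \<in> mot_deg d \<and>
       (A_plus_M Q P \<inter> mot_deg d) #>\<^bsub>add_grp (mot_deg d)\<^esub> (\<Sum>\<sigma>\<in>S. sigma_z mx my k \<sigma>)
         \<noteq> \<one>\<^bsub>add_grp (mot_deg d) Mod (A_plus_M Q P \<inter> mot_deg d)\<^esub>)"
proof -
  \<comment> \<open>Uniqueness of the reduced operations transfers all results for the concrete
    operations to the given ones.\<close>
  have p: "p = red_P" and q: "q = red_Q"
    using reduced_action.p_eq_red_P[OF assms(8)] reduced_action.q_eq_red_Q[OF assms(8)] by blast+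
  have d: "d = k + 2 * ((CARD('n) - 1) * (2 ^ k - 1))" using assms(5,6) by simp
  interpret local_basis k d1 M0
    using assms(3-5,9) unfolding p by unfold_locales
  have "comm_group (add_grp (UNIV :: bit set))" by (rule comm_group_add_grp) simp_all
  then interpret E: group_hom "V_grp red_P k d1 :: 'n rmot set monoid" "add_grp (UNIV :: bit set)" "eps red_P k d1"
    by (intro group_hom.intro[OF group_V_grp _ group_hom_axioms.intro[OF eps_hom]] comm_group.axioms(2))
  have "eps red_P k d1 ` carrier (V_grp red_P k d1 :: 'n rmot set monoid) = carrier (add_grp UNIV)"
    using eps_surj by (simp add: V_grp_def add_grp_def)
  \<comment> \<open>First isomorphism theorem for \<open>eps\<close>, whose kernel is the image of
    the hits.\<close>
  then have iso: "V_grp red_P k d1 Mod (theta red_P k d1 M0 ` (A_plus_N red_Q red_P \<inter> rmot_deg d))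
      \<cong> add_grp (UNIV :: bit set)"
    unfolding assms(6) theta_image by (rule E.FactGroup_iso)
  have not_hit: "\<forall>u \<in> rmot_deg d. eps red_P k d1 (theta red_P k d1 M0 u) = 1 \<longrightarrow> u \<notin> A_plus_N red_Q red_P"
  proof (intro ballI impI notI)
    fix u assume u: "u \<in> rmot_deg d" "eps red_P k d1 (theta red_P k d1 M0 u) = 1" "u \<in> A_plus_N red_Q red_P"
    have "Psi k u = 1" using u(1,2) unfolding assms(6) by (simp only: eps_theta)
    then show False using Psi_A_plus_N[OF k_pos u(3)] by simp
  qed
  show ?thesis
    unfolding p q
    by (intro conjI theta_image[folded assms(6)] eps_hom eps_surj iso not_hit allI impI
        sum_sigma_z_not_hit[OF assms(3) d] motivic_sum_sigma_z_not_hit[OF assms(7,3) d]; elim conjE)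
qed

end
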